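(* Let $(M^{2n+1},\phi,\xi,\eta,g)$ be an almost $\alpha$-para-Kenmotsu manifold with para-Kaehler leaves. Let $Q$ be the Ricci operator and $l$ the Jacobi operator $lX=R(X,\xi)\xi$. Then, for every vector field $X$ on $M$, $$Q\phi X-\phi QX=l\phi X-\phi lX-4\alpha(1-n)hX-\eta(X)\,\phi Q\xi+\eta(Q\phi X)\,\xi .$$
   Context: An almost paracontact metric manifold is a smooth manifold $M$ of dimension $2n+1$ with a $(1,1)$-tensor field $\phi$, a vector field $\xi$, a 1-form $\eta$ and a pseudo-Riemannian metric $g$ of signature $(n+1,n)$ such that $\eta(\xi)=1$, $\phi^2=\mathrm{Id}-\eta\otimes\xi$, the eigendistributions of $\phi|_{\ker\eta}$ for the eigenvalues $+1$ and $-1$ both have rank $n$, and $g(\phi X,\phi Y)=-g(X,Y)+\eta(X)\eta(Y)$ (hence $\eta(X)=g(X,\xi)$, $\phi\xi=0$, $\eta\circ\phi=0$). Its fundamental 2-form is $\Phi(X,Y)=g(\phi X,Y)$. It is almost $\alpha$-para-Kenmotsu, where $\alpha$ is a real constant, if $d\eta=0$ and $d\Phi=2\alpha\,\eta\wedge\Phi$ (with $d$ and $\wedge$ normalized compatibly, so that the cyclic sum of $(\nabla_X\Phi)(Y,Z)$ equals $2\alpha$ times the cyclic sum of $\eta(X)\Phi(Y,Z)$). $\nabla$ is the Levi-Civita connection, $R(X,Y)Z=\nabla_X\nabla_YZ-\nabla_Y\nabla_XZ-\nabla_{[X,Y]}Z$, the Ricci tensor is $S(Y,Z)=\mathrm{tr}(X\mapsto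 R(X,Y)Z)$, the Ricci operator is defined by $g(QX,Y)=S(X,Y)$, and $h=\frac12\mathcal{L}_\xi\phi$ (Lie derivative). Since $d\eta=0$, $\ker\eta$ is integrable; each leaf carries the almost para-Hermitian structure $J\bar X=\phi\bar X$, $\langle\bar X,\bar Y\rangle=g(\bar X,\bar Y)$ for $\bar X,\bar Y$ tangent to the leaf. $M$ has para-Kaehler leaves if on every leaf $\bar\nabla J=0$, where $\bar\nabla$ is the Levi-Civita connection of $\langle\cdot,\cdot\rangle$. *)

theory Defs
  imports "HOL-Analysis.Analysis" "HOL-Library.Function_Algebras"
begin

section \<open>Smooth manifolds\<close>

primrec Ck_on :: "nat \<Rightarrow> ('a::real_normed_vector \<Rightarrow> 'b::real_normed_vector) \<Rightarrow> 'a set \<Rightarrow> bool" where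
  "Ck_on 0 f S \<longleftrightarrow> continuous_on S f"
| "Ck_on (Suc k) f S \<longleftrightarrow>
     (\<forall>x\<in>S. f differentiable (at x)) \<and> (\<forall>v. Ck_on k (\<lambda>x. frechet_derivative f (at x) v) S)"

text \<open>Used for open sets \<open>S\<close> of a Euclidean space only.\<close>
definition smooth_on :: "('a::real_normed_vector \<Rightarrow> 'b::real_normed_vector) \<Rightarrow> 'a set \<Rightarrow> bool" where
  "smooth_on f S \<longleftrightarrow> (\<forall>k. Ck_on k f S)"

type_synonym ('m, 'e) chart = "'m set \<times> ('m \<Rightarrow> 'e)"

definition is_chart :: "('m::topological_space, 'e::euclidean_space) chart \<Rightarrow> bool" where
  "is_chart c \<longleftrightarrow> (case c of (U, \<kappa>) \<Rightarrow>
     open U \<and> open (\<kappa> ` U) \<and> homeomorphism U (\<kappa> ` U) \<kappa> (inv_into U \<kappa>))"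

definition smooth_transition ::
  "('m::topological_space, 'e::euclidean_space) chart \<Rightarrow> ('m, 'e) chart \<Rightarrow> bool" where
  "smooth_transition c d \<longleftrightarrow> (case (c, d) of ((U, \<kappa>), (V, \<mu>)) \<Rightarrow>
     smooth_on (\<mu> \<circ> inv_into U \<kappa>) (\<kappa> ` (U \<inter> V)))"

definition smooth_atlas :: "('m::topological_space, 'e::euclidean_space) chart set \<Rightarrow> bool" where
  "smooth_atlas A \<longleftrightarrow>
     (\<forall>c\<in>A. is_chart c) \<and> (\<Union>c\<in>A. fst c) = UNIV \<and> (\<forall>c\<in>A. \<forall>d\<in>A. smooth_transition c d)"

text \<open>The maximal atlas determined by \<open>A\<close>.\<close>
definition smooth_charts ::
  "('m::topological_space, 'e::euclidean_space) chart set \<Rightarrow> ('m, 'e) chart set" where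
  "smooth_charts A =
     {c. is_chart c \<and> (\<forall>d\<in>A. smooth_transition c d \<and> smooth_transition d c)}"

definition smooth_functions ::
  "('m::topological_space, 'e::euclidean_space) chart set \<Rightarrow> ('m \<Rightarrow> real) set" where
  "smooth_functions A = {f. \<forall>(U, \<kappa>)\<in>A. smooth_on (f \<circ> inv_into U \<kappa>) (\<kappa> ` U)}"


section \<open>Vector fields and tensor fields over an algebra of smooth functions\<close>

text \<open>
  Vector fields are the derivations of the algebra \<open>C\<close> of smooth functions, and tensor fields are
  the \<open>C\<close>-multilinear maps on vector fields. The same definitions serve for the manifold itself,
  with \<open>C = smooth_functions A\<close>, and for the leaves, whose smooth functions are extended by \<open>0\<close>
  to the ambient type. Derivations are \<open>0\<close> outside \<open>C\<close>, so that equality of vector fields is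
  equality of functions.
\<close>

type_synonym 'm vfield = "('m \<Rightarrow> real) \<Rightarrow> ('m \<Rightarrow> real)"

definition vector_fields :: "('m \<Rightarrow> real) set \<Rightarrow> 'm vfield set" where
  "vector_fields C = {X.
     (\<forall>f\<in>C. X f \<in> C) \<and>
     (\<forall>f\<in>C. \<forall>g\<in>C. X (f + g) = X f + X g) \<and>
     (\<forall>c::real. \<forall>f\<in>C. X ((\<lambda>_. c) * f) = (\<lambda>_. c) * X f) \<and>
     (\<forall>f\<in>C. \<forall>g\<in>C. X (f * g) = X f * g + f * X g) \<and>
     (\<forall>f. f \<notin> C \<longrightarrow> X f = 0)}"

definition fmul :: "('m \<Rightarrow> real) \<Rightarrow> 'm vfield \<Rightarrow> 'm vfield" (infixr "\<odot>" 75) where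
  "f \<odot> X = (\<lambda>u. f * X u)"

definition cmul :: "real \<Rightarrow> 'm vfield \<Rightarrow> 'm vfield" where
  "cmul c X = (\<lambda>_. c) \<odot> X"

definition bracket :: "'m vfield \<Rightarrow> 'm vfield \<Rightarrow> 'm vfield" where
  "bracket X Y = (\<lambda>f. X (Y f) - Y (X f))"

definition one_form :: "('m \<Rightarrow> real) set \<Rightarrow> ('m vfield \<Rightarrow> 'm \<Rightarrow> real) \<Rightarrow> bool" where
  "one_form C \<omega> \<longleftrightarrow>
     (\<forall>X\<in>vector_fields C. \<omega> X \<in> C) \<and>
     (\<forall>X\<in>vector_fields C. \<forall>Y\<in>vector_fields C. \<omega> (X + Y) = \<omega> X + \<omega> Y) \<and>
     (\<forall>f\<in>C. \<forall>X\<in>vector_fields C. \<omega> (f \<odot> X) = f * \<omega> X)"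

text \<open>Tensor fields of type (1,1).\<close>
definition endo_field :: "('m \<Rightarrow> real) set \<Rightarrow> ('m vfield \<Rightarrow> 'm vfield) \<Rightarrow> bool" where
  "endo_field C F \<longleftrightarrow>
     (\<forall>X\<in>vector_fields C. F X \<in> vector_fields C) \<and>
     (\<forall>X\<in>vector_fields C. \<forall>Y\<in>vector_fields C. F (X + Y) = F X + F Y) \<and>
     (\<forall>f\<in>C. \<forall>X\<in>vector_fields C. F (f \<odot> X) = f \<odot> F X)"

text \<open>Symmetric tensor fields of type (0,2).\<close>
definition sym_form :: "('m \<Rightarrow> real) set \<Rightarrow> ('m vfield \<Rightarrow> 'm vfield \<Rightarrow> 'm \<Rightarrow> real) \<Rightarrow> bool" where
  "sym_form C g \<longleftrightarrow>
     (\<forall>X\<in>vector_fields C. one_form C (g X)) \<and>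
     (\<forall>X\<in>vector_fields C. \<forall>Y\<in>vector_fields C. g X Y = g Y X)"

text \<open>
  Exterior derivative and wedge product are normalized without numerical factors (determinant
  convention).
\<close>
definition ext_deriv1 ::
  "('m vfield \<Rightarrow> 'm \<Rightarrow> real) \<Rightarrow> 'm vfield \<Rightarrow> 'm vfield \<Rightarrow> 'm \<Rightarrow> real" where
  "ext_deriv1 \<omega> X Y = X (\<omega> Y) - Y (\<omega> X) - \<omega> (bracket X Y)"

definition ext_deriv2 ::
  "('m vfield \<Rightarrow> 'm vfield \<Rightarrow> 'm \<Rightarrow> real) \<Rightarrow> 'm vfield \<Rightarrow> 'm vfield \<Rightarrow> 'm vfield \<Rightarrow> 'm \<Rightarrow> real" where
  "ext_deriv2 \<Omega> X Y Z =
     X (\<Omega> Y Z) + Y (\<Omega> Z X) + Z (\<Omega> X Y)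
     - \<Omega> (bracket X Y) Z - \<Omega> (bracket Y Z) X - \<Omega> (bracket Z X) Y"

definition wedge12 ::
  "('m vfield \<Rightarrow> 'm \<Rightarrow> real) \<Rightarrow> ('m vfield \<Rightarrow> 'm vfield \<Rightarrow> 'm \<Rightarrow> real) \<Rightarrow>
   'm vfield \<Rightarrow> 'm vfield \<Rightarrow> 'm vfield \<Rightarrow> 'm \<Rightarrow> real" where
  "wedge12 \<omega> \<Omega> X Y Z = \<omega> X * \<Omega> Y Z + \<omega> Y * \<Omega> Z X + \<omega> Z * \<Omega> X Y"


section \<open>Tangent spaces\<close>

global_interpretation tv: vector_space "\<lambda>(c::real) (v::('m \<Rightarrow> real) \<Rightarrow> real) f. c * v f"
  by unfold_locales (auto simp: fun_eq_iff algebra_simps)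

definition value_at :: "'m vfield \<Rightarrow> 'm \<Rightarrow> ('m \<Rightarrow> real) \<Rightarrow> real" where
  "value_at X p = (\<lambda>f. X f p)"

text \<open>On a manifold every derivation at a point is the value of a global vector field.\<close>
definition tangent_space :: "('m \<Rightarrow> real) set \<Rightarrow> 'm \<Rightarrow> (('m \<Rightarrow> real) \<Rightarrow> real) set" where
  "tangent_space C p = (\<lambda>X. value_at X p) ` vector_fields C"

text \<open>The endomorphism of the tangent space at \<open>p\<close> given by a tensor field of type (1,1).\<close>
definition endo_at :: "('m \<Rightarrow> real) set \<Rightarrow> ('m vfield \<Rightarrow> 'm vfield) \<Rightarrow> 'm \<Rightarrow>
    (('m \<Rightarrow> real) \<Rightarrow> real) \<Rightarrow> (('m \<Rightarrow> real) \<Rightarrow> real)" where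
  "endo_at C F p v = (SOME w. \<exists>X\<in>vector_fields C. value_at X p = v \<and> w = value_at (F X) p)"

definition trace_at :: "('m \<Rightarrow> real) set \<Rightarrow> ('m vfield \<Rightarrow> 'm vfield) \<Rightarrow> 'm \<Rightarrow> real" where
  "trace_at C F p =
     (let B = (SOME B. tv.independent B \<and> tv.span B = tangent_space C p)
      in \<Sum>v\<in>B. tv.representation B (endo_at C F p v) v)"

text \<open>
  The vectors \<open>E i\<close> below are linearly independent at \<open>p\<close> because they are orthonormal; so they
  form a basis of the tangent space.
\<close>
definition signature_at ::
  "('m \<Rightarrow> real) set \<Rightarrow> ('m vfield \<Rightarrow> 'm vfield \<Rightarrow> 'm \<Rightarrow> real) \<Rightarrow> 'm \<Rightarrow> nat \<Rightarrow> nat \<Rightarrow> bool" where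
  "signature_at C g p r s \<longleftrightarrow> (\<exists>E.
     (\<forall>i<r+s. E i \<in> vector_fields C) \<and>
     tv.span ((\<lambda>i. value_at (E i) p) ` {..<r+s}) = tangent_space C p \<and>
     (\<forall>i<r+s. \<forall>j<r+s. g (E i) (E j) p = (if i \<noteq> j then 0 else if i < r then 1 else -1)))"


section \<open>Levi-Civita connection and curvature\<close>

definition levi_civita :: "('m \<Rightarrow> real) set \<Rightarrow> ('m vfield \<Rightarrow> 'm vfield \<Rightarrow> 'm \<Rightarrow> real) \<Rightarrow>
    ('m vfield \<Rightarrow> 'm vfield \<Rightarrow> 'm vfield) \<Rightarrow> bool" where
  "levi_civita C g D \<longleftrightarrow>
     (\<forall>Y\<in>vector_fields C. endo_field C (\<lambda>X. D X Y)) \<and>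
     (\<forall>X\<in>vector_fields C. \<forall>Y\<in>vector_fields C. \<forall>Z\<in>vector_fields C.
        D X (Y + Z) = D X Y + D X Z) \<and>
     (\<forall>X\<in>vector_fields C. \<forall>Y\<in>vector_fields C. \<forall>f\<in>C.
        D X (f \<odot> Y) = X f \<odot> Y + f \<odot> D X Y) \<and>
     (\<forall>X\<in>vector_fields C. \<forall>Y\<in>vector_fields C. D X Y - D Y X = bracket X Y) \<and>
     (\<forall>X\<in>vector_fields C. \<forall>Y\<in>vector_fields C. \<forall>Z\<in>vector_fields C.
        X (g Y Z) = g (D X Y) Z + g Y (D X Z))"

definition curvature :: "('m vfield \<Rightarrow> 'm vfield \<Rightarrow> 'm vfield) \<Rightarrow>
    'm vfield \<Rightarrow> 'm vfield \<Rightarrow> 'm vfield \<Rightarrow> 'm vfield" where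
  "curvature D X Y Z = D X (D Y Z) - D Y (D X Z) - D (bracket X Y) Z"

definition ricci_tensor :: "('m \<Rightarrow> real) set \<Rightarrow> ('m vfield \<Rightarrow> 'm vfield \<Rightarrow> 'm vfield) \<Rightarrow>
    'm vfield \<Rightarrow> 'm vfield \<Rightarrow> 'm \<Rightarrow> real" where
  "ricci_tensor C D Y Z = (\<lambda>p. trace_at C (\<lambda>X. curvature D X Y Z) p)"

definition is_ricci_operator :: "('m \<Rightarrow> real) set \<Rightarrow> ('m vfield \<Rightarrow> 'm vfield \<Rightarrow> 'm \<Rightarrow> real) \<Rightarrow>
    ('m vfield \<Rightarrow> 'm vfield \<Rightarrow> 'm vfield) \<Rightarrow> ('m vfield \<Rightarrow> 'm vfield) \<Rightarrow> bool" where
  "is_ricci_operator C g D Q \<longleftrightarrow> endo_field C Q \<and>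
     (\<forall>X\<in>vector_fields C. \<forall>Y\<in>vector_fields C. g (Q X) Y = ricci_tensor C D X Y)"

definition jacobi_operator ::
  "('m vfield \<Rightarrow> 'm vfield \<Rightarrow> 'm vfield) \<Rightarrow> 'm vfield \<Rightarrow> 'm vfield \<Rightarrow> 'm vfield" where
  "jacobi_operator D \<xi> X = curvature D X \<xi> \<xi>"


section \<open>Almost paracontact metric structures\<close>

definition almost_paracontact_metric :: "('m \<Rightarrow> real) set \<Rightarrow> nat \<Rightarrow> ('m vfield \<Rightarrow> 'm vfield) \<Rightarrow>
    'm vfield \<Rightarrow> ('m vfield \<Rightarrow> 'm \<Rightarrow> real) \<Rightarrow> ('m vfield \<Rightarrow> 'm vfield \<Rightarrow> 'm \<Rightarrow> real) \<Rightarrow> bool" where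
  "almost_paracontact_metric C n \<phi> \<xi> \<eta> g \<longleftrightarrow>
     endo_field C \<phi> \<and> \<xi> \<in> vector_fields C \<and> one_form C \<eta> \<and>
     sym_form C g \<and> (\<forall>p. signature_at C g p (n + 1) n) \<and>
     \<eta> \<xi> = 1 \<and>
     (\<forall>X\<in>vector_fields C. \<phi> (\<phi> X) = X - \<eta> X \<odot> \<xi>) \<and>
     (\<forall>p. tv.dim {value_at X p | X.
            X \<in> vector_fields C \<and> \<eta> X p = 0 \<and> value_at (\<phi> X) p = value_at X p} = n) \<and>
     (\<forall>p. tv.dim {value_at X p | X.
            X \<in> vector_fields C \<and> \<eta> X p = 0 \<and> value_at (\<phi> X) p = - value_at X p} = n) \<and>
     (\<forall>X\<in>vector_fields C. \<forall>Y\<in>vector_fields C. g (\<phi> X) (\<phi> Y) = - g X Y + \<eta> X * \<eta> Y)"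

definition fundamental_form :: "('m vfield \<Rightarrow> 'm vfield) \<Rightarrow>
    ('m vfield \<Rightarrow> 'm vfield \<Rightarrow> 'm \<Rightarrow> real) \<Rightarrow> 'm vfield \<Rightarrow> 'm vfield \<Rightarrow> 'm \<Rightarrow> real" where
  "fundamental_form \<phi> g X Y = g (\<phi> X) Y"

definition almost_para_Kenmotsu :: "('m \<Rightarrow> real) set \<Rightarrow> real \<Rightarrow> nat \<Rightarrow> ('m vfield \<Rightarrow> 'm vfield) \<Rightarrow>
    'm vfield \<Rightarrow> ('m vfield \<Rightarrow> 'm \<Rightarrow> real) \<Rightarrow> ('m vfield \<Rightarrow> 'm vfield \<Rightarrow> 'm \<Rightarrow> real) \<Rightarrow> bool" where
  "almost_para_Kenmotsu C \<alpha> n \<phi> \<xi> \<eta> g \<longleftrightarrow>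
     almost_paracontact_metric C n \<phi> \<xi> \<eta> g \<and>
     (\<forall>X\<in>vector_fields C. \<forall>Y\<in>vector_fields C. ext_deriv1 \<eta> X Y = 0) \<and>
     (\<forall>X\<in>vector_fields C. \<forall>Y\<in>vector_fields C. \<forall>Z\<in>vector_fields C.
        ext_deriv2 (fundamental_form \<phi> g) X Y Z =
          (\<lambda>_. 2 * \<alpha>) * wedge12 \<eta> (fundamental_form \<phi> g) X Y Z)"

text \<open>\<open>(L\<^sub>\<xi> \<phi>) X = [\<xi>, \<phi> X] - \<phi> [\<xi>, X]\<close>\<close>
definition lie_deriv_endo ::
  "'m vfield \<Rightarrow> ('m vfield \<Rightarrow> 'm vfield) \<Rightarrow> 'm vfield \<Rightarrow> 'm vfield" where
  "lie_deriv_endo \<xi> F X = bracket \<xi> (F X) - F (bracket \<xi> X)"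

definition h_operator ::
  "('m vfield \<Rightarrow> 'm vfield) \<Rightarrow> 'm vfield \<Rightarrow> 'm vfield \<Rightarrow> 'm vfield" where
  "h_operator \<phi> \<xi> X = cmul (1/2) (lie_deriv_endo \<xi> \<phi> X)"


section \<open>Leaves of the kernel of a one-form\<close>

text \<open>
  An integral manifold of \<open>ker \<eta>\<close> is an immersed hypersurface tangent to \<open>ker \<eta>\<close>. It is given by
  its own topology \<open>T\<close>, which may be finer than the subspace topology: every point has an open
  neighbourhood \<open>P\<close> in \<open>T\<close> that is an embedded slice of a chart. The tangent space of \<open>P\<close> at
  \<open>x\<close> consists of the tangent vectors that annihilate all smooth functions vanishing on \<open>P\<close>.
\<close>
definition integral_manifold :: "('m::topological_space, 'e::euclidean_space) chart set \<Rightarrow>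
    ('m vfield \<Rightarrow> 'm \<Rightarrow> real) \<Rightarrow> 'm topology \<Rightarrow> bool" where
  "integral_manifold A \<eta> T \<longleftrightarrow>
     (\<forall>q\<in>topspace T. \<exists>U \<kappa> P. (U, \<kappa>) \<in> smooth_charts A \<and> q \<in> U \<and>
        (\<exists>b\<in>Basis. P = {x\<in>U. \<kappa> x \<bullet> b = \<kappa> q \<bullet> b}) \<and>
        openin T P \<and> subtopology T P = top_of_set P \<and>
        (\<forall>x\<in>P. \<forall>X\<in>vector_fields (smooth_functions A).
           \<eta> X x = 0 \<longleftrightarrow> (\<forall>F\<in>smooth_functions A. (\<forall>y\<in>P. F y = 0) \<longrightarrow> X F x = 0)))"

definition is_leaf :: "('m::topological_space, 'e::euclidean_space) chart set \<Rightarrow>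
    ('m vfield \<Rightarrow> 'm \<Rightarrow> real) \<Rightarrow> 'm topology \<Rightarrow> bool" where
  "is_leaf A \<eta> T \<longleftrightarrow>
     integral_manifold A \<eta> T \<and> connected_space T \<and> topspace T \<noteq> {} \<and>
     (\<forall>T'. integral_manifold A \<eta> T' \<and> connected_space T' \<and> topspace T \<subseteq> topspace T' \<longrightarrow>
        topspace T' = topspace T)"

text \<open>
  The smooth functions of an immersed submanifold are locally, in its own topology, restrictions of
  smooth functions of the ambient manifold.
\<close>
definition leaf_functions :: "('m::topological_space, 'e::euclidean_space) chart set \<Rightarrow>
    'm topology \<Rightarrow> ('m \<Rightarrow> real) set" where
  "leaf_functions A T = {f. (\<forall>x. x \<notin> topspace T \<longrightarrow> f x = 0) \<and>
     (\<forall>q\<in>topspace T. \<exists>P. openin T P \<and> q \<in> P \<and>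
        (\<exists>F\<in>smooth_functions A. \<forall>x\<in>P. f x = F x))}"

text \<open>The differential of the inclusion of the leaf maps the value of \<open>V\<close> at \<open>q\<close> to that of \<open>X\<close>.\<close>
definition incl_related :: "('m::topological_space, 'e::euclidean_space) chart set \<Rightarrow>
    'm topology \<Rightarrow> 'm \<Rightarrow> 'm vfield \<Rightarrow> 'm vfield \<Rightarrow> bool" where
  "incl_related A T q V X \<longleftrightarrow>
     (\<forall>F\<in>smooth_functions A. V (\<lambda>x. if x \<in> topspace T then F x else 0) q = X F q)"

definition induced_metric :: "('m::topological_space, 'e::euclidean_space) chart set \<Rightarrow>
    'm topology \<Rightarrow> ('m vfield \<Rightarrow> 'm vfield \<Rightarrow> 'm \<Rightarrow> real) \<Rightarrow>
    ('m vfield \<Rightarrow> 'm vfield \<Rightarrow> 'm \<Rightarrow> real) \<Rightarrow> bool" where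
  "induced_metric A T g \<gamma> \<longleftrightarrow>
     sym_form (leaf_functions A T) \<gamma> \<and>
     (\<forall>V\<in>vector_fields (leaf_functions A T). \<forall>W\<in>vector_fields (leaf_functions A T).
      \<forall>X\<in>vector_fields (smooth_functions A). \<forall>Y\<in>vector_fields (smooth_functions A).
      \<forall>q\<in>topspace T.
        incl_related A T q V X \<and> incl_related A T q W Y \<longrightarrow> \<gamma> V W q = g X Y q)"

definition induced_endo :: "('m::topological_space, 'e::euclidean_space) chart set \<Rightarrow>
    'm topology \<Rightarrow> ('m vfield \<Rightarrow> 'm vfield) \<Rightarrow> ('m vfield \<Rightarrow> 'm vfield) \<Rightarrow> bool" where
  "induced_endo A T \<phi> J \<longleftrightarrow>
     endo_field (leaf_functions A T) J \<and>
     (\<forall>V\<in>vector_fields (leaf_functions A T). \<forall>X\<in>vector_fields (smooth_functions A).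
      \<forall>q\<in>topspace T. incl_related A T q V X \<longrightarrow> incl_related A T q (J V) (\<phi> X))"

text \<open>
  The induced metric, the induced endomorphism and the Levi-Civita connection exist and are unique
  on every leaf, so the quantifier only names them.
\<close>
definition para_Kaehler_leaves :: "('m::topological_space, 'e::euclidean_space) chart set \<Rightarrow>
    ('m vfield \<Rightarrow> 'm vfield) \<Rightarrow> ('m vfield \<Rightarrow> 'm \<Rightarrow> real) \<Rightarrow>
    ('m vfield \<Rightarrow> 'm vfield \<Rightarrow> 'm \<Rightarrow> real) \<Rightarrow> bool" where
  "para_Kaehler_leaves A \<phi> \<eta> g \<longleftrightarrow>
     (\<forall>T. is_leaf A \<eta> T \<longrightarrow>
        (\<exists>\<gamma> J D. induced_metric A T g \<gamma> \<and> induced_endo A T \<phi> J \<and>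
           levi_civita (leaf_functions A T) \<gamma> D \<and>
           (\<forall>V\<in>vector_fields (leaf_functions A T). \<forall>W\<in>vector_fields (leaf_functions A T).
              D V (J W) - J (D V W) = 0)))"

end

theory Submission
  imports Defs
begin

text \<open>
  Put \<open>N X = D X \<xi>\<close> and \<open>B = \<phi> N\<close>. Closedness of \<open>\<eta>\<close> makes \<open>N\<close> self-adjoint; the formula for \<open>d\<Phi>\<close> with one
  argument \<open>\<xi>\<close> gives \<open>D\<^sub>\<xi> \<phi> = 0\<close> and \<open>\<phi> N + N \<phi> = 2 \<alpha> \<phi>\<close>, hence \<open>2 h = \<phi> N - N \<phi>\<close>. Parallelism of the
  structure along the leaves then determines the whole covariant derivative of \<open>\<phi>\<close>:
  \<open>(D\<^sub>X \<phi>) Y = g (B X) Y \<xi> - \<eta> Y B X\<close>. Differentiating once more expresses \<open>R X Y (\<phi> Z) - \<phi> (R X Y Z)\<close>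
  through \<open>N\<close>, \<open>B\<close> and \<open>\<phi> (R X Y \<xi>)\<close>. Tracing over \<open>X\<close> yields
  \<open>S Y (\<phi> Z) = S* Y Z - g (\<phi> (l Y)) Z - \<eta> Z S* Y \<xi> + 2 \<alpha> (n - 1) g (B Y) Z\<close>, where
  \<open>S* Y Z = tr (X \<mapsto> \<phi> (R X Y Z))\<close> is skew-symmetric, because \<open>\<phi>\<close> is skew and \<open>R\<close> is pair symmetric.
  Symmetrizing in \<open>Y\<close> and \<open>Z\<close> eliminates \<open>S*\<close> and gives the claim.

  The hypothesis on the leaves is only useful if there is a leaf through every point. The Poincare lemma
  provides local first integrals \<open>f\<close> with \<open>df = \<eta>\<close>; their level sets generate a finer topology on the
  manifold, whose connected components are the leaves. A vector field annihilated by \<open>\<eta>\<close> restricts to a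
  derivation of the leaf functions, restriction commutes with brackets, and so Koszul's formula identifies
  the tangential part of \<open>D\<close> with the Levi-Civita connection of the leaf.
\<close>


section \<open>Smooth functions on open sets\<close>

text \<open>Derivations, connections and curvature are developed over an abstract algebra of
  functions, because the manifold and a leaf have to be handled by the same lemmas: Koszul's formula
  is evaluated in both and compared term by term. In the traced identity the factor 2 \<alpha> (n -
  1) is the trace 2 n \<alpha> of N, lowered by 2 \<alpha> through the relation
  \<open>\<phi> N + N \<phi> = 2 \<alpha> \<phi>\<close> applied to \<open>N Y\<close>. Symmetrizing
  turns B into \<open>\<phi> N - N \<phi> = 2 h\<close>, whence 4 \<alpha> (n - 1) h. Skewness
  removes \<open>S* Y Z\<close> from the symmetrized identity but leaves the terms with
  \<open>S* Y \<xi>\<close>. These are computed by putting \<xi> in the first slot of the same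
  identity, which gives \<open>S* Y \<xi> = - S \<xi> (\<phi> Y)\<close>; they become the two
  summands of the claim that contain \<open>\<phi> (Q \<xi>)\<close> and
  \<open>\<eta> (Q (\<phi> X))\<close>.\<close>

abbreviation deriv_at ::
  "('a::real_normed_vector \<Rightarrow> 'b::real_normed_vector) \<Rightarrow> 'a \<Rightarrow> 'a \<Rightarrow> 'b" where
  "deriv_at f x \<equiv> frechet_derivative f (at x)"

lemma Ck_on_cong:
  assumes "open S" "\<And>x. x \<in> S \<Longrightarrow> f x = g x"
  shows "Ck_on k f S \<longleftrightarrow> Ck_on k g S"
  using assms(2)
proof (induction k arbitrary: f g)
  case 0
  then show ?case by (simp cong: continuous_on_cong)
next
  case (Suc k)
  have D: "(f has_derivative f') (at x) \<longleftrightarrow> (g has_derivative f') (at x)" if "x \<in> S" for f' x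
    using that assms(1) Suc.prems
    by (metis has_derivative_transform_within_open)
  then have "f differentiable (at x) \<longleftrightarrow> g differentiable (at x)" if "x \<in> S" for x
    using that by (simp add: differentiable_def)
  moreover have "deriv_at f x = deriv_at g x" if "x \<in> S" for x
    using D that by (simp add: frechet_derivative_def)
  ultimately show ?case
    using Suc.IH[of "\<lambda>x. deriv_at f x v" "\<lambda>x. deriv_at g x v" for v]
    by auto
qed

text \<open>\<open>Ck_on\<close> is phrased with the chosen \<open>frechet_derivative\<close>.
  Accepting an explicit derivative instead turns each closure property below into an induction on k
  in which the derivative is again built from functions of the same class.\<close>

lemma Ck_on_SucI:
  assumes "open S" "\<And>x. x \<in> S \<Longrightarrow> (f has_derivative f' x) (at x)"
    and "\<And>v. Ck_on k (\<lambda>x. f' x v) S"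
  shows "Ck_on (Suc k) f S"
proof -
  have "Ck_on k (\<lambda>x. deriv_at f x v) S = Ck_on k (\<lambda>x. f' x v) S" for v
    by (rule Ck_on_cong[OF assms(1)]) (metis assms(2) frechet_derivative_at)
  then show ?thesis using assms(2,3) by (auto simp: differentiable_def)
qed

lemma Ck_on_SucD: "Ck_on (Suc k) f S \<Longrightarrow> Ck_on k f S"
proof (induction k arbitrary: f)
  case 0
  then show ?case
    by (simp add: differentiable_imp_continuous_on differentiable_on_def differentiable_at_withinI)
qed auto

lemma Ck_on_le: "Ck_on k f S \<Longrightarrow> j \<le> k \<Longrightarrow> Ck_on j f S"
  by (induction k arbitrary: j) (use Ck_on_SucD le_Suc_eq in blast)+

lemma Ck_on_subset: "Ck_on k f S \<Longrightarrow> T \<subseteq> S \<Longrightarrow> Ck_on k f T"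
  by (induction k arbitrary: f) (auto intro: continuous_on_subset)

lemma Ck_on_locally:
  assumes "\<And>x. x \<in> S \<Longrightarrow> \<exists>T. open T \<and> x \<in> T \<and> Ck_on k f T"
  shows "Ck_on k f S"
  using assms
proof (induction k arbitrary: f)
  case 0
  then show ?case
    by (metis Ck_on.simps(1) continuous_at_imp_continuous_on continuous_on_eq_continuous_at)
next
  case (Suc k)
  have "f differentiable (at x)" if "x \<in> S" for x
    using Suc.prems[OF that] by auto
  moreover have "Ck_on k (\<lambda>x. deriv_at f x v) S" for v
    by (rule Suc.IH) (metis Suc.prems Ck_on.simps(2))
  ultimately show ?case by simp
qed

lemma Ck_on_const: "Ck_on k (\<lambda>x. c) S"
  by (induction k arbitrary: c) auto

lemma Ck_on_bounded_linear:
  assumes "bounded_linear f" shows "Ck_on k f S"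
proof (cases k)
  case 0
  then show ?thesis using assms by (simp add: linear_continuous_on)
next
  case (Suc j)
  have "deriv_at f x = f" for x
    using bounded_linear_imp_has_derivative[OF assms] frechet_derivative_at by metis
  moreover have "f differentiable at x" for x
    using bounded_linear_imp_differentiable[OF assms] .
  ultimately show ?thesis using Suc by (simp add: Ck_on_const)
qed

lemma Ck_on_bounded_linear_compose:
  assumes L: "bounded_linear L" and "open S" "Ck_on k f S"
  shows "Ck_on k (\<lambda>x. L (f x)) S"
  using assms(3)
proof (induction k arbitrary: f)
  case 0
  then show ?case using L by (simp add: bounded_linear.continuous_on)
next
  case (Suc k)
  have *: "((\<lambda>x. L (f x)) has_derivative (\<lambda>v. L (deriv_at f x v))) (at x)"
    if "x \<in> S" for x
    using Suc.prems that
    by (intro bounded_linear.has_derivative[OF L]) (simp add: frechet_derivative_works)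
  show ?case
    by (rule Ck_on_SucI[OF \<open>open S\<close> *]) (use Suc in simp_all)
qed

lemma Ck_on_add:
  assumes "open S" "Ck_on k f S" "Ck_on k g S"
  shows "Ck_on k (\<lambda>x. f x + g x) S"
  using assms(2,3)
proof (induction k arbitrary: f g)
  case 0
  then show ?case by (simp add: continuous_on_add)
next
  case (Suc k)
  have *: "((\<lambda>x. f x + g x) has_derivative
      (\<lambda>v. deriv_at f x v + deriv_at g x v)) (at x)"
    if "x \<in> S" for x
    using Suc.prems that by (intro has_derivative_add) (simp_all add: frechet_derivative_works)
  show ?case
    by (rule Ck_on_SucI[OF \<open>open S\<close> *]) (use Suc in simp_all)
qed

lemma Ck_on_sum:
  assumes "open S" "\<And>i. i \<in> I \<Longrightarrow> Ck_on k (f i) S"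
  shows "Ck_on k (\<lambda>x. \<Sum>i\<in>I. f i x) S"
  using assms(2) by (induction I rule: infinite_finite_induct) (auto intro: Ck_on_const Ck_on_add[OF assms(1)])

lemma Ck_on_bilinear:
  assumes B: "bounded_bilinear B" and "open S" "Ck_on k f S" "Ck_on k g S"
  shows "Ck_on k (\<lambda>x. B (f x) (g x)) S"
  using assms(3,4)
proof (induction k arbitrary: f g)
  case 0
  then show ?case using B by (simp add: bounded_bilinear.continuous_on)
next
  case (Suc k)
  have *: "((\<lambda>x. B (f x) (g x)) has_derivative
      (\<lambda>v. B (f x) (deriv_at g x v) + B (deriv_at f x v) (g x))) (at x)"
    if "x \<in> S" for x
    using Suc.prems that
    by (intro bounded_bilinear.FDERIV[OF B]) (simp_all add: frechet_derivative_works)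
  moreover have "Ck_on k f S" "Ck_on k g S" using Suc.prems Ck_on_SucD by blast+
  ultimately show ?case
    by (intro Ck_on_SucI[OF \<open>open S\<close> *] Ck_on_add[OF \<open>open S\<close>] Suc.IH)
      (use Suc.prems in simp_all)
qed

text \<open>In the chain rule the direction of differentiation moves with the point, whereas
  \<open>Ck_on\<close> controls constant directions only. Expanding over \<open>Basis\<close> moves
  the dependence into scalar coefficients.\<close>

lemma frechet_derivative_Basis_sum:
  fixes f :: "'a::euclidean_space \<Rightarrow> 'b::real_normed_vector"
  assumes "f differentiable (at x)"
  shows "deriv_at f x v = (\<Sum>b\<in>Basis. (v \<bullet> b) *\<^sub>R deriv_at f x b)"
proof -
  interpret linear "deriv_at f x" by (rule linear_frechet_derivative[OF assms])
  have "deriv_at f x v = deriv_at f x (\<Sum>b\<in>Basis. (v \<bullet> b) *\<^sub>R b)"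
    by (simp add: euclidean_representation)
  then show ?thesis by (simp add: sum scale)
qed

lemma Ck_on_compose:
  fixes f :: "'a::euclidean_space \<Rightarrow> 'b::real_normed_vector" and g :: "'c::real_normed_vector \<Rightarrow> 'a"
  assumes "open S" "open T" "g ` S \<subseteq> T" "Ck_on k g S" "Ck_on k f T"
  shows "Ck_on k (\<lambda>x. f (g x)) S"
  using assms(4,5)
proof (induction k arbitrary: f)
  case 0
  then show ?case using assms(3) by (auto intro: continuous_on_compose2)
next
  case (Suc k)
  have *: "((\<lambda>x. f (g x)) has_derivative
      (\<lambda>v. \<Sum>b\<in>Basis. (deriv_at g x v \<bullet> b) *\<^sub>R deriv_at f (g x) b)) (at x)"
    if "x \<in> S" for x
  proof -
    have f: "f differentiable (at (g x))" using Suc.prems that assms(3) by auto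
    have g: "(g has_derivative deriv_at g x) (at x)"
      using Suc.prems that by (simp add: frechet_derivative_works)
    have "((\<lambda>x. f (g x)) has_derivative (\<lambda>v. deriv_at f (g x) (deriv_at g x v))) (at x)"
      using diff_chain_at[OF g] f by (simp add: frechet_derivative_works o_def)
    then show ?thesis
      by (rule has_derivative_eq_rhs) (rule ext, rule frechet_derivative_Basis_sum[OF f])
  qed
  have "Ck_on k (\<lambda>x. deriv_at f (g x) b) S" for b
    using Suc.prems by (intro Suc.IH) (auto intro: Ck_on_SucD)
  moreover have "Ck_on k (\<lambda>x. deriv_at g x v \<bullet> b) S" for v b
    using Suc.prems by (intro Ck_on_bounded_linear_compose[OF bounded_linear_inner_left \<open>open S\<close>]) simp
  ultimately show ?case
    by (intro Ck_on_SucI[OF \<open>open S\<close> *] Ck_on_sum[OF \<open>open S\<close>]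
        Ck_on_bilinear[OF bounded_bilinear_scaleR \<open>open S\<close>])
qed

lemma Ck_on_inverse:
  fixes f :: "'a::real_normed_vector \<Rightarrow> real"
  assumes "open S" "Ck_on k f S" "\<And>x. x \<in> S \<Longrightarrow> f x \<noteq> 0"
  shows "Ck_on k (\<lambda>x. inverse (f x)) S"
  using assms(2)
proof (induction k)
  case 0
  then show ?case using assms(3) by (simp add: continuous_on_inverse)
next
  case (Suc k)
  \<comment> \<open>Written as an iterated product, so that the induction hypothesis on
    \<open>inverse f\<close> itself covers the factors other than the derivative of f.\<close>
  have *: "((\<lambda>x. inverse (f x)) has_derivative
      (\<lambda>v. (- 1) * (inverse (f x) * (deriv_at f x v * inverse (f x))))) (at x)"
    if "x \<in> S" for x
    by (rule has_derivative_eq_rhs[OF Deriv.has_derivative_inverse])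
      (use Suc.prems that assms(3) in \<open>auto simp: frechet_derivative_works[symmetric]\<close>)
  have "Ck_on k f S" using Suc.prems Ck_on_SucD by blast
  then have I: "Ck_on k (\<lambda>x. inverse (f x)) S" by (rule Suc.IH)
  show ?case
    by (intro Ck_on_SucI[OF \<open>open S\<close> *] Ck_on_bilinear[OF bounded_bilinear_mult \<open>open S\<close>])
      (use I Suc.prems in \<open>auto intro: Ck_on_const\<close>)
qed

lemma smooth_on_cong:
  assumes "open S" "\<And>x. x \<in> S \<Longrightarrow> f x = g x"
  shows "smooth_on f S \<longleftrightarrow> smooth_on g S"
  using Ck_on_cong[OF assms] by (simp add: smooth_on_def)

lemma smooth_on_subset: "smooth_on f S \<Longrightarrow> T \<subseteq> S \<Longrightarrow> smooth_on f T"
  unfolding smooth_on_def using Ck_on_subset by blast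

lemma smooth_on_locally:
  assumes "\<And>x. x \<in> S \<Longrightarrow> \<exists>T. open T \<and> x \<in> T \<and> smooth_on f T"
  shows "smooth_on f S"
  unfolding smooth_on_def
  by (intro allI Ck_on_locally) (metis assms smooth_on_def)

lemma smooth_on_const: "smooth_on (\<lambda>x. c) S"
  by (simp add: smooth_on_def Ck_on_const)

lemma smooth_on_bounded_linear: "bounded_linear f \<Longrightarrow> smooth_on f S"
  by (simp add: smooth_on_def Ck_on_bounded_linear)

lemma smooth_on_bounded_linear_compose:
  "bounded_linear L \<Longrightarrow> open S \<Longrightarrow> smooth_on f S \<Longrightarrow> smooth_on (\<lambda>x. L (f x)) S"
  by (simp add: smooth_on_def Ck_on_bounded_linear_compose)

lemma smooth_on_ident: "smooth_on (\<lambda>x. x) S"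
  by (rule smooth_on_bounded_linear) (rule bounded_linear_ident)

lemma smooth_on_add: "open S \<Longrightarrow> smooth_on f S \<Longrightarrow> smooth_on g S \<Longrightarrow> smooth_on (\<lambda>x. f x + g x) S"
  by (simp add: smooth_on_def Ck_on_add)

lemma smooth_on_sum:
  "open S \<Longrightarrow> (\<And>i. i \<in> I \<Longrightarrow> smooth_on (f i) S) \<Longrightarrow> smooth_on (\<lambda>x. \<Sum>i\<in>I. f i x) S"
  by (simp add: smooth_on_def Ck_on_sum)

lemma smooth_on_scaleR:
  "open S \<Longrightarrow> smooth_on f S \<Longrightarrow> smooth_on g S \<Longrightarrow> smooth_on (\<lambda>x. f x *\<^sub>R g x) S"
  by (simp add: smooth_on_def Ck_on_bilinear[OF bounded_bilinear_scaleR])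

lemma smooth_on_mult:
  fixes f g :: "'a::real_normed_vector \<Rightarrow> real"
  shows "open S \<Longrightarrow> smooth_on f S \<Longrightarrow> smooth_on g S \<Longrightarrow> smooth_on (\<lambda>x. f x * g x) S"
  by (simp add: smooth_on_def Ck_on_bilinear[OF bounded_bilinear_mult])

lemma smooth_on_minus: "open S \<Longrightarrow> smooth_on f S \<Longrightarrow> smooth_on (\<lambda>x. - f x) S"
  by (rule smooth_on_bounded_linear_compose[OF bounded_linear_minus[OF bounded_linear_ident]])

lemma smooth_on_diff:
  "open S \<Longrightarrow> smooth_on f S \<Longrightarrow> smooth_on g S \<Longrightarrow> smooth_on (\<lambda>x. f x - g x) S"
  using smooth_on_add[of S f "\<lambda>x. - g x"] smooth_on_minus[of S g] by simp

lemma smooth_on_inner_const: "open S \<Longrightarrow> smooth_on f S \<Longrightarrow> smooth_on (\<lambda>x. f x \<bullet> b) S"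
  by (rule smooth_on_bounded_linear_compose[OF bounded_linear_inner_left])

lemma smooth_on_inverse:
  fixes f :: "'a::real_normed_vector \<Rightarrow> real"
  shows "open S \<Longrightarrow> smooth_on f S \<Longrightarrow> (\<And>x. x \<in> S \<Longrightarrow> f x \<noteq> 0) \<Longrightarrow> smooth_on (\<lambda>x. inverse (f x)) S"
  by (simp add: smooth_on_def Ck_on_inverse)

lemma smooth_on_divide:
  fixes f :: "'a::real_normed_vector \<Rightarrow> real"
  assumes "open S" "smooth_on f S" "smooth_on g S" "\<And>x. x \<in> S \<Longrightarrow> g x \<noteq> 0"
  shows "smooth_on (\<lambda>x. f x / g x) S"
  unfolding divide_inverse using assms by (intro smooth_on_mult smooth_on_inverse)

lemma smooth_on_compose:
  fixes f :: "'a::euclidean_space \<Rightarrow> 'b::real_normed_vector" and g :: "'c::real_normed_vector \<Rightarrow> 'a"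
  assumes "open S" "open T" "g ` S \<subseteq> T" "smooth_on g S" "smooth_on f T"
  shows "smooth_on (\<lambda>x. f (g x)) S"
  using assms Ck_on_compose unfolding smooth_on_def by blast

lemma smooth_on_imp_continuous_on: "smooth_on f S \<Longrightarrow> continuous_on S f"
  unfolding smooth_on_def using Ck_on.simps(1) by blast

lemma smooth_on_imp_differentiable: "smooth_on f S \<Longrightarrow> x \<in> S \<Longrightarrow> f differentiable (at x)"
  unfolding smooth_on_def by (metis Ck_on.simps(2))

lemma smooth_on_imp_has_derivative:
  "smooth_on f S \<Longrightarrow> x \<in> S \<Longrightarrow> (f has_derivative deriv_at f x) (at x)"
  using smooth_on_imp_differentiable frechet_derivative_works by blast

lemma smooth_on_frechet_derivative:
  "smooth_on f S \<Longrightarrow> smooth_on (\<lambda>x. deriv_at f x v) S"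
  unfolding smooth_on_def by (metis Ck_on.simps(2))


section \<open>Bump functions, Hadamard's lemma and the Poincare lemma\<close>

text \<open>This family of functions, with \<open>p\<close> ranging over all polynomials, is closed under differentiation.\<close>
definition flat :: "real poly \<Rightarrow> real \<Rightarrow> real" where
  "flat p t = (if t > 0 then poly p (inverse t) * exp (- inverse t) else 0)"

lemma tendsto_poly_div_exp: "((\<lambda>s. poly p s * exp (- s)) \<longlongrightarrow> (0::real)) at_top"
proof -
  have "((\<lambda>s. \<Sum>i\<le>degree p. coeff p i * (s ^ i / exp s)) \<longlongrightarrow> (\<Sum>i\<le>degree p. coeff p i * 0)) at_top"
    by (intro tendsto_sum tendsto_mult tendsto_const tendsto_power_div_exp_0)
  moreover have "poly p s * exp (- s) = (\<Sum>i\<le>degree p. coeff p i * (s ^ i / exp s))" for s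
    by (simp add: poly_altdef sum_distrib_right exp_minus divide_inverse mult.assoc)
  ultimately show ?thesis by simp
qed

text \<open>With s = 1/t one has ds/dt = - s^2, so p(s) exp(-s) has derivative s^2 (p(s) - p'(s))
  exp(-s); the coefficient list \<open>[:0, 0, 1:]\<close> is s^2. At t = 0 exponential decay beats
  every polynomial.\<close>

lemma flat_has_derivative:
  "(flat p has_field_derivative flat ([:0, 0, 1:] * (p - pderiv p)) t) (at t)"
proof (cases t "0::real" rule: linorder_cases)
  case less
  have "((\<lambda>_. 0) has_field_derivative 0) (at t)" by simp
  then have "(flat p has_field_derivative 0) (at t)"
    by (rule DERIV_cong_ev[THEN iffD1, rotated -1, OF _ refl _ refl])
      (use less in \<open>auto simp: flat_def eventually_at_filter
        intro!: eventually_mono[OF eventually_nhds_in_open[of "{..<0}"]]\<close>)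
  then show ?thesis using less by (simp add: flat_def)
next
  case greater
  have "((\<lambda>t. poly p (inverse t) * exp (- inverse t)) has_field_derivative
      flat ([:0, 0, 1:] * (p - pderiv p)) t) (at t)"
    using greater
    by (auto intro!: derivative_eq_intros DERIV_chain2[OF poly_DERIV]
        simp: flat_def field_simps power2_eq_square)
  then show ?thesis
    by (rule DERIV_cong_ev[THEN iffD1, rotated -1, OF _ refl _ refl])
      (use greater in \<open>auto simp: flat_def eventually_at_filter
        intro!: eventually_mono[OF eventually_nhds_in_open[of "{0<..}"]]\<close>)
next
  case equal
  have "((\<lambda>h. flat p h / h) \<longlongrightarrow> 0) (at_left 0)"
    by (rule tendsto_eventually) (auto simp: flat_def eventually_at_filter)
  moreover have "((\<lambda>h. flat p h / h) \<longlongrightarrow> 0) (at_right 0)"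
  proof (rule Lim_transform_eventually)
    \<comment> \<open>Dividing by h multiplies the polynomial by s = 1/h, and s tends to
      infinity.\<close>
    show "((\<lambda>h. poly ([:0, 1:] * p) (inverse h) * exp (- inverse h)) \<longlongrightarrow> (0::real)) (at_right 0)"
      by (rule filterlim_compose[OF tendsto_poly_div_exp filterlim_inverse_at_top_right])
    show "\<forall>\<^sub>F h in at_right 0. poly ([:0, 1:] * p) (inverse h) * exp (- inverse h) = flat p h / h"
      by (auto simp: flat_def eventually_at_filter field_simps)
  qed
  ultimately have "((\<lambda>h. flat p h / h) \<longlongrightarrow> 0) (at 0)"
    by (rule filterlim_split_at)
  then show ?thesis using equal by (simp add: DERIV_def flat_def)
qed

lemma smooth_on_flat: "smooth_on (flat p) UNIV"
proof -
  have "Ck_on k (flat p) UNIV" for k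
  proof (induction k arbitrary: p)
    case 0
    then show ?case
      by (auto intro!: continuous_at_imp_continuous_on DERIV_isCont[OF flat_has_derivative])
  next
    case (Suc k)
    show ?case
      by (rule Ck_on_SucI[OF open_UNIV])
        (use flat_has_derivative[unfolded has_field_derivative_def] in blast,
          intro Ck_on_bilinear[OF bounded_bilinear_mult open_UNIV] Suc.IH Ck_on_const)
  qed
  then show ?thesis by (simp add: smooth_on_def)
qed

lemma smooth_on_inner:
  "open S \<Longrightarrow> smooth_on f S \<Longrightarrow> smooth_on g S \<Longrightarrow> smooth_on (\<lambda>x. f x \<bullet> g x) S"
  by (simp add: smooth_on_def Ck_on_bilinear[OF bounded_bilinear_inner])

text \<open>The quotient u / (u + w), where u is positive exactly inside radius 2 r and w exactly
  outside radius r. These two regions cover the space, so the denominator never vanishes.\<close>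

lemma smooth_bump:
  fixes a :: "'a::euclidean_space"
  assumes "0 < r"
  obtains \<psi> :: "'a \<Rightarrow> real" where "smooth_on \<psi> UNIV" "\<And>x. x \<in> cball a r \<Longrightarrow> \<psi> x = 1"
    "\<And>x. x \<notin> ball a (2 * r) \<Longrightarrow> \<psi> x = 0"
proof
  let ?n = "\<lambda>x. (x - a) \<bullet> (x - a)"
  define u where "u = (\<lambda>x. flat 1 (4 * r\<^sup>2 - ?n x))"
  define w where "w = (\<lambda>x. flat 1 (?n x - r\<^sup>2))"
  let ?\<psi> = "\<lambda>x. u x / (u x + w x)"
  have n: "?n x = (dist a x)\<^sup>2" for x
    by (simp add: dist_norm power2_norm_eq_inner inner_commute algebra_simps)
  have pos: "u x + w x > 0" for x
  proof -
    have "?n x < 4 * r\<^sup>2 \<or> ?n x > r\<^sup>2" using assms by (smt (verit) zero_less_power)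
    moreover have "u x \<ge> 0" "w x \<ge> 0" by (auto simp: u_def w_def flat_def)
    moreover have "?n x < 4 * r\<^sup>2 \<Longrightarrow> u x > 0" "?n x > r\<^sup>2 \<Longrightarrow> w x > 0"
      by (auto simp: u_def w_def flat_def)
    ultimately show ?thesis by force
  qed
  have sn: "smooth_on ?n UNIV"
    by (intro smooth_on_inner smooth_on_diff smooth_on_ident smooth_on_const open_UNIV)
  have "smooth_on u UNIV" unfolding u_def
    by (intro smooth_on_compose[OF open_UNIV open_UNIV _ _ smooth_on_flat] smooth_on_diff
        smooth_on_const sn open_UNIV) simp
  moreover have "smooth_on w UNIV" unfolding w_def
    by (intro smooth_on_compose[OF open_UNIV open_UNIV _ _ smooth_on_flat] smooth_on_diff
        smooth_on_const sn open_UNIV) simp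
  ultimately show "smooth_on ?\<psi> UNIV"
    by (intro smooth_on_divide smooth_on_add open_UNIV) (use pos in \<open>auto simp: less_le\<close>)
  show "?\<psi> x = 1" if "x \<in> cball a r" for x
  proof -
    have "(dist a x)\<^sup>2 \<le> r\<^sup>2" using that by (intro power_mono) auto
    then have "w x = 0" unfolding w_def n flat_def by simp
    then show ?thesis using pos[of x] by simp
  qed
  show "?\<psi> x = 0" if "x \<notin> ball a (2 * r)" for x
  proof -
    have "(2 * r)\<^sup>2 \<le> (dist a x)\<^sup>2" using that assms by (intro power_mono) auto
    then show ?thesis by (simp add: u_def n flat_def power2_eq_square)
  qed
qed

text \<open>The exponent m makes the family closed under differentiation: the inner derivative
  contributes a factor t, so m becomes m + 1. For m = 0 these are the coefficients in Hadamard's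
  lemma and in the homotopy formula for closed forms.\<close>

definition radial_integral ::
  "'a \<Rightarrow> nat \<Rightarrow> ('a \<Rightarrow> real) \<Rightarrow> 'a::euclidean_space \<Rightarrow> real" where
  "radial_integral a m f x = integral {0..1} (\<lambda>t. t ^ m * f (a + t *\<^sub>R (x - a)))"

lemma radial_in_ball:
  fixes a :: "'a::euclidean_space"
  assumes "x \<in> ball a r" "t \<in> {0..1}"
  shows "a + t *\<^sub>R (x - a) \<in> ball a r"
proof -
  have "t * norm (x - a) \<le> 1 * norm (x - a)" using assms by (intro mult_right_mono) auto
  also have "\<dots> < r" using assms by (simp add: dist_norm norm_minus_commute)
  finally show ?thesis using assms by (simp add: dist_norm)
qed

lemma continuous_on_radial:
  fixes a :: "'a::euclidean_space" and f :: "'a \<Rightarrow> real"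
  assumes "continuous_on (ball a r) f"
  shows "continuous_on (ball a r \<times> {0..1}) (\<lambda>(x, t). t ^ m * f (a + t *\<^sub>R (x - a)))"
proof -
  have "continuous_on (ball a r \<times> {0..1}) (\<lambda>p. f (a + snd p *\<^sub>R (fst p - a)))"
    by (rule continuous_on_compose2[OF assms], intro continuous_intros)
      (auto simp del: mem_ball intro: radial_in_ball)
  then show ?thesis unfolding split_beta by (intro continuous_intros)
qed

lemma continuous_on_radial1:
  fixes a :: "'a::euclidean_space" and f :: "'a \<Rightarrow> real"
  assumes "continuous_on (ball a r) f" "x \<in> ball a r"
  shows "continuous_on {0..1} (\<lambda>t. t ^ m * f (a + t *\<^sub>R (x - a)))"
proof -
  have "continuous_on {0..1} (\<lambda>t. f (a + t *\<^sub>R (x - a)))"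
    by (rule continuous_on_compose2[OF assms(1)], intro continuous_intros)
      (use assms(2) in \<open>auto simp del: mem_ball intro: radial_in_ball\<close>)
  then show ?thesis by (intro continuous_intros)
qed

lemma radial_integral_has_derivative:
  fixes a :: "'a::euclidean_space"
  assumes "Ck_on (Suc 0) f (ball a r)" "x \<in> ball a r"
  shows "(radial_integral a m f has_derivative
    (\<lambda>v. radial_integral a (Suc m) (\<lambda>y. deriv_at f y v) x)) (at x)"
proof -
  have f: "(f has_derivative deriv_at f y) (at y)" if "y \<in> ball a r" for y
    using assms(1) that by (simp add: frechet_derivative_works)
  have bl: "bounded_linear (deriv_at f y)" if "y \<in> ball a r" for y
    using f[OF that] has_derivative_bounded_linear by blast
  have cD: "continuous_on (ball a r) (\<lambda>y. deriv_at f y v)" for v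
    using assms(1) by simp
  \<comment> \<open>\<open>leibniz_rule\<close> wants the derivative of the integrand as a jointly
    continuous map into bounded linear functions. In finite dimension this continuity may be checked
    on each vector v separately.\<close>
  define F where "F = (\<lambda>x t. Blinfun (\<lambda>v. t ^ Suc m * deriv_at f (a + t *\<^sub>R (x - a)) v))"
  have F: "blinfun_apply (F x t) = (\<lambda>v. t ^ Suc m * deriv_at f (a + t *\<^sub>R (x - a)) v)"
    if "x \<in> ball a r" "t \<in> {0..1}" for x t
    unfolding F_def using that
    by (intro bounded_linear_Blinfun_apply bounded_linear_const_mult bl radial_in_ball)
  have D: "((\<lambda>x. t ^ m * f (a + t *\<^sub>R (x - a))) has_derivative blinfun_apply (F x t)) (at x within ball a r)"
    if "x \<in> ball a r" "t \<in> {0..1}" for x t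
  proof -
    interpret linear "deriv_at f (a + t *\<^sub>R (x - a))"
      using bl[OF radial_in_ball[OF that]] bounded_linear.linear by blast
    have "((\<lambda>x. a + t *\<^sub>R (x - a)) has_derivative (\<lambda>v. t *\<^sub>R v)) (at x)"
      by (auto intro!: derivative_eq_intros)
    from has_derivative_compose[OF this f[OF radial_in_ball[OF that]]]
    have "((\<lambda>x. t ^ m * f (a + t *\<^sub>R (x - a))) has_derivative
        (\<lambda>v. t ^ m * deriv_at f (a + t *\<^sub>R (x - a)) (t *\<^sub>R v))) (at x)"
      by (rule has_derivative_mult_right)
    moreover have "(\<lambda>v. t ^ m * deriv_at f (a + t *\<^sub>R (x - a)) (t *\<^sub>R v)) = blinfun_apply (F x t)"
      by (simp add: F[OF that] scale fun_eq_iff)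
    ultimately show ?thesis by (simp add: has_derivative_at_withinI)
  qed
  have cF: "continuous_on (ball a r \<times> cbox 0 1) (\<lambda>(x, t). F x t)"
  proof (rule continuous_on_blinfun_componentwise)
    fix v :: 'a
    have "continuous_on (ball a r \<times> cbox 0 1)
       (\<lambda>(x, t). t ^ Suc m * deriv_at f (a + t *\<^sub>R (x - a)) v)"
      using continuous_on_radial[OF cD] by (simp del: power_Suc)
    then show "continuous_on (ball a r \<times> cbox 0 1) (\<lambda>p. blinfun_apply (case p of (x, t) \<Rightarrow> F x t) v)"
      by (rule continuous_on_eq) (use F in \<open>auto simp: split_beta\<close>)
  qed
  have cf: "continuous_on (ball a r) f" using assms(1) Ck_on_SucD[of 0] by simp
  have 1: "((\<lambda>x. integral (cbox 0 1) (\<lambda>t. t ^ m * f (a + t *\<^sub>R (x - a)))) has_derivative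
      blinfun_apply (integral (cbox 0 1) (F x))) (at x within ball a r)"
    by (rule leibniz_rule[OF _ _ cF assms(2)])
      (use D continuous_on_radial1[OF cf] in \<open>auto intro: integrable_continuous_real\<close>)
  have 2: "blinfun_apply (integral (cbox 0 1) (F x)) =
      (\<lambda>v. radial_integral a (Suc m) (\<lambda>y. deriv_at f y v) x)"
  proof
    fix v
    have "Pair x ` cbox 0 1 \<subseteq> ball a r \<times> cbox 0 1" using assms(2) by auto
    from continuous_on_compose2[OF cF continuous_on_Pair[OF continuous_on_const continuous_on_id] this]
    have "continuous_on (cbox 0 1) (F x)" by simp
    then have "F x integrable_on cbox 0 1" by (rule integrable_continuous)
    then have "blinfun_apply (integral (cbox 0 1) (F x)) v = integral (cbox 0 1) (\<lambda>t. F x t v)"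
      by (rule blinfun_apply_integral)
    also have "\<dots> = radial_integral a (Suc m) (\<lambda>y. deriv_at f y v) x"
      unfolding radial_integral_def by (simp only: box_real, rule integral_cong) (use F[OF assms(2)] in auto)
    finally show "blinfun_apply (integral (cbox 0 1) (F x)) v =
      radial_integral a (Suc m) (\<lambda>y. deriv_at f y v) x" .
  qed
  show ?thesis
    using 1 unfolding 2 at_within_open[OF assms(2) open_ball] by (simp add: radial_integral_def[abs_def])
qed

lemma smooth_on_radial_integral:
  assumes "smooth_on f (ball a r)"
  shows "smooth_on (radial_integral a m f) (ball a r)"
proof -
  have "Ck_on k f (ball a r) \<Longrightarrow> Ck_on k (radial_integral a m f) (ball a r)" for k
  proof (induction k arbitrary: f m)
    case 0
    then have "continuous_on (ball a r \<times> cbox 0 1) (\<lambda>(x, t). t ^ m * f (a + t *\<^sub>R (x - a)))"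
      using continuous_on_radial[of a r f m] by simp
    from integral_continuous_on_param[OF this] show ?case
      by (simp add: radial_integral_def[abs_def])
  next
    case (Suc k)
    have "Ck_on (Suc 0) f (ball a r)" using Suc.prems Ck_on_le by blast
    then show ?case
      by (intro Ck_on_SucI[OF open_ball radial_integral_has_derivative] Suc.IH)
        (use Suc.prems in auto)
  qed
  then show ?thesis using assms by (simp add: smooth_on_def)
qed

lemma radial_has_derivative:
  assumes "smooth_on f (ball a r)" "x \<in> ball a r" "t \<in> {0..1}"
  shows "((\<lambda>t. f (a + t *\<^sub>R (x - a))) has_real_derivative
    (\<Sum>b\<in>Basis. ((x - a) \<bullet> b) * deriv_at f (a + t *\<^sub>R (x - a)) b)) (at t)"
proof -
  have f: "f differentiable (at (a + t *\<^sub>R (x - a)))"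
    using smooth_on_imp_differentiable[OF assms(1) radial_in_ball[OF assms(2,3)]] .
  interpret linear "deriv_at f (a + t *\<^sub>R (x - a))"
    using linear_frechet_derivative[OF f] .
  have "((\<lambda>t. a + t *\<^sub>R (x - a)) has_derivative (\<lambda>s. s *\<^sub>R (x - a))) (at t)"
    by (auto intro!: derivative_eq_intros)
  from has_derivative_compose[OF this f[unfolded frechet_derivative_works]]
  show ?thesis
    unfolding has_field_derivative_def
    by (rule has_derivative_eq_rhs)
      (simp add: scale frechet_derivative_Basis_sum[OF f, of "x - a"] fun_eq_iff mult.commute)
qed

text \<open>Integrate the t-derivative of t^m f(a + t (x - a)) over [0, 1]. The case m = 0 is
  Hadamard's lemma: \<open>0 ^ 0 = 1\<close> keeps the value at the centre, and the factor
  \<open>real m\<close> removes the term with the truncated \<open>m - 1\<close>. The case m = 1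
  completes the proof of \<open>poincare\<close>.\<close>

lemma taylor_radial:
  assumes f: "smooth_on f (ball a r)" and x: "x \<in> ball a r"
  shows "f x = 0 ^ m * f a + real m * radial_integral a (m - 1) f x +
    (\<Sum>b\<in>Basis. ((x - a) \<bullet> b) * radial_integral a m (\<lambda>y. deriv_at f y b) x)"
proof -
  let ?f = "\<lambda>t. f (a + t *\<^sub>R (x - a))"
  let ?D = "\<lambda>b t. deriv_at f (a + t *\<^sub>R (x - a)) b"
  let ?g = "\<lambda>t. real m * (t ^ (m - 1) * ?f t) + (\<Sum>b\<in>Basis. ((x - a) \<bullet> b) * (t ^ m * ?D b t))"
  have "(?g has_integral 1 ^ m * ?f 1 - 0 ^ m * ?f 0) {0..1}"
  proof (rule fundamental_theorem_of_calculus)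
    fix t :: real assume "t \<in> {0..1}"
    have "((\<lambda>t. t ^ m * ?f t) has_real_derivative ?g t) (at t)"
      using DERIV_mult[OF DERIV_pow radial_has_derivative[OF f x \<open>t \<in> _\<close>], of m]
      by (simp add: sum_distrib_left mult_ac)
    then show "((\<lambda>t. t ^ m * ?f t) has_vector_derivative ?g t) (at t within {0..1})"
      by (simp add: has_real_derivative_iff_has_vector_derivative has_vector_derivative_at_within)
  qed simp
  then have "f x = 0 ^ m * f a + integral {0..1} ?g"
    by (simp add: integral_unique)
  also have "integral {0..1} ?g = real m * radial_integral a (m - 1) f x +
    (\<Sum>b\<in>Basis. ((x - a) \<bullet> b) * radial_integral a m (\<lambda>y. deriv_at f y b) x)"
  proof -
    note c = continuous_on_radial1[OF smooth_on_imp_continuous_on[OF f] x]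
    note D = continuous_on_radial1[OF smooth_on_imp_continuous_on[OF smooth_on_frechet_derivative[OF f]] x]
    have "integral {0..1} ?g = integral {0..1} (\<lambda>t. real m * (t ^ (m - 1) * ?f t)) +
        integral {0..1} (\<lambda>t. \<Sum>b\<in>Basis. ((x - a) \<bullet> b) * (t ^ m * ?D b t))"
      by (intro integral_add integrable_continuous_real continuous_on_sum continuous_on_mult_left c D)
    also have "integral {0..1} (\<lambda>t. \<Sum>b\<in>Basis. ((x - a) \<bullet> b) * (t ^ m * ?D b t)) =
        (\<Sum>b\<in>Basis. integral {0..1} (\<lambda>t. ((x - a) \<bullet> b) * (t ^ m * ?D b t)))"
      by (intro integral_sum integrable_continuous_real continuous_on_mult_left D) simp
    finally show ?thesis by (simp add: radial_integral_def)
  qed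
  finally show ?thesis by (simp add: add.assoc)
qed

lemmas hadamard = taylor_radial[where m = 0, unfolded power_0 of_nat_0 mult_1_left mult_zero_left add_0_right]

lemma poincare:
  fixes A :: "'a::euclidean_space \<Rightarrow> 'a \<Rightarrow> real"
  assumes A: "\<And>b. b \<in> Basis \<Longrightarrow> smooth_on (A b) (ball a r)"
    and closed: "\<And>b c x. b \<in> Basis \<Longrightarrow> c \<in> Basis \<Longrightarrow> x \<in> ball a r \<Longrightarrow>
      deriv_at (A b) x c = deriv_at (A c) x b"
  obtains f where "smooth_on f (ball a r)"
    "\<And>b x. b \<in> Basis \<Longrightarrow> x \<in> ball a r \<Longrightarrow> deriv_at f x b = A b x"
proof
  \<comment> \<open>The integral of the one-form with coefficients \<open>A b\<close> along the
    segment from a to x.\<close>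
  let ?f = "\<lambda>x. \<Sum>b\<in>Basis. ((x - a) \<bullet> b) * radial_integral a 0 (A b) x"
  show "smooth_on ?f (ball a r)"
    by (intro smooth_on_sum smooth_on_mult smooth_on_inner_const smooth_on_diff smooth_on_ident
        smooth_on_const smooth_on_radial_integral A open_ball)
  fix c x :: 'a assume c: "c \<in> Basis" and x: "x \<in> ball a r"
  have "(?f has_derivative (\<lambda>v. \<Sum>b\<in>Basis. ((x - a) \<bullet> b) *
        radial_integral a 1 (\<lambda>y. deriv_at (A b) y v) x +
        (v \<bullet> b) * radial_integral a 0 (A b) x)) (at x)"
  proof (intro has_derivative_sum has_derivative_mult)
    fix b :: 'a assume "b \<in> Basis"
    show "((\<lambda>x. (x - a) \<bullet> b) has_derivative (\<lambda>v. v \<bullet> b)) (at x)"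
      by (auto intro!: derivative_eq_intros)
    have "Ck_on (Suc 0) (A b) (ball a r)" using A[OF \<open>b \<in> Basis\<close>] unfolding smooth_on_def by blast
    from radial_integral_has_derivative[OF this x, of 0]
    show "(radial_integral a 0 (A b) has_derivative
       (\<lambda>v. radial_integral a 1 (\<lambda>y. deriv_at (A b) y v) x)) (at x)" by simp
  qed
  then have "deriv_at ?f x = (\<lambda>v. \<Sum>b\<in>Basis. ((x - a) \<bullet> b) *
        radial_integral a 1 (\<lambda>y. deriv_at (A b) y v) x +
        (v \<bullet> b) * radial_integral a 0 (A b) x)"
    by (rule frechet_derivative_at[symmetric])
  then have "deriv_at ?f x c = (\<Sum>b\<in>Basis. ((x - a) \<bullet> b) *
        radial_integral a 1 (\<lambda>y. deriv_at (A b) y c) x) +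
        (\<Sum>b\<in>Basis. (c \<bullet> b) * radial_integral a 0 (A b) x)"
    by (simp add: sum.distrib)
  also have "(\<Sum>b\<in>Basis. (c \<bullet> b) * radial_integral a 0 (A b) x) = radial_integral a 0 (A c) x"
    using c by (simp add: inner_Basis if_distrib[of "\<lambda>z. z * _"] cong: if_cong)
  \<comment> \<open>Closedness exchanges b and c. Afterwards only the single coefficient
    \<open>A c\<close> occurs, and the sum is the last term of \<open>taylor_radial\<close> for it
    with m = 1.\<close>
  also have "(\<Sum>b\<in>Basis. ((x - a) \<bullet> b) * radial_integral a 1 (\<lambda>y. deriv_at (A b) y c) x) =
     (\<Sum>b\<in>Basis. ((x - a) \<bullet> b) * radial_integral a 1 (\<lambda>y. deriv_at (A c) y b) x)"
  proof (rule sum.cong[OF refl])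
    fix b :: 'a assume "b \<in> Basis"
    have "radial_integral a 1 (\<lambda>y. deriv_at (A b) y c) x =
        radial_integral a 1 (\<lambda>y. deriv_at (A c) y b) x"
      unfolding radial_integral_def
      by (rule integral_cong) (use closed[OF \<open>b \<in> Basis\<close> c radial_in_ball[OF x]] in simp)
    then show "((x - a) \<bullet> b) * radial_integral a 1 (\<lambda>y. deriv_at (A b) y c) x =
        ((x - a) \<bullet> b) * radial_integral a 1 (\<lambda>y. deriv_at (A c) y b) x" by simp
  qed
  also have "\<dots> + radial_integral a 0 (A c) x = A c x"
    using taylor_radial[OF A[OF c] x, of 1] by simp
  finally show "deriv_at ?f x c = A c x" .
qed

lemma frechet_derivative_cong:
  assumes "open S" "x \<in> S" "\<And>y. y \<in> S \<Longrightarrow> f y = g y"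
  shows "deriv_at f x = deriv_at g x"
proof -
  have "(f has_derivative f') (at x) \<longleftrightarrow> (g has_derivative f') (at x)" for f'
    using assms by (metis has_derivative_transform_within_open)
  then show ?thesis by (simp add: frechet_derivative_def)
qed

lemma radial_integral_center: "radial_integral a 0 f a = f a"
  by (simp add: radial_integral_def)


section \<open>Derivations, connections and traces\<close>

lemma fmul_apply [simp]: "(f \<odot> X) u p = f p * X u p"
  by (simp add: fmul_def)

lemma cmul_apply [simp]: "cmul c X u p = c * X u p"
  by (simp add: cmul_def)

lemma sum_fun_apply: "sum F I x = (\<Sum>i\<in>I. F i x)" for F :: "'i \<Rightarrow> 'a \<Rightarrow> 'b::comm_monoid_add"
  by (induction I rule: infinite_finite_induct) auto

text \<open>Unlike \<open>algebra_simps\<close>, these rules leave the function-valued arguments of derivations alone,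
  which would otherwise be permuted out of the form required by the derivation rules.\<close>
lemma real_ring_simps:
  fixes a b c :: real
  shows "a + b = b + a" "a + b + c = a + (b + c)" "a + (b + c) = b + (a + c)"
    "a * b = b * a" "a * b * c = a * (b * c)" "a * (b * c) = b * (a * c)"
    "(a + b) * c = a * c + b * c" "a * (b + c) = a * b + a * c"
    "(a - b) * c = a * c - b * c" "a * (b - c) = a * b - a * c"
    "a + (b - c) = a + b - c" "a - b + c = a + c - b" "a - (b - c) = a + c - b" "a - b - c = a - (b + c)"
    "(a - b = c) = (a = c + b)" "(a = c - b) = (a + b = c)"
  by (auto simp: algebra_simps)

lemma bracket_apply: "bracket X Y u p = X (Y u) p - Y (X u) p"
  by (simp add: bracket_def)

text \<open>Closure under scaling takes the place of constants: leaf functions are 0 off the leaf,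
  so nonzero constants need not be among them. Both \<open>smooth_functions A\<close> and
  \<open>leaf_functions A T\<close> are instances.\<close>

locale fun_algebra =
  fixes C :: "('m \<Rightarrow> real) set"
  assumes zero_C [simp]: "0 \<in> C"
    and scale_C [simp]: "f \<in> C \<Longrightarrow> (\<lambda>_. c) * f \<in> C"
    and add_C [simp]: "f \<in> C \<Longrightarrow> g \<in> C \<Longrightarrow> f + g \<in> C"
    and mult_C [simp]: "f \<in> C \<Longrightarrow> g \<in> C \<Longrightarrow> f * g \<in> C"
begin

abbreviation "VF \<equiv> vector_fields C"

lemma uminus_C [simp]: "f \<in> C \<Longrightarrow> - f \<in> C"
proof -
  assume "f \<in> C"
  then have "(\<lambda>_. -1) * f \<in> C" by (rule scale_C)
  also have "(\<lambda>_. -1) * f = - f" by (simp add: fun_eq_iff)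
  finally show ?thesis .
qed

lemma diff_C [simp]: "f \<in> C \<Longrightarrow> g \<in> C \<Longrightarrow> f - g \<in> C"
  using add_C[of f "- g"] by simp

lemma vf_closed [simp]: "X \<in> VF \<Longrightarrow> f \<in> C \<Longrightarrow> X f \<in> C"
  unfolding vector_fields_def by blast

lemma vf_add: "X \<in> VF \<Longrightarrow> f \<in> C \<Longrightarrow> g \<in> C \<Longrightarrow> X (f + g) = X f + X g"
  unfolding vector_fields_def by blast

lemma vf_scale: "X \<in> VF \<Longrightarrow> f \<in> C \<Longrightarrow> X ((\<lambda>_. c) * f) = (\<lambda>_. c) * X f"
  unfolding vector_fields_def by blast

lemma vf_mult: "X \<in> VF \<Longrightarrow> f \<in> C \<Longrightarrow> g \<in> C \<Longrightarrow> X (f * g) = X f * g + f * X g"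
  unfolding vector_fields_def by blast

lemma vf_outside: "X \<in> VF \<Longrightarrow> f \<notin> C \<Longrightarrow> X f = 0"
  unfolding vector_fields_def by blast

lemma vf_zero: "X \<in> VF \<Longrightarrow> X 0 = 0"
proof -
  assume "X \<in> VF"
  from vf_add[OF this zero_C zero_C] have "X 0 = X 0 + X 0" by (simp only: add_0_left)
  then show ?thesis by (metis add_cancel_right_right)
qed

lemma vf_uminus:
  assumes X: "X \<in> VF" and f: "f \<in> C" shows "X (- f) = - X f"
proof -
  have "X f + X (- f) = X (f + - f)" by (rule vf_add[OF X f uminus_C[OF f], symmetric])
  also have "\<dots> = 0" using vf_zero[OF X] by simp
  finally show ?thesis by (rule minus_unique[symmetric])
qed

lemma vf_diff:
  assumes X: "X \<in> VF" and f: "f \<in> C" and g: "g \<in> C" shows "X (f - g) = X f - X g"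
  using vf_add[OF X f, of "- g"] vf_uminus[OF X g] g by simp

lemma VF_I:
  assumes "\<And>f. f \<in> C \<Longrightarrow> X f \<in> C"
    and "\<And>f g. f \<in> C \<Longrightarrow> g \<in> C \<Longrightarrow> X (f + g) = X f + X g"
    and "\<And>c f. f \<in> C \<Longrightarrow> X ((\<lambda>_. c) * f) = (\<lambda>_. c) * X f"
    and "\<And>f g. f \<in> C \<Longrightarrow> g \<in> C \<Longrightarrow> X (f * g) = X f * g + f * X g"
    and "\<And>f. f \<notin> C \<Longrightarrow> X f = 0"
  shows "X \<in> VF"
  using assms unfolding vector_fields_def by blast

lemmas vf_simps = vf_add vf_scale vf_mult vf_outside vf_zero vf_diff vf_uminus

lemma VF_zero [simp]: "0 \<in> VF"
  by (rule VF_I) auto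

lemma VF_add [simp]:
  assumes X: "X \<in> VF" and Y: "Y \<in> VF" shows "X + Y \<in> VF"
  by (rule VF_I) (use X Y in \<open>auto simp: vf_simps[OF X] vf_simps[OF Y] fun_eq_iff real_ring_simps\<close>)

lemma VF_uminus [simp]:
  assumes X: "X \<in> VF" shows "- X \<in> VF"
  by (rule VF_I) (use X in \<open>auto simp: vf_simps[OF X] fun_eq_iff real_ring_simps\<close>)

lemma VF_diff [simp]: "X \<in> VF \<Longrightarrow> Y \<in> VF \<Longrightarrow> X - Y \<in> VF"
  using VF_add[of X "- Y"] by simp

lemma VF_fmul [simp]:
  assumes f: "f \<in> C" and X: "X \<in> VF" shows "f \<odot> X \<in> VF"
  by (rule VF_I) (use f X in \<open>auto simp: fmul_def vf_simps[OF X] fun_eq_iff real_ring_simps\<close>)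

lemma VF_cmul [simp]:
  assumes X: "X \<in> VF" shows "cmul c X \<in> VF"
  by (rule VF_I) (use X in \<open>auto simp: cmul_def fmul_def vf_simps[OF X] fun_eq_iff real_ring_simps\<close>)

lemma VF_sum: "(\<And>i. i \<in> I \<Longrightarrow> X i \<in> VF) \<Longrightarrow> sum X I \<in> VF"
  by (induction I rule: infinite_finite_induct) auto

lemma VF_bracket [simp]:
  assumes X: "X \<in> VF" and Y: "Y \<in> VF" shows "bracket X Y \<in> VF"
  unfolding bracket_def
  by (rule VF_I) (use X Y in \<open>auto simp: vf_simps[OF X] vf_simps[OF Y] fun_eq_iff real_ring_simps\<close>)

lemma VF_eqI:
  assumes "X \<in> VF" "Y \<in> VF" "\<And>u p. u \<in> C \<Longrightarrow> X u p = Y u p"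
  shows "X = Y"
  using assms vf_outside by (metis ext)

lemma bracket_minus: "bracket Y X = - bracket X Y"
  by (simp add: bracket_def fun_eq_iff)

lemma bracket_add_left:
  assumes X: "X \<in> VF" and X': "X' \<in> VF" and Y: "Y \<in> VF"
  shows "bracket (X + X') Y = bracket X Y + bracket X' Y"
  by (rule VF_eqI) (use assms in \<open>auto simp: bracket_apply vf_simps[OF Y]\<close>)

lemma bracket_fmul_left:
  assumes f: "f \<in> C" and X: "X \<in> VF" and Y: "Y \<in> VF"
  shows "bracket (f \<odot> X) Y = f \<odot> bracket X Y - Y f \<odot> X"
proof (rule VF_eqI)
  fix u p assume "u \<in> C"
  then show "bracket (f \<odot> X) Y u p = (f \<odot> bracket X Y - Y f \<odot> X) u p"
    using assms by (simp add: bracket_apply vf_simps[OF Y] fmul_def[of f X] real_ring_simps)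
qed (use assms in simp_all)

lemma jacobi_identity:
  assumes X: "X \<in> VF" and Y: "Y \<in> VF" and Z: "Z \<in> VF"
  shows "bracket X (bracket Y Z) + bracket Y (bracket Z X) + bracket Z (bracket X Y) = 0"
proof (rule VF_eqI)
  fix u p assume "u \<in> C"
  then show "(bracket X (bracket Y Z) + bracket Y (bracket Z X) + bracket Z (bracket X Y)) u p = 0 u p"
    using assms by (simp add: bracket_def vf_diff[OF X] vf_diff[OF Y] vf_diff[OF Z])
qed (use assms in simp_all)

context
  fixes \<omega> assumes \<omega>: "one_form C \<omega>"
begin

lemma form_closed: "X \<in> VF \<Longrightarrow> \<omega> X \<in> C"
  using \<omega> unfolding one_form_def by blast

lemma form_add: "X \<in> VF \<Longrightarrow> Y \<in> VF \<Longrightarrow> \<omega> (X + Y) = \<omega> X + \<omega> Y"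
  using \<omega> unfolding one_form_def by blast

lemma form_fmul: "f \<in> C \<Longrightarrow> X \<in> VF \<Longrightarrow> \<omega> (f \<odot> X) = f * \<omega> X"
  using \<omega> unfolding one_form_def by blast

lemma form_zero: "\<omega> 0 = 0"
proof -
  from form_add[OF VF_zero VF_zero] have "\<omega> 0 = \<omega> 0 + \<omega> 0" by (simp only: add_0_left)
  then show ?thesis by (metis add_cancel_right_right)
qed

lemma form_uminus: "X \<in> VF \<Longrightarrow> \<omega> (- X) = - \<omega> X"
  using form_add[of X "- X"] form_zero by (intro minus_unique[symmetric]) simp

lemma form_sum: "(\<And>i. i \<in> I \<Longrightarrow> X i \<in> VF) \<Longrightarrow> \<omega> (sum X I) = (\<Sum>i\<in>I. \<omega> (X i))"
  by (induction I rule: infinite_finite_induct) (simp_all add: form_zero form_add VF_sum)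

lemma form_diff: "X \<in> VF \<Longrightarrow> Y \<in> VF \<Longrightarrow> \<omega> (X - Y) = \<omega> X - \<omega> Y"
  using form_add[of X "- Y"] by (simp add: form_uminus)

end

context
  fixes F assumes F: "endo_field C F"
begin

lemma endo_closed: "X \<in> VF \<Longrightarrow> F X \<in> VF"
  using F unfolding endo_field_def by blast

lemma endo_add: "X \<in> VF \<Longrightarrow> Y \<in> VF \<Longrightarrow> F (X + Y) = F X + F Y"
  using F unfolding endo_field_def by blast

lemma endo_fmul: "f \<in> C \<Longrightarrow> X \<in> VF \<Longrightarrow> F (f \<odot> X) = f \<odot> F X"
  using F unfolding endo_field_def by blast

lemma endo_zero: "F 0 = 0"
proof -
  from endo_add[OF VF_zero VF_zero] have "F 0 = F 0 + F 0" by (simp only: add_0_left)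
  then show ?thesis by (metis add_cancel_right_right)
qed

lemma endo_uminus: "X \<in> VF \<Longrightarrow> F (- X) = - F X"
  using endo_add[of X "- X"] endo_zero by (intro minus_unique[symmetric]) simp

lemma endo_sum: "(\<And>i. i \<in> I \<Longrightarrow> X i \<in> VF) \<Longrightarrow> F (sum X I) = (\<Sum>i\<in>I. F (X i))"
  by (induction I rule: infinite_finite_induct) (simp_all add: endo_zero endo_add VF_sum)

lemma endo_diff: "X \<in> VF \<Longrightarrow> Y \<in> VF \<Longrightarrow> F (X - Y) = F X - F Y"
  using endo_add[of X "- Y"] by (simp add: endo_uminus)

end

end

text \<open>Interpreted for the manifold and for a leaf alike, which makes \<open>koszul\<close>
  available on both sides of the comparison in \<open>koszul_leaf\<close>.\<close>

locale metric_connection = fun_algebra C for C :: "('m \<Rightarrow> real) set" +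
  fixes g :: "'m vfield \<Rightarrow> 'm vfield \<Rightarrow> 'm \<Rightarrow> real" and D
  assumes sym_form: "sym_form C g" and levi_civita: "levi_civita C g D"
begin

lemma g_form: "X \<in> VF \<Longrightarrow> one_form C (g X)"
  using sym_form unfolding sym_form_def by blast

lemma g_commute: "X \<in> VF \<Longrightarrow> Y \<in> VF \<Longrightarrow> g X Y = g Y X"
  using sym_form unfolding sym_form_def by blast

lemmas g_closed [simp] = form_closed[OF g_form]
lemmas g_add_right = form_add[OF g_form]
lemmas g_diff_right = form_diff[OF g_form]
lemmas g_uminus_right = form_uminus[OF g_form]
lemmas g_fmul_right = form_fmul[OF g_form]

lemma g_zero_left [simp]: "X \<in> VF \<Longrightarrow> g 0 X = 0"
  using g_commute[of 0 X] form_zero[OF g_form] by simp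

lemma g_add_left: "X \<in> VF \<Longrightarrow> Y \<in> VF \<Longrightarrow> Z \<in> VF \<Longrightarrow> g (X + Y) Z = g X Z + g Y Z"
  using g_add_right[of Z X Y] by (simp add: g_commute[of Z])

lemma g_diff_left: "X \<in> VF \<Longrightarrow> Y \<in> VF \<Longrightarrow> Z \<in> VF \<Longrightarrow> g (X - Y) Z = g X Z - g Y Z"
  using g_diff_right[of Z X Y] by (simp add: g_commute[of Z])

lemma g_uminus_left: "X \<in> VF \<Longrightarrow> Z \<in> VF \<Longrightarrow> g (- X) Z = - g X Z"
  using g_uminus_right[of Z X] by (simp add: g_commute[of Z])

lemma g_fmul_left: "f \<in> C \<Longrightarrow> X \<in> VF \<Longrightarrow> Z \<in> VF \<Longrightarrow> g (f \<odot> X) Z = f * g X Z"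
  using g_fmul_right[of Z f X] by (simp add: g_commute[of Z])

lemma D_endo: "Y \<in> VF \<Longrightarrow> endo_field C (\<lambda>X. D X Y)"
  using levi_civita unfolding levi_civita_def by blast

lemma D_closed [simp]: "X \<in> VF \<Longrightarrow> Y \<in> VF \<Longrightarrow> D X Y \<in> VF"
  using endo_closed[OF D_endo] .

lemma D_add_left: "X \<in> VF \<Longrightarrow> X' \<in> VF \<Longrightarrow> Y \<in> VF \<Longrightarrow> D (X + X') Y = D X Y + D X' Y"
  using endo_add[OF D_endo] .

lemma D_diff_left: "X \<in> VF \<Longrightarrow> X' \<in> VF \<Longrightarrow> Y \<in> VF \<Longrightarrow> D (X - X') Y = D X Y - D X' Y"
  using endo_diff[OF D_endo] .

lemma D_uminus_left: "X \<in> VF \<Longrightarrow> Y \<in> VF \<Longrightarrow> D (- X) Y = - D X Y"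
  using endo_uminus[OF D_endo] .

lemma D_fmul_left: "f \<in> C \<Longrightarrow> X \<in> VF \<Longrightarrow> Y \<in> VF \<Longrightarrow> D (f \<odot> X) Y = f \<odot> D X Y"
  using endo_fmul[OF D_endo] .

lemma D_add_right: "X \<in> VF \<Longrightarrow> Y \<in> VF \<Longrightarrow> Z \<in> VF \<Longrightarrow> D X (Y + Z) = D X Y + D X Z"
  using levi_civita unfolding levi_civita_def by blast

lemma D_fmul_right:
  "X \<in> VF \<Longrightarrow> Y \<in> VF \<Longrightarrow> f \<in> C \<Longrightarrow> D X (f \<odot> Y) = X f \<odot> Y + f \<odot> D X Y"
  using levi_civita unfolding levi_civita_def by blast

lemma D_zero_right: "X \<in> VF \<Longrightarrow> D X 0 = 0"
proof -
  assume "X \<in> VF"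
  from D_add_right[OF this VF_zero VF_zero] have "D X 0 = D X 0 + D X 0" by (simp only: add_0_left)
  then show ?thesis by (metis add_cancel_right_right)
qed

lemma D_uminus_right: "X \<in> VF \<Longrightarrow> Y \<in> VF \<Longrightarrow> D X (- Y) = - D X Y"
  using D_add_right[of X Y "- Y"] D_zero_right by (intro minus_unique[symmetric]) simp

lemma D_diff_right: "X \<in> VF \<Longrightarrow> Y \<in> VF \<Longrightarrow> Z \<in> VF \<Longrightarrow> D X (Y - Z) = D X Y - D X Z"
  using D_add_right[of X Y "- Z"] by (simp add: D_uminus_right)

lemma torsion_free: "X \<in> VF \<Longrightarrow> Y \<in> VF \<Longrightarrow> bracket X Y = D X Y - D Y X"
  using levi_civita unfolding levi_civita_def by metis

lemma metric: "X \<in> VF \<Longrightarrow> Y \<in> VF \<Longrightarrow> Z \<in> VF \<Longrightarrow> X (g Y Z) = g (D X Y) Z + g Y (D X Z)"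
  using levi_civita unfolding levi_civita_def by blast

text \<open>The right-hand side consists of the metric, brackets and derivations, all of which are
  compatible with restriction to a leaf. Hence the left-hand side is as well.\<close>

lemma koszul:
  assumes X: "X \<in> VF" and Y: "Y \<in> VF" and Z: "Z \<in> VF"
  shows "2 * g (D X Y) Z = X (g Y Z) + Y (g Z X) - Z (g X Y)
    + g (bracket X Y) Z - g (bracket Y Z) X + g (bracket Z X) Y"
proof -
  have "g V (D U W) = g (D U W) V" if "V \<in> VF" "U \<in> VF" "W \<in> VF" for U V W
    using that by (intro g_commute) auto
  then show ?thesis
    using assms by (simp add: metric[OF X] metric[OF Y] metric[OF Z] torsion_free g_diff_left)
qed

section \<open>Symmetries of the curvature tensor\<close>

abbreviation "R \<equiv> curvature D"

lemma R_closed [simp]: "X \<in> VF \<Longrightarrow> Y \<in> VF \<Longrightarrow> Z \<in> VF \<Longrightarrow> R X Y Z \<in> VF"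
  by (simp add: curvature_def)

lemma R_swap: "X \<in> VF \<Longrightarrow> Y \<in> VF \<Longrightarrow> Z \<in> VF \<Longrightarrow> R Y X Z = - R X Y Z"
  by (simp add: curvature_def bracket_minus[of Y X] D_uminus_left)

lemma R_endo:
  assumes "Y \<in> VF" "Z \<in> VF" shows "endo_field C (\<lambda>X. R X Y Z)"
  unfolding endo_field_def
proof (intro conjI ballI)
  fix X X' assume "X \<in> VF" "X' \<in> VF"
  then show "R (X + X') Y Z = R X Y Z + R X' Y Z" using assms
    by (simp add: curvature_def bracket_add_left D_add_left D_add_right)
next
  fix f X assume "f \<in> C" "X \<in> VF"
  then show "R (f \<odot> X) Y Z = f \<odot> R X Y Z" using assms
    by (simp add: curvature_def bracket_fmul_left D_fmul_left D_fmul_right D_diff_left)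
      (simp add: fun_eq_iff algebra_simps)
qed (use assms in simp)

text \<open>Apply \<open>bracket X Y\<close> to the function \<open>g Z W\<close>, once by metric
  compatibility and once as a commutator of derivations. The mixed terms with one derivative on each
  of Z and W cancel.\<close>

lemma R_skew:
  assumes X: "X \<in> VF" and Y: "Y \<in> VF" and Z: "Z \<in> VF" and W: "W \<in> VF"
  shows "g (R X Y Z) W = - g (R X Y W) Z"
proof -
  have "bracket X Y (g Z W) = X (Y (g Z W)) - Y (X (g Z W))" by (simp add: bracket_def)
  then have "g (D (bracket X Y) Z) W + g Z (D (bracket X Y) W) =
     X (g (D Y Z) W + g Z (D Y W)) - Y (g (D X Z) W + g Z (D X W))"
    using assms by (simp only: metric VF_bracket)
  then have a: "g (D (bracket X Y) Z) W + g Z (D (bracket X Y) W) =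
     g (D X (D Y Z)) W + g Z (D X (D Y W)) - (g (D Y (D X Z)) W + g Z (D Y (D X W)))"
    using assms by (simp add: metric[OF X] metric[OF Y] vf_add[OF X] vf_add[OF Y])
  have b: "g (R X Y Z) W = g (D X (D Y Z)) W - g (D Y (D X Z)) W - g (D (bracket X Y) Z) W"
    using assms by (simp add: curvature_def g_diff_left)
  have c: "g (R X Y W) Z = g Z (D X (D Y W)) - g Z (D Y (D X W)) - g Z (D (bracket X Y) W)"
    using assms by (simp add: g_commute[of "R X Y W" Z]) (simp add: curvature_def g_diff_right)
  show ?thesis
  proof
    fix q
    show "g (R X Y Z) W q = (- g (R X Y W) Z) q"
      using fun_cong[OF a, of q] unfolding b c plus_fun_apply minus_apply uminus_apply by linarith
  qed
qed

text \<open>Grouped by the outer field, each group is D X [Y, Z] - D [Y, Z] X = [X, [Y, Z]] because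
  the torsion vanishes. What remains is the Jacobi identity.\<close>

lemma bianchi:
  assumes X: "X \<in> VF" and Y: "Y \<in> VF" and Z: "Z \<in> VF"
  shows "R X Y Z + R Y Z X + R Z X Y = 0"
proof -
  have "R X Y Z + R Y Z X + R Z X Y =
    (D X (D Y Z - D Z Y) - D (bracket Y Z) X) + (D Y (D Z X - D X Z) - D (bracket Z X) Y)
    + (D Z (D X Y - D Y X) - D (bracket X Y) Z)"
    using assms by (simp add: curvature_def D_diff_right)
  also have "\<dots> = bracket X (bracket Y Z) + bracket Y (bracket Z X) + bracket Z (bracket X Y)"
    using assms torsion_free[of X "bracket Y Z"] torsion_free[of Y "bracket Z X"]
      torsion_free[of Z "bracket X Y"] torsion_free[of Y Z] torsion_free[of Z X] torsion_free[of X Y]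
    by simp
  finally show ?thesis using jacobi_identity[OF assms] by simp
qed

text \<open>The four cyclic identities, one for each field in the last slot, and the antisymmetry
  within both pairs are linear relations between real numbers at p. The pair symmetry is a linear
  combination of them.\<close>

lemma R_pair_symmetry:
  assumes X: "X \<in> VF" and Y: "Y \<in> VF" and Z: "Z \<in> VF" and W: "W \<in> VF"
  shows "g (R X Y Z) W = g (R Z W X) Y"
proof
  fix p
  have b: "g (R X Y Z) W p + g (R Y Z X) W p + g (R Z X Y) W p = 0"
    if "X \<in> VF" "Y \<in> VF" "Z \<in> VF" "W \<in> VF" for X Y Z W
    using arg_cong[OF bianchi[OF that(1-3)], of "\<lambda>V. g V W p"] that by (simp add: g_add_left)
  have s: "g (R Y X Z) W p = - g (R X Y Z) W p"
    if "X \<in> VF" "Y \<in> VF" "Z \<in> VF" "W \<in> VF" for X Y Z W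
    using R_swap[OF that(1-3)] that by (simp add: g_uminus_left)
  have k: "g (R X Y Z) W p = - g (R X Y W) Z p"
    if "X \<in> VF" "Y \<in> VF" "Z \<in> VF" "W \<in> VF" for X Y Z W
    using R_skew[OF that] by simp
  show "g (R X Y Z) W p = g (R Z W X) Y p"
    using b[OF X Y Z W] b[OF Y Z W X] b[OF Z W X Y] b[OF W X Y Z]
      k[OF X Y Z W] k[OF Y Z X W] k[OF Z X Y W] k[OF Z W X Y] k[OF Y Z W X] k[OF W X Y Z]
      k[OF W Y X Z] k[OF W X Z Y] k[OF X Z W Y] k[OF Y W X Z] k[OF Z X W Y]
      s[OF Z X Y W] s[OF W Y X Z] s[OF X Z Y W] s[OF W Y Z X] s[OF Z X W Y] s[OF X Z W Y] s[OF X W Y Z] s[OF X W Z Y]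
      s[OF Y W X Z] s[OF Y W Z X]
    by linarith
qed

end

text \<open>\<open>tensorial\<close> is the point where geometry enters the algebra: C-linear maps
  on fields depend on pointwise values only. For a manifold this is
  \<open>manifold.tensorial\<close>, proved with bump functions and coordinate fields.\<close>

locale tensorial_connection = metric_connection C g D
  for C :: "('m \<Rightarrow> real) set" and g D +
  fixes n :: nat
  assumes const_C [simp]: "(\<lambda>_. c) \<in> C"
    and tensorial: "one_form C \<omega> \<Longrightarrow> X \<in> vector_fields C \<Longrightarrow> value_at X p = 0 \<Longrightarrow> \<omega> X p = 0"
    and signature: "signature_at C g p (n + 1) n"
begin

lemma one_C [simp]: "1 \<in> C"
  using const_C[of 1] by (simp add: one_fun_def)

definition sgn_at :: "nat \<Rightarrow> real" where
  "sgn_at i = (if i < n + 1 then 1 else -1)"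

text \<open>Orthonormality at the single point \<open>p\<close> suffices, since only tensors are evaluated on the frame.\<close>
definition frame :: "'m \<Rightarrow> (nat \<Rightarrow> 'm vfield) \<Rightarrow> bool" where
  "frame p E \<longleftrightarrow> (\<forall>i<2*n+1. E i \<in> VF) \<and>
     tv.span ((\<lambda>i. value_at (E i) p) ` {..<2*n+1}) = tangent_space C p \<and>
     (\<forall>i<2*n+1. \<forall>j<2*n+1. g (E i) (E j) p = (if i = j then sgn_at i else 0))"

lemma frame_exists: "\<exists>E. frame p E"
proof -
  have "n + 1 + n = 2 * n + 1" by simp
  with signature[of p] obtain E where
    "(\<forall>i<2*n+1. E i \<in> VF)"
    "tv.span ((\<lambda>i. value_at (E i) p) ` {..<2*n+1}) = tangent_space C p"
    "(\<forall>i<2*n+1. \<forall>j<2*n+1. g (E i) (E j) p = (if i \<noteq> j then 0 else if i < n + 1 then 1 else -1))"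
    unfolding signature_at_def by metis
  then have "frame p E" unfolding frame_def sgn_at_def by simp
  then show ?thesis by blast
qed

lemma form_cmul: "one_form C \<omega> \<Longrightarrow> X \<in> VF \<Longrightarrow> \<omega> (cmul c X) p = c * \<omega> X p"
  by (simp add: cmul_def form_fmul)

lemma form_value_cong:
  assumes \<omega>: "one_form C \<omega>" and "X \<in> VF" "Y \<in> VF" "value_at X p = value_at Y p"
  shows "\<omega> X p = \<omega> Y p"
proof -
  have "value_at (X - Y) p = 0" using assms(4) by (simp add: value_at_def fun_eq_iff)
  then have "\<omega> (X - Y) p = 0" using assms by (intro tensorial[OF \<omega>]) auto
  then show ?thesis using assms by (simp add: form_diff[OF \<omega>])
qed

lemma sgn_at_square [simp]: "sgn_at i * sgn_at i = 1"
  by (simp add: sgn_at_def)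

section \<open>Orthonormal frames at a point\<close>

context
  fixes p E assumes E: "frame p E"
begin

lemma frame_VF [simp]: "i < 2 * n + 1 \<Longrightarrow> E i \<in> VF"
  using E by (simp add: frame_def)

lemma frame_orthonormal:
  "i < 2 * n + 1 \<Longrightarrow> j < 2 * n + 1 \<Longrightarrow> g (E i) (E j) p = (if i = j then sgn_at i else 0)"
  using E by (simp add: frame_def)

text \<open>The values of constant combinations of the frame form a subspace that contains the
  frame, hence the whole tangent space. A coefficient is read off by pairing with
  \<open>E j\<close>, and the sign corrects for g (E j) (E j) = -1.\<close>

lemma frame_value:
  assumes X: "X \<in> VF"
  shows "value_at X p = value_at (\<Sum>i<2*n+1. cmul (sgn_at i * g X (E i) p) (E i)) p"
proof -
  let ?V = "\<lambda>c. \<Sum>i<2*n+1. cmul (c i) (E i)"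
  have V: "?V c \<in> VF" for c by (intro VF_sum) auto
  have "value_at X p \<in> tv.span ((\<lambda>i. value_at (E i) p) ` {..<2*n+1})"
    using E X by (simp add: frame_def tangent_space_def)
  moreover have "tv.span ((\<lambda>i. value_at (E i) p) ` {..<2*n+1}) \<subseteq> {value_at (?V c) p | c. True}"
  proof (rule tv.span_minimal)
    show "(\<lambda>i. value_at (E i) p) ` {..<2*n+1} \<subseteq> {value_at (?V c) p | c. True}"
    proof clarify
      fix j assume j: "j < 2*n+1"
      have "value_at (E j) p = value_at (?V (\<lambda>i. if i = j then 1 else 0)) p"
        using j by (simp add: value_at_def fun_eq_iff sum_fun_apply if_distrib[of "\<lambda>x. x * _"] cong: if_cong)
      then show "\<exists>c. value_at (E j) p = value_at (?V c) p \<and> True"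
        by (intro exI[of _ "\<lambda>i. if i = j then 1 else 0"] conjI TrueI)
    qed
    show "tv.subspace {value_at (?V c) p | c. True}"
      unfolding tv.subspace_def
    proof (intro conjI ballI allI)
      have "0 = value_at (?V (\<lambda>i. 0)) p"
        by (simp add: value_at_def fun_eq_iff sum_fun_apply)
      then show "0 \<in> {value_at (?V c) p | c. True}"
        by (intro CollectI exI[of _ "\<lambda>i. 0"] conjI TrueI)
    next
      fix x y assume "x \<in> {value_at (?V c) p | c. True}" "y \<in> {value_at (?V c) p | c. True}"
      then obtain c d where "x = value_at (?V c) p" "y = value_at (?V d) p" by blast
      then have "x + y = value_at (?V (\<lambda>i. c i + d i)) p"
        by (simp add: value_at_def fun_eq_iff sum_fun_apply algebra_simps sum.distrib)
      then show "x + y \<in> {value_at (?V c) p | c. True}"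
        by (intro CollectI exI[of _ "\<lambda>i. c i + d i"] conjI TrueI)
    next
      fix x r assume "x \<in> {value_at (?V c) p | c. True}"
      then obtain c where "x = value_at (?V c) p" by blast
      then have "(\<lambda>f. r * x f) = value_at (?V (\<lambda>i. r * c i)) p"
        by (simp add: value_at_def fun_eq_iff sum_fun_apply sum_distrib_left mult.assoc del: sum.lessThan_Suc)
      then show "(\<lambda>f. r * x f) \<in> {value_at (?V c) p | c. True}"
        by (intro CollectI exI[of _ "\<lambda>i. r * c i"] conjI TrueI)
    qed
  qed
  ultimately obtain c where c: "value_at X p = value_at (?V c) p" by blast
  have "sgn_at j * g X (E j) p = c j" if j: "j < 2*n+1" for j
  proof -
    have "g (E j) X p = g (E j) (?V c) p"
      by (rule form_value_cong[OF g_form[OF frame_VF[OF j]] X V c])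
    also have "\<dots> = (\<Sum>i<2*n+1. c i * g (E j) (E i) p)"
      by (subst form_sum[OF g_form[OF frame_VF[OF j]]])
        (auto simp: sum_fun_apply form_cmul[OF g_form[OF frame_VF[OF j]]] intro!: sum.cong)
    also have "\<dots> = (\<Sum>i<2*n+1. if i = j then c j * sgn_at j else 0)"
      using j by (intro sum.cong) (auto simp: frame_orthonormal)
    also have "\<dots> = c j * sgn_at j" using j by simp
    finally show ?thesis
      using g_commute[OF X frame_VF[OF j]] by simp
  qed
  then show ?thesis
    unfolding c by (intro arg_cong[where f = "\<lambda>V. value_at V p"] sum.cong) auto
qed

lemma frame_form:
  assumes \<omega>: "one_form C \<omega>" and X: "X \<in> VF"
  shows "\<omega> X p = (\<Sum>i<2*n+1. sgn_at i * g X (E i) p * \<omega> (E i) p)"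
proof -
  have "(\<Sum>i<2*n+1. cmul (sgn_at i * g X (E i) p) (E i)) \<in> VF" by (intro VF_sum) auto
  from form_value_cong[OF \<omega> X this frame_value[OF X]]
  show ?thesis
    by (subst (asm) form_sum[OF \<omega>]) (auto simp: sum_fun_apply form_cmul[OF \<omega>] intro!: sum.cong)
qed

text \<open>An adjoint pair may change slots under a contraction with the metric. Expand
  \<open>F (E i)\<close> in the frame, exchange the sums and collapse the expansion of
  \<open>G (E j)\<close>.\<close>

lemma frame_sum_transpose:
  assumes F: "endo_field C F" and G: "endo_field C G"
    and FG: "\<And>X Y. X \<in> VF \<Longrightarrow> Y \<in> VF \<Longrightarrow> g (F X) Y = g X (G Y)"
    and T1: "\<And>Y. Y \<in> VF \<Longrightarrow> one_form C (\<lambda>X. T X Y)" and T2: "\<And>X. X \<in> VF \<Longrightarrow> one_form C (T X)"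
  shows "(\<Sum>i<2*n+1. sgn_at i * T (F (E i)) (E i) p) = (\<Sum>i<2*n+1. sgn_at i * T (E i) (G (E i)) p)"
proof -
  have "(\<Sum>i<2*n+1. sgn_at i * T (F (E i)) (E i) p) =
    (\<Sum>i<2*n+1. \<Sum>j<2*n+1. sgn_at i * (sgn_at j * g (F (E i)) (E j) p * T (E j) (E i) p))"
    by (intro sum.cong refl, subst frame_form[OF T1])
      (auto simp: endo_closed[OF F] sum_distrib_left simp del: sum.lessThan_Suc)
  also have "\<dots> = (\<Sum>j<2*n+1. \<Sum>i<2*n+1. sgn_at j * (sgn_at i * g (G (E j)) (E i) p * T (E j) (E i) p))"
    by (subst sum.swap, intro sum.cong refl)
      (simp add: FG g_commute[of _ "G _"] endo_closed[OF G] mult_ac)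
  also have "\<dots> = (\<Sum>i<2*n+1. sgn_at i * T (E i) (G (E i)) p)"
    by (intro sum.cong refl, subst frame_form[OF T2, of _ "G _"])
      (auto simp: endo_closed[OF G] sum_distrib_left simp del: sum.lessThan_Suc)
  finally show ?thesis .
qed

text \<open>\<open>tensorial\<close> speaks of forms only; pairing F with the frame fields reduces
  endomorphisms to forms, and \<open>frame_value\<close> recovers the vector.\<close>

lemma endo_value_zero:
  assumes F: "endo_field C F" and X: "X \<in> VF" and "value_at X p = 0"
  shows "value_at (F X) p = 0"
proof -
  have FX: "F X \<in> VF" using endo_closed[OF F X] .
  have "g (F X) (E i) p = 0" if i: "i < 2*n+1" for i
  proof -
    have "one_form C (\<lambda>X. g (F X) (E i))"
      unfolding one_form_def using i
      by (auto simp: endo_closed[OF F] endo_add[OF F] endo_fmul[OF F] g_add_left g_fmul_left)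
    from tensorial[OF this X assms(3)] show ?thesis .
  qed
  then show ?thesis
    unfolding frame_value[OF FX] by (simp add: value_at_def fun_eq_iff sum_fun_apply)
qed

text \<open>Well-definedness of the choice in \<open>endo_at\<close>: two candidates differ by the
  image of a field that vanishes at p.\<close>

lemma endo_at_value:
  assumes F: "endo_field C F" and X: "X \<in> VF"
  shows "endo_at C F p (value_at X p) = value_at (F X) p"
  unfolding endo_at_def
proof (rule some_equality)
  show "\<exists>Y\<in>VF. value_at Y p = value_at X p \<and> value_at (F X) p = value_at (F Y) p"
    using X by blast
  fix w assume "\<exists>Y\<in>VF. value_at Y p = value_at X p \<and> w = value_at (F Y) p"
  then obtain Y where Y: "Y \<in> VF" "value_at Y p = value_at X p" "w = value_at (F Y) p" by blast
  then have "value_at (F (Y - X)) p = 0"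
    using X by (intro endo_value_zero[OF F]) (auto simp: value_at_def fun_eq_iff)
  then show "w = value_at (F X) p"
    using X Y by (simp add: endo_diff[OF F] value_at_def fun_eq_iff)
qed

text \<open>\<open>trace_at\<close> uses an arbitrary chosen basis B. The fields \<open>L v\<close>
  realize its vectors, so that forms can be evaluated on them. Expanding \<open>L v\<close> in the
  frame and \<open>F (E i)\<close> in B gives the same double sum in both orders.\<close>

lemma frame_trace:
  assumes F: "endo_field C F"
  shows "trace_at C F p = (\<Sum>i<2*n+1. sgn_at i * g (F (E i)) (E i) p)"
proof -
  define V where "V = tangent_space C p"
  define B where "B = (SOME B. tv.independent B \<and> tv.span B = V)"
  have V: "V = tv.span ((\<lambda>i. value_at (E i) p) ` {..<2*n+1})"
    using E by (simp add: frame_def V_def)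
  have "\<exists>B. tv.independent B \<and> tv.span B = V"
  proof -
    obtain B where "B \<subseteq> V" "tv.independent B" "V \<subseteq> tv.span B"
      using tv.maximal_independent_subset[of V] by blast
    moreover have "tv.span B \<subseteq> V"
      using \<open>B \<subseteq> V\<close> by (intro tv.span_minimal) (simp_all add: V tv.subspace_span)
    ultimately show ?thesis by blast
  qed
  then have B: "tv.independent B" "tv.span B = V"
    unfolding B_def by (metis (mono_tags, lifting) someI_ex)+
  have BV: "B \<subseteq> V" using B tv.span_superset by blast
  have fin: "finite B"
    using tv.independent_span_bound[OF _ B(1), of "(\<lambda>i. value_at (E i) p) ` {..<2*n+1}"] BV V by simp
  have "\<forall>v\<in>B. \<exists>X\<in>VF. value_at X p = v"
    using BV unfolding V_def tangent_space_def by blast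
  then obtain L where L: "\<And>v. v \<in> B \<Longrightarrow> L v \<in> VF" "\<And>v. v \<in> B \<Longrightarrow> value_at (L v) p = v"
    by metis
  have val: "value_at X p \<in> tv.span B" if "X \<in> VF" for X
    using that B(2) by (simp add: V_def tangent_space_def)
  let ?r = "\<lambda>X v. tv.representation B (value_at X p) v"
  have expand: "\<omega> X p = (\<Sum>v\<in>B. ?r X v * \<omega> (L v) p)" if \<omega>: "one_form C \<omega>" and X: "X \<in> VF" for \<omega> X
  proof -
    have W: "(\<Sum>v\<in>B. cmul (?r X v) (L v)) \<in> VF" using L by (intro VF_sum) auto
    have "value_at X p = (\<Sum>v\<in>B. (\<lambda>f. ?r X v * v f))"
      using tv.sum_representation_eq[OF B(1) val[OF X] fin] by simp
    also have "\<dots> = value_at (\<Sum>v\<in>B. cmul (?r X v) (L v)) p"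
    proof
      fix f
      have "(\<Sum>v\<in>B. ?r X v * v f) = (\<Sum>v\<in>B. ?r X v * L v f p)"
      proof (rule sum.cong[OF refl])
        fix v assume "v \<in> B"
        then show "?r X v * v f = ?r X v * L v f p"
          using fun_cong[OF L(2), of v f] by (simp add: value_at_def)
      qed
      then show "(\<Sum>v\<in>B. (\<lambda>f. ?r X v * v f)) f = value_at (\<Sum>v\<in>B. cmul (?r X v) (L v)) p f"
        by (simp add: value_at_def sum_fun_apply)
    qed
    finally have "\<omega> X p = \<omega> (\<Sum>v\<in>B. cmul (?r X v) (L v)) p"
      by (rule form_value_cong[OF \<omega> X W])
    also have "\<dots> = (\<Sum>v\<in>B. ?r X v * \<omega> (L v) p)"
      using L by (subst form_sum[OF \<omega>]) (auto simp: sum_fun_apply form_cmul[OF \<omega>] intro!: sum.cong)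
    finally show ?thesis .
  qed
  have rep: "?r (F (L v)) v = (\<Sum>i<2*n+1. sgn_at i * g (L v) (E i) p * ?r (F (E i)) v)" if v: "v \<in> B" for v
  proof -
    let ?S = "\<Sum>i<2*n+1. cmul (sgn_at i * g (L v) (E i) p) (E i)"
    have S: "?S \<in> VF" by (intro VF_sum) auto
    have "value_at (F (L v)) p = value_at (F ?S) p"
      using endo_at_value[OF F L(1)[OF v]] endo_at_value[OF F S] frame_value[OF L(1)[OF v]] by simp
    also have "F ?S = (\<Sum>i<2*n+1. cmul (sgn_at i * g (L v) (E i) p) (F (E i)))"
      by (subst endo_sum[OF F]) (auto simp: cmul_def endo_fmul[OF F] intro!: sum.cong simp del: sum.lessThan_Suc)
    also have "value_at \<dots> p = (\<Sum>i<2*n+1. (\<lambda>f. (sgn_at i * g (L v) (E i) p) * value_at (F (E i)) p f))"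
      by (simp add: value_at_def fun_eq_iff sum_fun_apply)
    finally have "?r (F (L v)) v = (\<Sum>i<2*n+1. tv.representation B (\<lambda>f. (sgn_at i * g (L v) (E i) p) * value_at (F (E i)) p f) v)"
      using tv.representation_sum[OF B(1), of "{..<2*n+1}" "\<lambda>i f. (sgn_at i * g (L v) (E i) p) * value_at (F (E i)) p f"]
        tv.span_scale[OF val[OF endo_closed[OF F frame_VF]]] by simp
    also have "\<dots> = (\<Sum>i<2*n+1. sgn_at i * g (L v) (E i) p * ?r (F (E i)) v)"
      by (intro sum.cong refl) (simp add: tv.representation_scale[OF B(1) val[OF endo_closed[OF F frame_VF]]])
    finally show ?thesis .
  qed
  have "trace_at C F p = (\<Sum>v\<in>B. tv.representation B (endo_at C F p v) v)"
    unfolding trace_at_def Let_def B_def V_def ..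
  also have "\<dots> = (\<Sum>v\<in>B. ?r (F (L v)) v)"
    using endo_at_value[OF F L(1)] L(2) by (intro sum.cong) auto
  also have "\<dots> = (\<Sum>v\<in>B. \<Sum>i<2*n+1. sgn_at i * g (L v) (E i) p * ?r (F (E i)) v)"
    by (intro sum.cong refl rep)
  also have "\<dots> = (\<Sum>i<2*n+1. \<Sum>v\<in>B. sgn_at i * g (L v) (E i) p * ?r (F (E i)) v)"
    by (rule sum.swap)
  also have "\<dots> = (\<Sum>i<2*n+1. sgn_at i * g (F (E i)) (E i) p)"
  proof (intro sum.cong refl)
    fix i assume "i \<in> {..<2*n+1}"
    then have i: "E i \<in> VF" by simp
    have "g (F (E i)) (E i) p = g (E i) (F (E i)) p"
      using g_commute[OF i endo_closed[OF F i]] by simp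
    also have "\<dots> = (\<Sum>v\<in>B. ?r (F (E i)) v * g (E i) (L v) p)"
      by (rule expand[OF g_form[OF i] endo_closed[OF F i]])
    also have "\<dots> = (\<Sum>v\<in>B. ?r (F (E i)) v * g (L v) (E i) p)"
      using g_commute[OF i L(1)] by (intro sum.cong) auto
    finally show "(\<Sum>v\<in>B. sgn_at i * g (L v) (E i) p * ?r (F (E i)) v) = sgn_at i * g (F (E i)) (E i) p"
      by (simp add: sum_distrib_left mult_ac)
  qed
  finally show ?thesis .
qed

end

text \<open>By \<open>frame_value\<close> a field is determined at each point by its pairings with a
  frame. Identities between vector fields are proved below by testing against an arbitrary Z in this
  way.\<close>

lemma nondegenerate:
  assumes X: "X \<in> VF" and Y: "Y \<in> VF" and eq: "\<And>Z. Z \<in> VF \<Longrightarrow> g X Z = g Y Z"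
  shows "X = Y"
proof (rule VF_eqI[OF X Y])
  fix u p
  obtain E where E: "frame p E" using frame_exists by blast
  have "value_at X p = value_at Y p"
    unfolding frame_value[OF E X] frame_value[OF E Y] using eq[OF frame_VF[OF E]]
    by (intro arg_cong[where f = "\<lambda>V. value_at V p"] sum.cong) auto
  then show "X u p = Y u p" by (simp add: value_at_def fun_eq_iff)
qed

end


section \<open>The covariant derivative of the structure tensor\<close>

locale almost_Kenmotsu = tensorial_connection C g D n
  for C :: "('m \<Rightarrow> real) set" and g D n +
  fixes \<alpha> :: real and \<phi> \<xi> \<eta>
  assumes kenmotsu: "almost_para_Kenmotsu C \<alpha> n \<phi> \<xi> \<eta> g"
begin

lemma paracontact: "almost_paracontact_metric C n \<phi> \<xi> \<eta> g"
  using kenmotsu unfolding almost_para_Kenmotsu_def by blast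

lemma phi_endo: "endo_field C \<phi>"
  using paracontact unfolding almost_paracontact_metric_def by blast

lemma xi_VF [simp]: "\<xi> \<in> VF"
  using paracontact unfolding almost_paracontact_metric_def by blast

lemma eta_form: "one_form C \<eta>"
  using paracontact unfolding almost_paracontact_metric_def by blast

lemma eta_xi [simp]: "\<eta> \<xi> = 1"
  using paracontact unfolding almost_paracontact_metric_def by blast

lemma phi_phi: "X \<in> VF \<Longrightarrow> \<phi> (\<phi> X) = X - \<eta> X \<odot> \<xi>"
  using paracontact unfolding almost_paracontact_metric_def by blast

lemma g_phi_phi: "X \<in> VF \<Longrightarrow> Y \<in> VF \<Longrightarrow> g (\<phi> X) (\<phi> Y) = - g X Y + \<eta> X * \<eta> Y"
  using paracontact unfolding almost_paracontact_metric_def by blast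

lemma eta_closed_form: "X \<in> VF \<Longrightarrow> Y \<in> VF \<Longrightarrow> X (\<eta> Y) - Y (\<eta> X) - \<eta> (bracket X Y) = 0"
  using kenmotsu unfolding almost_para_Kenmotsu_def ext_deriv1_def by blast

lemma d_fundamental:
  "X \<in> VF \<Longrightarrow> Y \<in> VF \<Longrightarrow> Z \<in> VF \<Longrightarrow>
     ext_deriv2 (fundamental_form \<phi> g) X Y Z = (\<lambda>_. 2 * \<alpha>) * wedge12 \<eta> (fundamental_form \<phi> g) X Y Z"
  using kenmotsu unfolding almost_para_Kenmotsu_def by blast

lemmas phi_closed [simp] = endo_closed[OF phi_endo]
lemmas phi_linear = endo_add[OF phi_endo] endo_diff[OF phi_endo] endo_fmul[OF phi_endo]
  endo_uminus[OF phi_endo]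
lemmas eta_closed [simp] = form_closed[OF eta_form]
lemmas eta_linear = form_add[OF eta_form] form_diff[OF eta_form] form_fmul[OF eta_form]
  form_uminus[OF eta_form]
lemmas g_linear = g_add_left g_add_right g_diff_left g_diff_right g_fmul_left g_fmul_right
  g_uminus_left g_uminus_right

lemma one_fmul [simp]: "1 \<odot> X = X"
  by (simp add: fun_eq_iff)

lemma zero_fmul [simp]: "0 \<odot> X = 0"
  by (simp add: fun_eq_iff)

lemma fmul_zero [simp]: "f \<odot> 0 = 0"
  by (simp add: fun_eq_iff)

text \<open>Since \<phi> \<phi> \<xi> = 0, the rule \<open>phi_phi\<close> at \<phi> \<xi> gives
  \<phi> \<xi> = k \<xi> with k = \<eta>(\<phi> \<xi>). Then 0 = \<phi> \<phi> \<xi> = k^2 \<xi>,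
  and k vanishes pointwise.\<close>

lemma phi_xi [simp]: "\<phi> \<xi> = 0"
proof -
  have 0: "\<phi> (\<phi> \<xi>) = 0" by (simp add: phi_phi)
  then have "\<phi> (\<phi> (\<phi> \<xi>)) = 0" using endo_zero[OF phi_endo] by simp
  then have 1: "\<phi> \<xi> = \<eta> (\<phi> \<xi>) \<odot> \<xi>" using phi_phi[of "\<phi> \<xi>"] by simp
  then have "\<phi> (\<phi> \<xi>) = \<eta> (\<phi> \<xi>) \<odot> (\<eta> (\<phi> \<xi>) \<odot> \<xi>)"
    by (metis phi_linear(3) eta_closed phi_closed xi_VF)
  then have "\<eta> (\<eta> (\<phi> \<xi>) \<odot> (\<eta> (\<phi> \<xi>) \<odot> \<xi>)) = 0" using 0 form_zero[OF eta_form] by simp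
  then have "\<eta> (\<phi> \<xi>) * (\<eta> (\<phi> \<xi>) * 1) = 0" by (simp add: eta_linear)
  then have "\<eta> (\<phi> \<xi>) = 0" by (simp add: fun_eq_iff)
  then show ?thesis using 1 by simp
qed

lemma eta_phi [simp]: assumes X: "X \<in> VF" shows "\<eta> (\<phi> X) = 0"
proof -
  have "\<phi> (\<phi> (\<phi> X)) = \<phi> X" using X by (subst phi_phi) (simp_all add: phi_linear)
  then have "\<eta> (\<phi> X) \<odot> \<xi> = 0" using phi_phi[of "\<phi> X"] X by simp
  then have "\<eta> (\<eta> (\<phi> X) \<odot> \<xi>) = 0" using form_zero[OF eta_form] by simp
  then show ?thesis using X by (simp add: eta_linear)
qed

lemma g_xi_left [simp]: assumes X: "X \<in> VF" shows "g \<xi> X = \<eta> X"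
  using g_phi_phi[of \<xi> X] X by (simp add: eq_neg_iff_add_eq_0)

lemma g_xi_right [simp]: "X \<in> VF \<Longrightarrow> g X \<xi> = \<eta> X"
  using g_commute[of X \<xi>] by simp

lemma phi_skew: assumes X: "X \<in> VF" and Y: "Y \<in> VF" shows "g (\<phi> X) Y = - g X (\<phi> Y)"
proof -
  have "g (\<phi> (\<phi> X)) (\<phi> Y) = - g (\<phi> X) Y" using g_phi_phi[of "\<phi> X" Y] X Y by simp
  moreover have "g (\<phi> (\<phi> X)) (\<phi> Y) = g X (\<phi> Y)" using X Y by (simp add: phi_phi g_linear)
  ultimately show ?thesis by simp
qed

section \<open>The operator N and its relation to \<phi> and h\<close>

abbreviation "N X \<equiv> D X \<xi>"

lemma N_endo: "endo_field C N"
  using D_endo[OF xi_VF] .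

lemma deriv_one: assumes X: "X \<in> VF" shows "X 1 = 0"
  using vf_mult[OF X one_C one_C] by simp

lemma eta_N [simp]: assumes X: "X \<in> VF" shows "\<eta> (N X) = 0"
proof -
  have "X 1 = \<eta> (N X) + \<eta> (N X)" using metric[OF X xi_VF xi_VF] X by simp
  then have "\<eta> (N X) + \<eta> (N X) = 0" using deriv_one[OF X] by simp
  then show ?thesis by (simp add: fun_eq_iff)
qed

lemma deriv_eta:
  assumes X: "X \<in> VF" and Y: "Y \<in> VF" shows "X (\<eta> Y) = g (N X) Y + \<eta> (D X Y)"
  using metric[OF X xi_VF Y] X Y by simp

lemma N_symmetric:
  assumes X: "X \<in> VF" and Y: "Y \<in> VF" shows "g (N X) Y = g (N Y) X"
  using eta_closed_form[OF X Y] X Y by (simp add: deriv_eta[OF X] deriv_eta[OF Y] torsion_free eta_linear algebra_simps)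

text \<open>g (N \<xi>) Z = g (N Z) \<xi> = \<eta>(N Z) = 0, so the trajectories of \<xi> are
  geodesics.\<close>

lemma N_xi [simp]: "N \<xi> = 0"
  by (rule nondegenerate) (simp_all add: N_symmetric[OF xi_VF])

text \<open>The formula for d\<Phi> with \<xi> in the first slot: values of \<Phi> involving \<xi>
  vanish, and torsion-freeness rewrites brackets with \<xi> through D \<xi> and N. Both sides later
  turn out to be zero, by \<open>N_phi\<close>.\<close>

lemma D_xi_phi:
  assumes Y: "Y \<in> VF"
  shows "D \<xi> (\<phi> Y) - \<phi> (D \<xi> Y) = cmul (2 * \<alpha>) (\<phi> Y) - \<phi> (N Y) - N (\<phi> Y)"
proof (rule nondegenerate)
  fix Z assume Z: "Z \<in> VF"
  have "\<xi> (g (\<phi> Y) Z) - g (\<phi> (bracket \<xi> Y)) Z - g (\<phi> (bracket Z \<xi>)) Y = (\<lambda>_. 2 * \<alpha>) * g (\<phi> Y) Z"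
    using d_fundamental[OF xi_VF Y Z] Y Z
    unfolding ext_deriv2_def wedge12_def fundamental_form_def
    by (simp add: vf_zero[OF Y] vf_zero[OF Z])
  moreover have "\<xi> (g (\<phi> Y) Z) = g (D \<xi> (\<phi> Y)) Z + g (\<phi> Y) (D \<xi> Z)"
    using Y Z by (simp add: metric[OF xi_VF])
  moreover have "g (\<phi> (bracket \<xi> Y)) Z = g (\<phi> (D \<xi> Y)) Z - g (\<phi> (N Y)) Z"
    using Y Z by (simp add: torsion_free phi_linear g_linear)
  moreover have "g (\<phi> (bracket Z \<xi>)) Y = - g (N (\<phi> Y)) Z + g (\<phi> Y) (D \<xi> Z)"
    using Y Z phi_skew[of "N Z" Y] N_symmetric[of Z "\<phi> Y"] phi_skew[of "D \<xi> Z" Y]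
    by (simp add: torsion_free phi_linear g_linear g_commute[of "\<phi> Y"])
  ultimately show "g (D \<xi> (\<phi> Y) - \<phi> (D \<xi> Y)) Z = g (cmul (2 * \<alpha>) (\<phi> Y) - \<phi> (N Y) - N (\<phi> Y)) Z"
    using Y Z by (simp add: g_linear cmul_def) (simp add: fun_eq_iff algebra_simps)
qed (use Y in simp_all)

text \<open>\<open>D_xi_phi\<close> is one equation from which two are to be extracted. Let K be the
  derivative of \<phi> along \<xi>. Differentiating \<phi> \<phi> = id - \<eta> \<xi> shows that K
  anticommutes with \<phi>, whereas the other side, 2 \<alpha> \<phi> - \<phi> N - N \<phi>,
  commutes with \<phi>. Hence its product with \<phi> is 0.\<close>

lemma N_phi_aux:
  assumes Y: "Y \<in> VF" shows "N Y + \<phi> (N (\<phi> Y)) = cmul (2 * \<alpha>) (\<phi> (\<phi> Y))"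
proof -
  define K where "K = (\<lambda>Y. D \<xi> (\<phi> Y) - \<phi> (D \<xi> Y))"
  have "K (\<phi> Y) + \<phi> (K Y) = D \<xi> (\<phi> (\<phi> Y)) - \<phi> (\<phi> (D \<xi> Y))"
    using Y by (simp add: K_def phi_linear)
  also have "\<dots> = (\<eta> (D \<xi> Y) - \<xi> (\<eta> Y)) \<odot> \<xi>"
    using Y by (simp add: phi_phi D_diff_right D_fmul_right) (simp add: fun_eq_iff algebra_simps)
  also have "\<dots> = 0" using Y by (simp add: deriv_eta[OF xi_VF])
  finally have 0: "K (\<phi> Y) + \<phi> (K Y) = 0" .
  have 1: "K (\<phi> Y) = cmul (2 * \<alpha>) (\<phi> (\<phi> Y)) - \<phi> (N (\<phi> Y)) - N (\<phi> (\<phi> Y))"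
    using D_xi_phi[of "\<phi> Y"] Y by (simp add: K_def)
  have 2: "\<phi> (K Y) = cmul (2 * \<alpha>) (\<phi> (\<phi> Y)) - \<phi> (\<phi> (N Y)) - \<phi> (N (\<phi> Y))"
    using D_xi_phi[OF Y] Y by (simp add: K_def phi_linear cmul_def)
  have 3: "N (\<phi> (\<phi> Y)) = N Y" "\<phi> (\<phi> (N Y)) = N Y"
    using Y by (simp_all add: phi_phi D_diff_left D_fmul_left)
  show ?thesis
  proof (intro ext)
    fix u q
    from 0 have "(K (\<phi> Y) + \<phi> (K Y)) u q = 0" by simp
    then show "(N Y + \<phi> (N (\<phi> Y))) u q = cmul (2 * \<alpha>) (\<phi> (\<phi> Y)) u q"
      unfolding 1 2 3 by simp
  qed
qed

lemma N_phi:
  assumes Y: "Y \<in> VF" shows "\<phi> (N Y) + N (\<phi> Y) = cmul (2 * \<alpha>) (\<phi> Y)"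
proof -
  have "\<phi> (N Y + \<phi> (N (\<phi> Y))) = \<phi> (cmul (2 * \<alpha>) (\<phi> (\<phi> Y)))" using N_phi_aux[OF Y] by simp
  then show ?thesis using Y by (simp add: phi_linear phi_phi cmul_def)
qed

lemma D_xi_phi_zero: assumes Y: "Y \<in> VF" shows "D \<xi> (\<phi> Y) = \<phi> (D \<xi> Y)"
  using D_xi_phi[OF Y] N_phi[OF Y] by (simp add: diff_diff_eq)

lemma h_eq:
  assumes X: "X \<in> VF" shows "h_operator \<phi> \<xi> X = cmul (1/2) (\<phi> (N X) - N (\<phi> X))"
  using X by (simp add: h_operator_def lie_deriv_endo_def torsion_free phi_linear D_xi_phi_zero)

end

text \<open>\<open>leaves_parallel\<close> is the parallelism of J read in the ambient manifold: as
  \<phi> is skew, it says that the derivative of \<phi> in a tangent direction, applied to a tangent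
  field, is orthogonal to the kernel of \<eta>.\<close>

locale para_Kenmotsu = almost_Kenmotsu C g D n \<alpha> \<phi> \<xi> \<eta>
  for C :: "('m \<Rightarrow> real) set" and g D n \<alpha> \<phi> \<xi> \<eta> +
  assumes leaves_parallel: "\<And>X Y Z. X \<in> vector_fields C \<Longrightarrow> Y \<in> vector_fields C \<Longrightarrow> Z \<in> vector_fields C \<Longrightarrow>
      \<eta> X = 0 \<Longrightarrow> \<eta> Y = 0 \<Longrightarrow> \<eta> Z = 0 \<Longrightarrow> g (D X (\<phi> Y)) Z + g (D X Y) (\<phi> Z) = 0"
begin

text \<open>The \<xi>-directions left open by \<open>leaves_parallel\<close> are filled in one by
  one: X = \<xi> by \<open>D_xi_phi_zero\<close>, Y = \<xi> by differentiating \<phi> \<xi> = 0, and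
  the \<xi>-component of the result by differentiating \<eta>(\<phi> Y) = 0.\<close>

lemma D_phi:
  assumes X: "X \<in> VF" and Y: "Y \<in> VF"
  shows "D X (\<phi> Y) = \<phi> (D X Y) + g (\<phi> (N X)) Y \<odot> \<xi> - \<eta> Y \<odot> \<phi> (N X)"
proof (rule nondegenerate)
  fix Z assume Z: "Z \<in> VF"
  \<comment> \<open>The projection produces fields annihilated by \<eta> everywhere, as the
    hypothesis demands; \<phi> does not change under it because \<phi> \<xi> = 0.\<close>
  let ?P = "\<lambda>X. X - \<eta> X \<odot> \<xi>"
  have P: "?P X \<in> VF" "\<eta> (?P X) = 0" "\<phi> (?P X) = \<phi> X" if "X \<in> VF" for X
    using that by (simp_all add: eta_linear phi_linear)
  have "g (D (?P X) (\<phi> Y)) (?P Z) + g (D (?P X) (?P Y)) (\<phi> Z) = 0"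
    using leaves_parallel[OF P(1)[OF X] P(1)[OF Y] P(1)[OF Z] P(2)[OF X] P(2)[OF Y] P(2)[OF Z]]
    by (simp only: P(3)[OF Y] P(3)[OF Z])
  moreover have "g (D (?P X) (\<phi> Y)) (?P Z) = g (D X (\<phi> Y)) Z - \<eta> X * g (D \<xi> (\<phi> Y)) Z
      - \<eta> Z * (\<eta> (D X (\<phi> Y)) - \<eta> X * \<eta> (D \<xi> (\<phi> Y)))"
    using X Y Z by (simp add: D_diff_left D_fmul_left g_linear eta_linear)
  moreover have "g (D (?P X) (?P Y)) (\<phi> Z) = g (D X Y) (\<phi> Z) - \<eta> X * g (D \<xi> Y) (\<phi> Z) - \<eta> Y * g (N X) (\<phi> Z)"
    using X Y Z by (simp add: D_diff_left D_fmul_left D_diff_right D_fmul_right g_linear)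
  moreover have "\<eta> (D U (\<phi> Y)) = - g (N U) (\<phi> Y)" if "U \<in> VF" for U
    using deriv_eta[OF that phi_closed[OF Y]] vf_zero[OF that] Y
    by (simp add: eq_neg_iff_add_eq_0 add.commute)
  moreover have "g (D \<xi> (\<phi> Y)) Z = - g (D \<xi> Y) (\<phi> Z)"
    using Y Z by (simp add: D_xi_phi_zero phi_skew)
  ultimately have 1: "g (D X (\<phi> Y)) Z + g (D X Y) (\<phi> Z) + \<eta> Z * g (N X) (\<phi> Y) - \<eta> Y * g (N X) (\<phi> Z) = 0"
    using X Y Z by (simp add: fun_eq_iff algebra_simps)
  show "g (D X (\<phi> Y)) Z = g (\<phi> (D X Y) + g (\<phi> (N X)) Y \<odot> \<xi> - \<eta> Y \<odot> \<phi> (N X)) Z"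
  proof
    fix q
    show "g (D X (\<phi> Y)) Z q = g (\<phi> (D X Y) + g (\<phi> (N X)) Y \<odot> \<xi> - \<eta> Y \<odot> \<phi> (N X)) Z q"
      using fun_cong[OF 1, of q] X Y Z phi_skew[of "D X Y" Z] phi_skew[of "N X" Y] phi_skew[of "N X" Z]
      by (simp add: g_linear algebra_simps)
  qed
qed (use X Y in simp_all)

text \<open>This combination of derivatives of \<phi> N appears when \<open>D_phi\<close> is
  differentiated and antisymmetrized. Applied to \<open>N Y\<close>, \<open>D_phi\<close> loses its
  last term because \<eta> vanishes on the range of N.\<close>

lemma R_xi_phi:
  assumes X: "X \<in> VF" and Y: "Y \<in> VF"
  shows "D X (\<phi> (N Y)) - D Y (\<phi> (N X)) - \<phi> (N (bracket X Y)) =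
    \<phi> (R X Y \<xi>) + (g (\<phi> (N X)) (N Y) - g (\<phi> (N Y)) (N X)) \<odot> \<xi>"
  using X Y by (simp add: D_phi curvature_def phi_linear) (simp add: fun_eq_iff algebra_simps)

lemma D_D_phi:
  assumes X: "X \<in> VF" and Y: "Y \<in> VF" and Z: "Z \<in> VF"
  shows "D X (D Y (\<phi> Z)) = \<phi> (D X (D Y Z)) + g (\<phi> (N X)) (D Y Z) \<odot> \<xi> - \<eta> (D Y Z) \<odot> \<phi> (N X)
    + (g (D X (\<phi> (N Y))) Z + g (\<phi> (N Y)) (D X Z)) \<odot> \<xi> + g (\<phi> (N Y)) Z \<odot> N X
    - (g (N X) Z + \<eta> (D X Z)) \<odot> \<phi> (N Y) - \<eta> Z \<odot> D X (\<phi> (N Y))"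
proof -
  have a: "D X (D Y (\<phi> Z)) = D X (\<phi> (D Y Z)) + D X (g (\<phi> (N Y)) Z \<odot> \<xi>) - D X (\<eta> Z \<odot> \<phi> (N Y))"
    unfolding D_phi[OF Y Z] using X Y Z by (simp add: D_add_right D_diff_right)
  have b: "D X (\<phi> (D Y Z)) = \<phi> (D X (D Y Z)) + g (\<phi> (N X)) (D Y Z) \<odot> \<xi> - \<eta> (D Y Z) \<odot> \<phi> (N X)"
    using X Y Z by (intro D_phi) simp_all
  have c: "D X (g (\<phi> (N Y)) Z \<odot> \<xi>) =
      (g (D X (\<phi> (N Y))) Z + g (\<phi> (N Y)) (D X Z)) \<odot> \<xi> + g (\<phi> (N Y)) Z \<odot> N X"
    using X Y Z by (subst D_fmul_right) (simp_all add: metric[OF X])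
  have d: "D X (\<eta> Z \<odot> \<phi> (N Y)) = (g (N X) Z + \<eta> (D X Z)) \<odot> \<phi> (N Y) + \<eta> Z \<odot> D X (\<phi> (N Y))"
    using X Y Z by (subst D_fmul_right) (simp_all add: deriv_eta[OF X])
  show ?thesis unfolding a b c d by (simp add: fun_eq_iff algebra_simps)
qed

text \<open>The Ricci identity for \<phi>. In the antisymmetrized \<open>D_D_phi\<close> the
  derivatives of \<phi> N enter only through c, once as g c Z along \<xi> and once as - \<eta>(Z) c;
  the scalar \<open>?k\<close> cancels between the two.\<close>

lemma R_phi:
  assumes X: "X \<in> VF" and Y: "Y \<in> VF" and Z: "Z \<in> VF"
  shows "R X Y (\<phi> Z) = \<phi> (R X Y Z) + g (\<phi> (R X Y \<xi>)) Z \<odot> \<xi> - \<eta> Z \<odot> \<phi> (R X Y \<xi>)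
    + g (\<phi> (N Y)) Z \<odot> N X - g (\<phi> (N X)) Z \<odot> N Y - g (N X) Z \<odot> \<phi> (N Y) + g (N Y) Z \<odot> \<phi> (N X)"
proof -
  let ?k = "g (\<phi> (N X)) (N Y) - g (\<phi> (N Y)) (N X)"
  define c where "c = D X (\<phi> (N Y)) - D Y (\<phi> (N X)) - \<phi> (N (bracket X Y))"
  have c: "c = \<phi> (R X Y \<xi>) + ?k \<odot> \<xi>" unfolding c_def by (rule R_xi_phi[OF X Y])
  have "g (\<phi> (R X Y \<xi>)) Z + ?k * \<eta> Z = g c Z"
    unfolding c using X Y Z by (simp add: g_linear)
  also have "\<dots> = g (D X (\<phi> (N Y))) Z - g (D Y (\<phi> (N X))) Z - g (\<phi> (N (bracket X Y))) Z"
    unfolding c_def using X Y Z by (simp add: g_linear)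
  \<comment> \<open>Solved for the term with the derivative along X, as is the vector equation that
    follows, so that unfolding both eliminates it.\<close>
  finally have 1: "g (D X (\<phi> (N Y))) Z = g (\<phi> (R X Y \<xi>)) Z + ?k * \<eta> Z
      + g (D Y (\<phi> (N X))) Z + g (\<phi> (N (bracket X Y))) Z"
    by (simp add: algebra_simps)
  have 2: "D X (\<phi> (N Y)) = \<phi> (R X Y \<xi>) + ?k \<odot> \<xi> + D Y (\<phi> (N X)) + \<phi> (N (bracket X Y))"
    using c unfolding c_def by (simp add: algebra_simps)
  have 3: "\<phi> (R X Y Z) = \<phi> (D X (D Y Z)) - \<phi> (D Y (D X Z)) - \<phi> (D (bracket X Y) Z)"
    using X Y Z by (simp add: curvature_def phi_linear)
  have 4: "R X Y (\<phi> Z) = D X (D Y (\<phi> Z)) - D Y (D X (\<phi> Z)) - D (bracket X Y) (\<phi> Z)"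
    by (simp add: curvature_def)
  have 5: "D (bracket X Y) (\<phi> Z) = \<phi> (D (bracket X Y) Z) + g (\<phi> (N (bracket X Y))) Z \<odot> \<xi> - \<eta> Z \<odot> \<phi> (N (bracket X Y))"
    using X Y Z by (intro D_phi) simp_all
  show ?thesis
    unfolding 3 4 5 D_D_phi[OF X Y Z] D_D_phi[OF Y X Z]
    unfolding 1 unfolding 2
    by (simp add: fun_eq_iff algebra_simps)
qed

end


section \<open>The Ricci commutator\<close>

context para_Kenmotsu
begin

lemma jacobi_symmetric:
  assumes Y: "Y \<in> VF" and Z: "Z \<in> VF"
  shows "g (jacobi_operator D \<xi> Y) Z = g (jacobi_operator D \<xi> Z) Y"
proof -
  have "g (R Y \<xi> \<xi>) Z = g (R \<xi> Z Y) \<xi>" using R_pair_symmetry[OF Y xi_VF xi_VF Z] .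
  also have "\<dots> = g (R Z \<xi> \<xi>) Y"
    using R_swap[OF xi_VF Z Y] R_skew[OF xi_VF Z Y xi_VF] R_swap[OF xi_VF Z xi_VF] Y Z
    by (simp add: g_uminus_left del: g_xi_right g_xi_left)
  finally show ?thesis by (simp add: jacobi_operator_def)
qed

section \<open>Contractions over a frame and the Ricci tensor\<close>

context
  fixes p E assumes E: "frame p E"
begin

text \<open>Contraction with the inverse metric at p. T keeps two arguments, although only the
  diagonal is summed, so that an operator can be moved from one slot to the other.\<close>

definition frame_tr :: "('m vfield \<Rightarrow> 'm vfield \<Rightarrow> 'm \<Rightarrow> real) \<Rightarrow> real" where
  "frame_tr T = (\<Sum>i<2*n+1. sgn_at i * T (E i) (E i) p)"

lemma frame_tr_cong:
  assumes "\<And>X. X \<in> VF \<Longrightarrow> T X X p = T' X X p"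
  shows "frame_tr T = frame_tr T'"
  unfolding frame_tr_def
proof (rule sum.cong[OF refl])
  fix i assume "i \<in> {..<2*n+1}"
  then have "E i \<in> VF" by (simp add: frame_VF[OF E])
  then show "sgn_at i * T (E i) (E i) p = sgn_at i * T' (E i) (E i) p" using assms by simp
qed

lemma frame_tr_add: "frame_tr (\<lambda>X Y. T X Y + T' X Y) = frame_tr T + frame_tr T'"
  by (simp only: frame_tr_def plus_fun_apply distrib_left sum.distrib)

lemma frame_tr_uminus: "frame_tr (\<lambda>X Y. - T X Y) = - frame_tr T"
  by (simp only: frame_tr_def uminus_apply mult_minus_right sum_negf)

lemma frame_tr_diff: "frame_tr (\<lambda>X Y. T X Y - T' X Y) = frame_tr T - frame_tr T'"
  by (simp only: frame_tr_def minus_apply right_diff_distrib sum_subtractf)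

lemma frame_tr_scale: "frame_tr (\<lambda>X Y. f * T X Y) = f p * frame_tr T"
  by (simp only: frame_tr_def times_fun_apply sum_distrib_left mult.left_commute)

lemma frame_tr_form:
  assumes \<omega>: "one_form C \<omega>" and X: "X \<in> VF"
  shows "frame_tr (\<lambda>U V. g X V * \<omega> U) = \<omega> X p"
  unfolding frame_form[OF E \<omega> X] by (simp only: frame_tr_def times_fun_apply mult.assoc)

lemma frame_tr_metric: "frame_tr g = 2 * real n + 1"
proof -
  have "frame_tr g = (\<Sum>i<2*n+1. 1)"
    unfolding frame_tr_def
    by (rule sum.cong[OF refl]) (simp add: frame_orthonormal[OF E])
  then show ?thesis by simp
qed

lemma frame_tr_transpose:
  assumes "endo_field C F" "endo_field C G"
    and "\<And>X Y. X \<in> VF \<Longrightarrow> Y \<in> VF \<Longrightarrow> g (F X) Y = g X (G Y)"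
    and "\<And>Y. Y \<in> VF \<Longrightarrow> one_form C (\<lambda>X. T X Y)" and "\<And>X. X \<in> VF \<Longrightarrow> one_form C (T X)"
  shows "frame_tr (\<lambda>U V. T (F U) V) = frame_tr (\<lambda>U V. T U (G V))"
  unfolding frame_tr_def by (rule frame_sum_transpose[OF E assms])

lemma bilinear_form_g_left:
  assumes F: "endo_field C F" and Y: "Y \<in> VF"
  shows "one_form C (\<lambda>X. g (F X) Y)"
  unfolding one_form_def using Y
  by (auto simp: endo_closed[OF F] endo_add[OF F] endo_fmul[OF F] g_linear)

lemma endo_compose: "endo_field C F \<Longrightarrow> endo_field C G \<Longrightarrow> endo_field C (\<lambda>X. F (G X))"
  unfolding endo_field_def by auto

lemma endo_minus_phi: "endo_field C (\<lambda>X. cmul (-1) (\<phi> X))"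
  unfolding endo_field_def by (auto simp: phi_linear) (auto simp: fun_eq_iff)

lemma form_g_compose:
  assumes F: "endo_field C F" and X: "X \<in> VF"
  shows "one_form C (\<lambda>Y. g X (F Y))"
  unfolding one_form_def using X
  by (auto simp: endo_closed[OF F] endo_add[OF F] endo_fmul[OF F] g_linear)

text \<open>N is self-adjoint and \<phi> is skew, so the trace equals its own negative.\<close>

lemma frame_tr_phi_N: "frame_tr (\<lambda>X Y. g (\<phi> (N X)) Y) = 0"
proof -
  have "frame_tr (\<lambda>X Y. g (\<phi> (N X)) Y) = frame_tr (\<lambda>X Y. g (\<phi> X) (N Y))"
    by (rule frame_tr_transpose[OF N_endo N_endo, where T = "\<lambda>X Y. g (\<phi> X) Y"])
      (simp_all add: N_symmetric g_commute[of _ "N _"] bilinear_form_g_left[OF phi_endo] g_form)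
  also have "\<dots> = frame_tr (\<lambda>X Y. - g (\<phi> (N X)) Y)"
    by (rule frame_tr_cong) (metis D_closed g_commute phi_closed phi_skew uminus_apply xi_VF)
  finally show ?thesis unfolding frame_tr_uminus by simp
qed

text \<open>The trace of \<open>N_phi_aux\<close>. On the left, \<phi> N \<phi> has the same trace
  as N, since \<eta> vanishes on the range of N; on the right, \<phi> \<phi> has trace (2 n + 1) -
  1. This gives twice the claim.\<close>

lemma frame_tr_N: "frame_tr (\<lambda>X Y. g (N X) Y) = 2 * real n * \<alpha>"
proof -
  have "frame_tr (\<lambda>X Y. g (N (\<phi> X)) (\<phi> Y)) = frame_tr (\<lambda>X Y. g (N X) (\<phi> (cmul (-1) (\<phi> Y))))"
    by (rule frame_tr_transpose[OF phi_endo endo_minus_phi, where T = "\<lambda>X Y. g (N X) (\<phi> Y)"])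
      (auto simp: phi_skew g_linear cmul_def fun_eq_iff intro!: bilinear_form_g_left[OF N_endo] form_g_compose[OF phi_endo])
  also have "\<dots> = frame_tr (\<lambda>X Y. - g (N X) Y)"
    by (rule frame_tr_cong) (simp add: cmul_def phi_linear phi_phi g_linear)
  finally have 1: "frame_tr (\<lambda>X Y. g (N (\<phi> X)) (\<phi> Y)) = - frame_tr (\<lambda>X Y. g (N X) Y)"
    unfolding frame_tr_uminus .
  have 2: "frame_tr (\<lambda>X Y. \<eta> Y * \<eta> X) = 1"
  proof -
    have "frame_tr (\<lambda>X Y. \<eta> Y * \<eta> X) = frame_tr (\<lambda>X Y. g \<xi> Y * \<eta> X)"
      by (rule frame_tr_cong) simp
    then show ?thesis unfolding frame_tr_form[OF eta_form xi_VF] by simp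
  qed
  have "frame_tr (\<lambda>X Y. g (N X) Y - g (N (\<phi> X)) (\<phi> Y)) = frame_tr (\<lambda>X Y. (\<lambda>_. 2 * \<alpha>) * (g X Y - \<eta> Y * \<eta> X))"
  proof (rule frame_tr_cong)
    fix X assume X: "X \<in> VF"
    have "g (N X + \<phi> (N (\<phi> X))) X p = g (cmul (2 * \<alpha>) (\<phi> (\<phi> X))) X p"
      using N_phi_aux[OF X] by simp
    then show "(g (N X) X - g (N (\<phi> X)) (\<phi> X)) p = ((\<lambda>_. 2 * \<alpha>) * (g X X - \<eta> X * \<eta> X)) p"
      using X by (simp add: g_linear phi_phi cmul_def phi_skew)
  qed
  then show ?thesis
    unfolding frame_tr_diff frame_tr_scale 1 2 frame_tr_metric by simp
qed

definition ricci_star :: "'m vfield \<Rightarrow> 'm vfield \<Rightarrow> real" where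
  "ricci_star Y Z = frame_tr (\<lambda>U V. g (\<phi> (R U Y Z)) V)"

lemma ricci_frame:
  assumes Y: "Y \<in> VF" and Z: "Z \<in> VF"
  shows "ricci_tensor C D Y Z p = frame_tr (\<lambda>U V. g (R U Y Z) V)"
  unfolding ricci_tensor_def frame_tr_def by (rule frame_trace[OF E R_endo[OF Y Z]])

lemma ricci_symmetric:
  assumes Y: "Y \<in> VF" and Z: "Z \<in> VF"
  shows "ricci_tensor C D Y Z p = ricci_tensor C D Z Y p"
  unfolding ricci_frame[OF Y Z] ricci_frame[OF Z Y]
proof (rule frame_tr_cong)
  fix X assume X: "X \<in> VF"
  have "g (R X Y Z) X = g (R Z X X) Y" by (rule R_pair_symmetry[OF X Y Z X])
  also have "\<dots> = g (- R X Z X) Y" using X Y Z by (simp add: R_swap[of X Z X])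
  also have "\<dots> = g (R X Z Y) X" using X Y Z R_skew[OF X Z X Y] by (simp add: g_linear)
  finally show "g (R X Y Z) X p = g (R X Z Y) X p" by simp
qed

lemma ricci_star_skew:
  assumes Y: "Y \<in> VF" and Z: "Z \<in> VF"
  shows "ricci_star Z Y = - ricci_star Y Z"
proof -
  have "ricci_star Z Y = frame_tr (\<lambda>U V. - g (R (\<phi> U) Y Z) V)"
    unfolding ricci_star_def
  proof (rule frame_tr_cong)
    fix X assume X: "X \<in> VF"
    have "g (\<phi> (R X Z Y)) X = - g (R X Z Y) (\<phi> X)" using X Y Z by (simp add: phi_skew)
    also have "\<dots> = - g (R Y (\<phi> X) X) Z" using R_pair_symmetry[OF X Z Y phi_closed[OF X]] by simp
    also have "\<dots> = g (R Y (\<phi> X) Z) X" using X Y Z R_skew[of Y "\<phi> X" X Z] by simp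
    also have "\<dots> = - g (R (\<phi> X) Y Z) X"
      using X Y Z R_swap[of "\<phi> X" Y Z] by (simp add: g_linear)
    finally show "g (\<phi> (R X Z Y)) X p = (- g (R (\<phi> X) Y Z) X) p" by simp
  qed
  also have "\<dots> = - frame_tr (\<lambda>U V. g (R (\<phi> U) Y Z) V)" by (rule frame_tr_uminus)
  \<comment> \<open>Pair symmetry has carried \<phi> into the first argument of the curvature; under
    the trace it returns to the outside with a sign.\<close>
  also have "frame_tr (\<lambda>U V. g (R (\<phi> U) Y Z) V) = frame_tr (\<lambda>U V. g (R U Y Z) (cmul (-1) (\<phi> V)))"
    by (rule frame_tr_transpose[OF phi_endo endo_minus_phi, where T = "\<lambda>U V. g (R U Y Z) V"])
      (use Y Z in \<open>auto simp: phi_skew g_linear cmul_def fun_eq_iff intro!: bilinear_form_g_left[OF R_endo] g_form\<close>)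
  also have "\<dots> = ricci_star Y Z"
    unfolding ricci_star_def
    by (rule frame_tr_cong) (use Y Z in \<open>simp add: phi_skew cmul_def g_fmul_right\<close>)
  finally show ?thesis .
qed

lemma ricci_phi:
  assumes Y: "Y \<in> VF" and Z: "Z \<in> VF"
  shows "ricci_tensor C D Y (\<phi> Z) p = ricci_star Y Z - g (\<phi> (jacobi_operator D \<xi> Y)) Z p
    - \<eta> Z p * ricci_star Y \<xi> + 2 * \<alpha> * (real n - 1) * g (\<phi> (N Y)) Z p"
proof -
  \<comment> \<open>Obtained from \<open>R_phi\<close>. A summand with a factor \<open>g W V\<close>
    for a fixed field W is evaluated at W by \<open>frame_tr_form\<close>, with W equal to \<xi>,
    \<open>N Y\<close> or \<open>\<phi> (N Y)\<close>. The others are \<open>ricci_star\<close> and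
    multiples of the traces of N and of \<phi> N.\<close>
  let ?T = "\<lambda>U V. g (\<phi> (R U Y Z)) V + g \<xi> V * g (\<phi> (R U Y \<xi>)) Z - \<eta> Z * g (\<phi> (R U Y \<xi>)) V
      + g (\<phi> (N Y)) Z * g (N U) V - g (N Y) V * g (\<phi> (N U)) Z
      - g (\<phi> (N Y)) V * g (N U) Z + g (N Y) Z * g (\<phi> (N U)) V"
  have 1: "ricci_tensor C D Y (\<phi> Z) p = frame_tr ?T"
    unfolding ricci_frame[OF Y phi_closed[OF Z]]
  proof (rule frame_tr_cong[of "\<lambda>U. g (R U Y (\<phi> Z))" ?T])
    fix X assume X: "X \<in> VF"
    show "g (R X Y (\<phi> Z)) X p = (g (\<phi> (R X Y Z)) X + g \<xi> X * g (\<phi> (R X Y \<xi>)) Z - \<eta> Z * g (\<phi> (R X Y \<xi>)) X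
      + g (\<phi> (N Y)) Z * g (N X) X - g (N Y) X * g (\<phi> (N X)) Z
      - g (\<phi> (N Y)) X * g (N X) Z + g (N Y) Z * g (\<phi> (N X)) X) p"
      unfolding R_phi[OF X Y Z] using X Y Z by (simp add: g_linear)
  qed
  have 2: "frame_tr ?T = ricci_star Y Z + g (\<phi> (R \<xi> Y \<xi>)) Z p - \<eta> Z p * ricci_star Y \<xi>
      + g (\<phi> (N Y)) Z p * (2 * real n * \<alpha>) - g (\<phi> (N (N Y))) Z p - g (N (\<phi> (N Y))) Z p"
    unfolding frame_tr_add frame_tr_diff frame_tr_scale frame_tr_N frame_tr_phi_N ricci_star_def
      frame_tr_form[OF bilinear_form_g_left[OF endo_compose[OF phi_endo R_endo[OF Y xi_VF]] Z] xi_VF]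
      frame_tr_form[OF bilinear_form_g_left[OF endo_compose[OF phi_endo N_endo] Z] D_closed[OF Y xi_VF]]
      frame_tr_form[OF bilinear_form_g_left[OF N_endo Z] phi_closed[OF D_closed[OF Y xi_VF]]]
    by simp
  have 3: "g (\<phi> (R \<xi> Y \<xi>)) Z = - g (\<phi> (jacobi_operator D \<xi> Y)) Z"
    using Y Z R_swap[of Y \<xi> \<xi>] by (simp add: jacobi_operator_def endo_uminus[OF phi_endo] g_uminus_left)
  have 4: "g (\<phi> (N (N Y))) Z p = 2 * \<alpha> * g (\<phi> (N Y)) Z p - g (N (\<phi> (N Y))) Z p"
  proof -
    have "g (\<phi> (N (N Y)) + N (\<phi> (N Y))) Z p = g (cmul (2 * \<alpha>) (\<phi> (N Y))) Z p"
      using N_phi[of "N Y"] Y by simp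
    then show ?thesis using Y Z by (simp add: g_linear cmul_def)
  qed
  show ?thesis unfolding 1 2 3 4 by (simp add: algebra_simps)
qed

text \<open>In \<open>ricci_phi\<close> with Y = \<xi> the Jacobi term and the N term vanish, and
  \<open>ricci_star \<xi> \<xi>\<close> is 0 by skewness. The same skewness then exchanges the
  arguments.\<close>

lemma ricci_star_xi:
  assumes Y: "Y \<in> VF" shows "ricci_star Y \<xi> = - ricci_tensor C D \<xi> (\<phi> Y) p"
proof -
  have "ricci_star \<xi> \<xi> = 0" using ricci_star_skew[OF xi_VF xi_VF] by simp
  moreover have "R \<xi> \<xi> \<xi> = 0"
  proof -
    have "R \<xi> \<xi> \<xi> = - R \<xi> \<xi> \<xi>" by (rule R_swap) simp_all
    then show ?thesis by (simp add: fun_eq_iff)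
  qed
  ultimately have "ricci_tensor C D \<xi> (\<phi> Y) p = ricci_star \<xi> Y"
    using ricci_phi[OF xi_VF Y] Y endo_zero[OF phi_endo] by (simp add: jacobi_operator_def)
  then show ?thesis using ricci_star_skew[OF Y xi_VF] by simp
qed

end

theorem ricci_phi_commutator:
  assumes Q: "is_ricci_operator C g D Q" and X: "X \<in> VF"
  shows "Q (\<phi> X) - \<phi> (Q X) =
    jacobi_operator D \<xi> (\<phi> X) - \<phi> (jacobi_operator D \<xi> X)
      - cmul (4 * \<alpha> * (1 - real n)) (h_operator \<phi> \<xi> X)
      - \<eta> X \<odot> \<phi> (Q \<xi>) + \<eta> (Q (\<phi> X)) \<odot> \<xi>" (is "?L = ?R")
proof (rule nondegenerate)
  have Q_VF [simp]: "Q Y \<in> VF" if "Y \<in> VF" for Y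
    using Q that endo_closed unfolding is_ricci_operator_def by blast
  have S: "g (Q Y) Z = ricci_tensor C D Y Z" if "Y \<in> VF" "Z \<in> VF" for Y Z
    using Q that unfolding is_ricci_operator_def by blast
  have l_VF [simp]: "jacobi_operator D \<xi> Y \<in> VF" if "Y \<in> VF" for Y
    using that by (simp add: jacobi_operator_def)
  have h: "h_operator \<phi> \<xi> X = cmul (1/2) (\<phi> (N X) - N (\<phi> X))" by (rule h_eq[OF X])
  show "?L \<in> VF" using X by simp
  show "?R \<in> VF" using X unfolding h by simp
  fix Z assume Z: "Z \<in> VF"
  show "g ?L Z = g ?R Z"
  proof
    fix p
    obtain E where E: "frame p E" using frame_exists by blast
    have sym: "ricci_tensor C D Y Z p = ricci_tensor C D Z Y p" if "Y \<in> VF" "Z \<in> VF" for Y Z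
      by (rule ricci_symmetric[OF E that])
    \<comment> \<open>Because \<phi> is skew, pairing the commutator with Z is a symmetrization in X
      and Z. \<open>ricci_phi\<close> is used once in each order, and \<open>ricci_star X Z\<close>
      drops out.\<close>
    have "g ?L Z p = g (Q (\<phi> X)) Z p + g (Q X) (\<phi> Z) p"
      using X Z by (simp add: g_linear phi_skew)
    also have "\<dots> = ricci_tensor C D Z (\<phi> X) p + ricci_tensor C D X (\<phi> Z) p"
      using X Z sym[of "\<phi> X" Z] by (simp add: S)
    finally have 1: "g ?L Z p = ricci_tensor C D Z (\<phi> X) p + ricci_tensor C D X (\<phi> Z) p" .
    have 2: "ricci_tensor C D Z (\<phi> X) p + ricci_tensor C D X (\<phi> Z) p = - g (\<phi> (jacobi_operator D \<xi> Z)) X p - g (\<phi> (jacobi_operator D \<xi> X)) Z p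
        + \<eta> X p * ricci_tensor C D \<xi> (\<phi> Z) p + \<eta> Z p * ricci_tensor C D \<xi> (\<phi> X) p
        + 2 * \<alpha> * (real n - 1) * (g (\<phi> (N X)) Z p + g (\<phi> (N Z)) X p)"
      unfolding ricci_phi[OF E Z X] ricci_phi[OF E X Z] ricci_star_xi[OF E X] ricci_star_xi[OF E Z]
        ricci_star_skew[OF E X Z]
      by (simp add: algebra_simps)
    \<comment> \<open>Where Z stands under l or N the operator is transposed: both are self-adjoint,
      so \<phi> l and \<phi> N turn into - l \<phi> and - N \<phi>.\<close>
    have 3: "g (\<phi> (jacobi_operator D \<xi> Z)) X = - g (jacobi_operator D \<xi> (\<phi> X)) Z"
      using X Z jacobi_symmetric[of Z "\<phi> X"] by (simp add: phi_skew)
    have 4: "g (\<phi> (N Z)) X = - g (N (\<phi> X)) Z"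
      using X Z N_symmetric[of Z "\<phi> X"] by (simp add: phi_skew)
    have 5: "ricci_tensor C D \<xi> (\<phi> Z) = - g (\<phi> (Q \<xi>)) Z"
      using Z by (simp add: S[symmetric] phi_skew)
    have 6: "ricci_tensor C D \<xi> (\<phi> X) p = \<eta> (Q (\<phi> X)) p"
      using X sym[of \<xi> "\<phi> X"] S[of "\<phi> X" \<xi>] by simp
    show "g ?L Z p = g ?R Z p"
      unfolding 1 2 3 4 5 6 h using X Z by (simp add: g_linear cmul_def algebra_simps)
  qed
qed

end


section \<open>Coordinates on a manifold\<close>

locale manifold =
  fixes A :: "('m::t2_space, 'e::euclidean_space) chart set"
  assumes atlas: "smooth_atlas A"
begin

abbreviation "C \<equiv> smooth_functions A"

abbreviation in_chart :: "'m set \<Rightarrow> ('m \<Rightarrow> 'e) \<Rightarrow> ('m \<Rightarrow> real) \<Rightarrow> 'e \<Rightarrow> real" where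
  "in_chart U \<kappa> F \<equiv> \<lambda>y. F (inv_into U \<kappa> y)"

lemma atlas_charts: "c \<in> A \<Longrightarrow> c \<in> smooth_charts A"
  using atlas unfolding smooth_atlas_def smooth_charts_def by blast

lemma atlas_cover: obtains U \<kappa> where "(U, \<kappa>) \<in> A" "p \<in> U"
proof -
  have "p \<in> (\<Union>c\<in>A. fst c)" using atlas unfolding smooth_atlas_def by simp
  then show ?thesis using that by fastforce
qed

lemma chart_is_chart: "c \<in> smooth_charts A \<Longrightarrow> is_chart c"
  by (simp add: smooth_charts_def)

lemma chart_transitions:
  assumes "(U, \<kappa>) \<in> smooth_charts A" "(V, \<mu>) \<in> A"
  shows "smooth_on (\<lambda>y. \<mu> (inv_into U \<kappa> y)) (\<kappa> ` (U \<inter> V))"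
    and "smooth_on (\<lambda>y. \<kappa> (inv_into V \<mu> y)) (\<mu> ` (V \<inter> U))"
  using assms by (auto simp: smooth_charts_def smooth_transition_def o_def)

context
  fixes U and \<kappa> :: "'m \<Rightarrow> 'e"
  assumes chart: "(U, \<kappa>) \<in> smooth_charts A"
begin

lemma chart_open: "open U" and chart_image_open: "open (\<kappa> ` U)"
  and chart_homeo: "homeomorphism U (\<kappa> ` U) \<kappa> (inv_into U \<kappa>)"
  using chart_is_chart[OF chart] by (auto simp: is_chart_def)

lemma chart_cont: "continuous_on U \<kappa>"
  and chart_inv_cont: "continuous_on (\<kappa> ` U) (inv_into U \<kappa>)"
  and chart_inv [simp]: "x \<in> U \<Longrightarrow> inv_into U \<kappa> (\<kappa> x) = x"
  using chart_homeo by (auto simp: homeomorphism_def)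

lemma chart_inv2: "y \<in> \<kappa> ` U \<Longrightarrow> inv_into U \<kappa> y \<in> U" "y \<in> \<kappa> ` U \<Longrightarrow> \<kappa> (inv_into U \<kappa> y) = y"
  by auto

lemma chart_preimage_open:
  assumes "open S" shows "open {x \<in> U. \<kappa> x \<in> S}"
proof -
  have "open (U \<inter> \<kappa> -` S)"
    by (rule continuous_open_preimage[OF chart_cont chart_open assms])
  moreover have "U \<inter> \<kappa> -` S = {x \<in> U. \<kappa> x \<in> S}" by auto
  ultimately show ?thesis by simp
qed

lemma chart_image_open_subset:
  assumes "open W" shows "open (\<kappa> ` (U \<inter> W))"
proof -
  have "open (\<kappa> ` U \<inter> inv_into U \<kappa> -` W)"
    by (rule continuous_open_preimage[OF chart_inv_cont chart_image_open assms])
  moreover have "\<kappa> ` U \<inter> inv_into U \<kappa> -` W = \<kappa> ` (U \<inter> W)" by auto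
  ultimately show ?thesis by simp
qed

lemma chart_ball:
  assumes "open W" "p \<in> U" "p \<in> W"
  obtains r where "r > 0" "\<And>y. y \<in> cball (\<kappa> p) r \<Longrightarrow> y \<in> \<kappa> ` U \<and> inv_into U \<kappa> y \<in> W"
proof -
  have "\<kappa> p \<in> \<kappa> ` (U \<inter> W)" using assms by blast
  then obtain r where "r > 0" "cball (\<kappa> p) r \<subseteq> \<kappa> ` (U \<inter> W)"
    using chart_image_open_subset[OF assms(1)] open_contains_cball by blast
  then show ?thesis using that by fastforce
qed

end

text \<open>Smoothness is tested on the given atlas only; the adapted charts constructed below
  belong to the maximal atlas.\<close>

lemma smooth_function_chart:
  assumes chart: "(U, \<kappa>) \<in> smooth_charts A" and F: "F \<in> C"
  shows "smooth_on (in_chart U \<kappa> F) (\<kappa> ` U)"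
proof (rule smooth_on_locally)
  fix y assume y: "y \<in> \<kappa> ` U"
  obtain V \<mu> where V: "(V, \<mu>) \<in> A" "inv_into U \<kappa> y \<in> V" by (rule atlas_cover)
  note V' = atlas_charts[OF V(1)]
  have "smooth_on (\<lambda>z. F (inv_into V \<mu> z)) (\<mu> ` V)"
    using F V(1) by (auto simp: smooth_functions_def o_def)
  from smooth_on_compose[OF chart_image_open_subset[OF chart chart_open[OF V']]
      chart_image_open[OF V'] _ chart_transitions(1)[OF chart V(1)] this]
  have "smooth_on (\<lambda>y. F (inv_into V \<mu> (\<mu> (inv_into U \<kappa> y)))) (\<kappa> ` (U \<inter> V))"
    using chart_inv[OF chart] by fastforce
  moreover have "F (inv_into V \<mu> (\<mu> (inv_into U \<kappa> z))) = F (inv_into U \<kappa> z)" if "z \<in> \<kappa> ` (U \<inter> V)" for z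
    using that chart_inv[OF chart] chart_inv[OF V'] by auto
  ultimately have "smooth_on (in_chart U \<kappa> F) (\<kappa> ` (U \<inter> V))"
    using smooth_on_cong[OF chart_image_open_subset[OF chart chart_open[OF V']]] by (metis (mono_tags, lifting))
  moreover have "y \<in> \<kappa> ` (U \<inter> V)" using y V(2) chart_inv2[OF chart y] by (metis IntI imageI)
  ultimately show "\<exists>T. open T \<and> y \<in> T \<and> smooth_on (in_chart U \<kappa> F) T"
    using chart_image_open_subset[OF chart chart_open[OF V']] by blast
qed

lemma smooth_functionI:
  assumes "\<And>U \<kappa>. (U, \<kappa>) \<in> A \<Longrightarrow> smooth_on (in_chart U \<kappa> F) (\<kappa> ` U)"
  shows "F \<in> C"
  using assms by (auto simp: smooth_functions_def o_def)

lemma const_smooth: "(\<lambda>_. c) \<in> C"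
  by (rule smooth_functionI) (rule smooth_on_const)

sublocale fun_algebra C
proof
  show "0 \<in> C" using const_smooth[of 0] by (simp add: zero_fun_def)
next
  fix f g assume fg: "f \<in> C" "g \<in> C"
  show "f + g \<in> C"
    by (rule smooth_functionI) (simp, intro smooth_on_add chart_image_open smooth_function_chart atlas_charts fg)
  show "f * g \<in> C"
    by (rule smooth_functionI) (simp, intro smooth_on_mult chart_image_open smooth_function_chart atlas_charts fg)
next
  fix f and c :: real assume f: "f \<in> C"
  show "(\<lambda>_. c) * f \<in> C"
    by (rule smooth_functionI) (simp, intro smooth_on_mult chart_image_open smooth_on_const smooth_function_chart atlas_charts f)
qed

lemma sum_smooth: "(\<And>i. i \<in> I \<Longrightarrow> f i \<in> C) \<Longrightarrow> sum f I \<in> C"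
  by (induction I rule: infinite_finite_induct) auto

section \<open>Extension of local functions by cutting off\<close>

definition bump_extension :: "'m set \<Rightarrow> ('m \<Rightarrow> 'e) \<Rightarrow> ('e \<Rightarrow> real) \<Rightarrow> ('e \<Rightarrow> real) \<Rightarrow> 'm \<Rightarrow> real" where
  "bump_extension U \<kappa> \<psi> f x = (if x \<in> U then \<psi> (\<kappa> x) * f (\<kappa> x) else 0)"

text \<open>Two kinds of points cover everything: those of the chart with coordinates in S, where
  the function is a smooth product, and those off the preimage of K, where it is 0. That preimage is
  compact, hence closed in a Hausdorff space.\<close>

lemma bump_extension_smooth:
  assumes chart: "(U, \<kappa>) \<in> smooth_charts A"
    and \<psi>: "smooth_on \<psi> UNIV" "\<And>y. y \<notin> K \<Longrightarrow> \<psi> y = 0" and K: "compact K" "K \<subseteq> S" "S \<subseteq> \<kappa> ` U"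
    and f: "open S" "smooth_on f S"
  shows "bump_extension U \<kappa> \<psi> f \<in> C"
proof (rule smooth_functionI)
  fix V \<mu> assume V: "(V, \<mu>) \<in> A"
  note V' = atlas_charts[OF V]
  let ?j = "inv_into V \<mu>"
  show "smooth_on (\<lambda>y. bump_extension U \<kappa> \<psi> f (?j y)) (\<mu> ` V)"
  proof (rule smooth_on_locally)
    fix y assume y: "y \<in> \<mu> ` V"
    show "\<exists>T. open T \<and> y \<in> T \<and> smooth_on (\<lambda>y. bump_extension U \<kappa> \<psi> f (?j y)) T"
    proof (cases "?j y \<in> U \<and> \<kappa> (?j y) \<in> S")
      case True
      let ?W = "{x \<in> U. \<kappa> x \<in> S}"
      let ?T = "\<mu> ` (V \<inter> ?W)"
      have T: "open ?T" by (intro chart_image_open_subset[OF V'] chart_preimage_open[OF chart] f)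
      have "y \<in> ?T" using True y chart_inv2[OF V' y] by (metis (mono_tags, lifting) IntI image_eqI mem_Collect_eq)
      have "smooth_on (\<lambda>y. \<psi> y * f y) S"
        by (intro smooth_on_mult f smooth_on_subset[OF \<psi>(1)]) simp
      moreover have "smooth_on (\<lambda>y. \<kappa> (?j y)) ?T"
        by (rule smooth_on_subset[OF chart_transitions(2)[OF chart V]]) auto
      moreover have "(\<lambda>y. \<kappa> (?j y)) ` ?T \<subseteq> S" using chart_inv[OF V'] by auto
      ultimately have "smooth_on (\<lambda>y. \<psi> (\<kappa> (?j y)) * f (\<kappa> (?j y))) ?T"
        using smooth_on_compose[OF T f(1)] by blast
      moreover have "\<psi> (\<kappa> (?j z)) * f (\<kappa> (?j z)) = bump_extension U \<kappa> \<psi> f (?j z)" if "z \<in> ?T" for z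
        using that chart_inv[OF V'] by (auto simp: bump_extension_def)
      ultimately have "smooth_on (\<lambda>y. bump_extension U \<kappa> \<psi> f (?j y)) ?T"
        using smooth_on_cong[OF T] by (metis (mono_tags, lifting))
      then show ?thesis using T \<open>y \<in> ?T\<close> by blast
    next
      case False
      let ?K = "inv_into U \<kappa> ` K"
      have "K \<subseteq> \<kappa> ` U" using K by blast
      then have "compact ?K"
        using continuous_on_subset[OF chart_inv_cont[OF chart]] compact_continuous_image K(1) by blast
      then have "open (- ?K)" using compact_imp_closed by blast
      then have T: "open (\<mu> ` (V \<inter> - ?K))" by (rule chart_image_open_subset[OF V'])
      have "?j y \<notin> ?K"
      proof
        assume "?j y \<in> ?K"
        then obtain k where k: "k \<in> K" "?j y = inv_into U \<kappa> k" by blast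
        then have "k \<in> \<kappa> ` U" "k \<in> S" using K by blast+
        then show False using chart_inv2[OF chart] k(2) False by metis
      qed
      then have "y \<in> \<mu> ` (V \<inter> - ?K)"
        using chart_inv2[OF V' y] by (metis ComplI IntI image_eqI)
      moreover have "bump_extension U \<kappa> \<psi> f (?j z) = 0" if z: "z \<in> \<mu> ` (V \<inter> - ?K)" for z
      proof (cases "?j z \<in> U")
        case True
        have "?j z \<notin> ?K" using z chart_inv[OF V'] by auto
        then have "\<kappa> (?j z) \<notin> K" using True chart_inv[OF chart] by (metis image_eqI)
        then show ?thesis using \<psi>(2) by (simp add: bump_extension_def)
      qed (simp add: bump_extension_def)
      then have "smooth_on (\<lambda>y. bump_extension U \<kappa> \<psi> f (?j y)) (\<mu> ` (V \<inter> - ?K))"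
        using smooth_on_cong[OF T, of "\<lambda>y. bump_extension U \<kappa> \<psi> f (?j y)" "\<lambda>_. 0"] smooth_on_const by blast
      ultimately show ?thesis using T by blast
    qed
  qed
qed

text \<open>Realizes the germ at p by a global function. The clauses on vanishing make
  \<open>bump_function\<close> the special case of the constant 1.\<close>

lemma smooth_extension:
  assumes chart: "(U, \<kappa>) \<in> smooth_charts A" and p: "p \<in> U"
    and S: "open S" "\<kappa> p \<in> S" "S \<subseteq> \<kappa> ` U" and f: "smooth_on f S"
  obtains F W where "F \<in> C" "open W" "p \<in> W" "W \<subseteq> U" "\<And>x. x \<in> W \<Longrightarrow> \<kappa> x \<in> S \<and> F x = f (\<kappa> x)"
    "\<And>x. x \<in> U \<Longrightarrow> \<kappa> x \<notin> S \<Longrightarrow> F x = 0" "\<And>x. x \<notin> U \<Longrightarrow> F x = 0"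
proof -
  obtain r where r: "r > 0" "cball (\<kappa> p) r \<subseteq> S" using S open_contains_cball by blast
  obtain \<psi> :: "'e \<Rightarrow> real" where \<psi>: "smooth_on \<psi> UNIV" "\<And>x. x \<in> cball (\<kappa> p) (r/2) \<Longrightarrow> \<psi> x = 1"
    "\<And>x. x \<notin> ball (\<kappa> p) (2 * (r/2)) \<Longrightarrow> \<psi> x = 0"
    using smooth_bump[of "r/2" "\<kappa> p"] r(1) by auto
  have 0: "\<psi> x = 0" if "x \<notin> cball (\<kappa> p) r" for x
    using that by (intro \<psi>(3)) auto
  have F: "bump_extension U \<kappa> \<psi> f \<in> C"
    by (rule bump_extension_smooth[OF chart \<psi>(1) 0 compact_cball r(2) S(3) S(1) f])
  show ?thesis
  proof
    let ?W = "{x \<in> U. \<kappa> x \<in> ball (\<kappa> p) (r/2)}"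
    show "open ?W" by (rule chart_preimage_open[OF chart open_ball])
    show "p \<in> ?W" using p r(1) by simp
    show "\<kappa> x \<in> S \<and> bump_extension U \<kappa> \<psi> f x = f (\<kappa> x)" if "x \<in> ?W" for x
      using that r \<psi>(2)[of "\<kappa> x"] by (auto simp: bump_extension_def subset_iff)
    show "bump_extension U \<kappa> \<psi> f x = 0" if "x \<in> U" "\<kappa> x \<notin> S" for x
    proof -
      have "\<kappa> x \<notin> cball (\<kappa> p) r" using that(2) r(2) by blast
      from 0[OF this] show ?thesis by (simp add: bump_extension_def)
    qed
    show "bump_extension U \<kappa> \<psi> f \<in> C" by (rule F)
    show "bump_extension U \<kappa> \<psi> f x = 0" if "x \<notin> U" for x using that by (simp add: bump_extension_def)
  qed auto
qed

lemma bump_function: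
  assumes "open W" "p \<in> W"
  obtains F V where "F \<in> C" "open V" "p \<in> V" "V \<subseteq> W" "\<And>x. x \<in> V \<Longrightarrow> F x = 1" "\<And>x. x \<notin> W \<Longrightarrow> F x = 0"
proof -
  obtain U \<kappa> where U: "(U, \<kappa>) \<in> A" "p \<in> U" by (rule atlas_cover)
  note chart = atlas_charts[OF U(1)]
  let ?S = "\<kappa> ` (U \<inter> W)"
  obtain F V where F: "F \<in> C" "open V" "p \<in> V" "V \<subseteq> U" "\<And>x. x \<in> V \<Longrightarrow> \<kappa> x \<in> ?S \<and> F x = 1"
    "\<And>x. x \<in> U \<Longrightarrow> \<kappa> x \<notin> ?S \<Longrightarrow> F x = 0" "\<And>x. x \<notin> U \<Longrightarrow> F x = 0"
    by (rule smooth_extension[OF chart U(2) chart_image_open_subset[OF chart assms(1)] _ _ smooth_on_const])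
      (use assms U(2) in auto)
  have W: "x \<in> W" if "x \<in> U" "\<kappa> x \<in> ?S" for x
    using that chart_inv[OF chart] by (metis IntD1 IntD2 imageE)
  show ?thesis
  proof
    show "V \<subseteq> W" using F(4,5) W by blast
    show "F x = 0" if "x \<notin> W" for x using that W F(6,7) by blast
  qed (use F in auto)
qed

text \<open>A functional at one point instead of a field, since \<open>leaf_field_value\<close>
  applies the theory to a leaf field at q, which is not yet known to be the value of a field on the
  manifold.\<close>

definition point_derivation :: "'m \<Rightarrow> (('m \<Rightarrow> real) \<Rightarrow> real) \<Rightarrow> bool" where
  "point_derivation q \<delta> \<longleftrightarrow>
     (\<forall>F\<in>C. \<forall>G\<in>C. \<delta> (F + G) = \<delta> F + \<delta> G) \<and>
     (\<forall>c. \<forall>F\<in>C. \<delta> ((\<lambda>_. c) * F) = c * \<delta> F) \<and>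
     (\<forall>F\<in>C. \<forall>G\<in>C. \<delta> (F * G) = \<delta> F * G q + F q * \<delta> G)"

lemma vf_point_derivation:
  assumes X: "X \<in> VF" shows "point_derivation q (\<lambda>F. X F q)"
  unfolding point_derivation_def by (simp add: vf_add[OF X] vf_scale[OF X] vf_mult[OF X])

context
  fixes q \<delta> assumes \<delta>: "point_derivation q \<delta>"
begin

lemma pd_add: "F \<in> C \<Longrightarrow> G \<in> C \<Longrightarrow> \<delta> (F + G) = \<delta> F + \<delta> G"
  using \<delta> unfolding point_derivation_def by blast

lemma pd_scale: "F \<in> C \<Longrightarrow> \<delta> ((\<lambda>_. c) * F) = c * \<delta> F"
  using \<delta> unfolding point_derivation_def by blast

lemma pd_mult: "F \<in> C \<Longrightarrow> G \<in> C \<Longrightarrow> \<delta> (F * G) = \<delta> F * G q + F q * \<delta> G"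
  using \<delta> unfolding point_derivation_def by blast

lemma pd_const: "\<delta> (\<lambda>_. c) = 0"
proof -
  have 1: "1 \<in> C" using const_smooth[of 1] by (simp add: one_fun_def)
  have "\<delta> 1 = 0" using pd_mult[OF 1 1] by simp
  then have "\<delta> ((\<lambda>_. c) * 1) = 0" using pd_scale[OF 1, of c] by simp
  then show ?thesis by simp
qed

lemma pd_zero: "\<delta> 0 = 0"
  using pd_const[of 0] by (simp add: zero_fun_def)

lemma pd_diff: "F \<in> C \<Longrightarrow> G \<in> C \<Longrightarrow> \<delta> (F - G) = \<delta> F - \<delta> G"
  using pd_add[of "F - G" G] by simp

lemma pd_sum: "(\<And>i. i \<in> I \<Longrightarrow> f i \<in> C) \<Longrightarrow> \<delta> (sum f I) = (\<Sum>i\<in>I. \<delta> (f i))"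
  by (induction I rule: infinite_finite_induct) (simp_all add: pd_zero pd_add sum_smooth)

text \<open>For a bump function B supported in W the product B (F - G) is 0; as B q = 1 and F q = G
  q, the product rule leaves the difference of the two values.\<close>

lemma pd_local:
  assumes F: "F \<in> C" "G \<in> C" and W: "open W" "q \<in> W" "\<And>x. x \<in> W \<Longrightarrow> F x = G x"
  shows "\<delta> F = \<delta> G"
proof -
  obtain B V where B: "B \<in> C" "q \<in> V" "\<And>x. x \<in> V \<Longrightarrow> B x = 1" "\<And>x. x \<notin> W \<Longrightarrow> B x = 0"
    using bump_function[OF W(1,2)] by metis
  have "B * (F - G) = 0"
  proof
    fix x show "(B * (F - G)) x = 0 x" using B(4)[of x] W(3)[of x] by (cases "x \<in> W") auto
  qed
  then have "\<delta> (B * (F - G)) = 0" using pd_zero by simp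
  then have "B q * (\<delta> F - \<delta> G) = 0"
    using F B(1) W by (simp add: pd_mult pd_diff)
  then show ?thesis using B(2,3) by simp
qed

text \<open>By Hadamard's lemma F is, near q, a constant plus the sum of
  \<open>(c b - c b q) * G b\<close>, where \<open>G b q\<close> is the partial derivative in
  direction b. The product rule at q keeps only \<delta> of the coordinates times these
  values.\<close>

lemma pd_coordinates:
  assumes chart: "(U, \<kappa>) \<in> smooth_charts A" and q: "q \<in> U" and F: "F \<in> C"
    and c: "\<And>b. b \<in> Basis \<Longrightarrow> c b \<in> C" and W: "open W" "q \<in> W"
    and eq: "\<And>b x. b \<in> Basis \<Longrightarrow> x \<in> W \<Longrightarrow> x \<in> U \<Longrightarrow> c b x = \<kappa> x \<bullet> b"
  shows "\<delta> F = (\<Sum>b\<in>Basis. \<delta> (c b) * deriv_at (in_chart U \<kappa> F) (\<kappa> q) b)"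
proof -
  let ?f = "\<lambda>y. F (inv_into U \<kappa> y)"
  obtain r where r: "r > 0" "cball (\<kappa> q) r \<subseteq> \<kappa> ` U"
    using chart_ball[OF chart W(1) q W(2)] by (metis subsetI)
  have bU: "ball (\<kappa> q) r \<subseteq> \<kappa> ` U" using r(2) by auto
  have f: "smooth_on ?f (ball (\<kappa> q) r)"
    using smooth_on_subset[OF smooth_function_chart[OF chart F] bU] .
  define g where "g = (\<lambda>b. radial_integral (\<kappa> q) 0 (\<lambda>y. deriv_at ?f y b))"
  have g: "smooth_on (g b) (ball (\<kappa> q) r)" for b
    unfolding g_def by (intro smooth_on_radial_integral smooth_on_frechet_derivative f)
  have "\<exists>G V. G \<in> C \<and> open V \<and> q \<in> V \<and> V \<subseteq> U \<and> (\<forall>x\<in>V. \<kappa> x \<in> ball (\<kappa> q) r \<and> G x = g b (\<kappa> x))" for b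
    by (rule smooth_extension[OF chart q open_ball _ bU g[of b]]) (use r(1) in auto)
  then obtain G V where G: "\<And>b. G b \<in> C" "\<And>b. open (V b)" "\<And>b. q \<in> V b" "\<And>b. V b \<subseteq> U"
    "\<And>b x. x \<in> V b \<Longrightarrow> \<kappa> x \<in> ball (\<kappa> q) r \<and> G b x = g b (\<kappa> x)"
    by metis
  define H where "H = (\<lambda>_. F q) + (\<Sum>b\<in>Basis. (c b - (\<lambda>_. c b q)) * G b)"
  have term_C: "(c b - (\<lambda>_. c b q)) * G b \<in> C" if "b \<in> Basis" for b
    using c[OF that] G(1) const_smooth by simp
  have sum_C: "(\<Sum>b\<in>Basis. (c b - (\<lambda>_. c b q)) * G b) \<in> C"
    by (rule sum_smooth[OF term_C])
  have HC: "H \<in> C" unfolding H_def by (rule add_C[OF const_smooth sum_C])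
  have "\<delta> F = \<delta> H"
  proof (rule pd_local[OF F HC])
    let ?V = "W \<inter> (\<Inter>b\<in>Basis. V b)"
    show "open ?V" using W(1) G(2) by (intro open_Int open_INT) auto
    show "q \<in> ?V" using W(2) G(3) by auto
    fix x assume x: "x \<in> ?V"
    then have xb: "x \<in> V b" if "b \<in> Basis" for b using that by auto
    obtain b0 :: 'e where "b0 \<in> Basis" using nonempty_Basis by blast
    then have xU: "x \<in> U" "\<kappa> x \<in> ball (\<kappa> q) r" using xb G(4,5) by blast+
    have "F x = F q + (\<Sum>b\<in>Basis. ((\<kappa> x - \<kappa> q) \<bullet> b) * g b (\<kappa> x))"
      using hadamard[OF f xU(2)] chart_inv[OF chart xU(1)] chart_inv[OF chart q] by (simp add: g_def)
    also have "(\<Sum>b\<in>Basis. ((\<kappa> x - \<kappa> q) \<bullet> b) * g b (\<kappa> x)) = (\<Sum>b\<in>Basis. (c b x - c b q) * G b x)"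
      using x xU(1) q W(2) eq G(5)[OF xb] by (intro sum.cong) (auto simp: inner_diff_left)
    finally show "F x = H x" by (simp add: H_def sum_fun_apply)
  qed
  also have "\<dots> = (\<Sum>b\<in>Basis. \<delta> ((c b - (\<lambda>_. c b q)) * G b))"
    unfolding H_def
    by (subst pd_add[OF const_smooth sum_C], subst pd_sum[OF term_C]) (auto simp: pd_const)
  also have "\<dots> = (\<Sum>b\<in>Basis. \<delta> (c b) * G b q)"
  proof (intro sum.cong refl)
    fix b :: 'e assume b: "b \<in> Basis"
    show "\<delta> ((c b - (\<lambda>_. c b q)) * G b) = \<delta> (c b) * G b q"
      by (subst pd_mult) (use c[OF b] G(1) const_smooth in \<open>auto simp: pd_diff pd_const\<close>)
  qed
  also have "\<dots> = (\<Sum>b\<in>Basis. \<delta> (c b) * deriv_at ?f (\<kappa> q) b)"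
    using G(5)[OF G(3)] by (simp add: g_def radial_integral_center)
  finally show ?thesis .
qed

end

lemmas vf_local = pd_local[OF vf_point_derivation]
lemmas vf_coordinates = pd_coordinates[OF vf_point_derivation]

text \<open>Global functions and global fields that agree with coordinates and partial derivatives
  on W only. Being elements of C and VF, they are subject to the algebraic lemmas.\<close>

definition coord_frame ::
  "'m set \<Rightarrow> ('m \<Rightarrow> 'e) \<Rightarrow> 'm set \<Rightarrow> ('e \<Rightarrow> 'm \<Rightarrow> real) \<Rightarrow> ('e \<Rightarrow> 'm vfield) \<Rightarrow> bool" where
  "coord_frame U \<kappa> W c d \<longleftrightarrow> open W \<and> W \<subseteq> U \<and>
     (\<forall>b\<in>Basis. c b \<in> C \<and> d b \<in> VF) \<and>
     (\<forall>b\<in>Basis. \<forall>x\<in>W. c b x = \<kappa> x \<bullet> b) \<and>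
     (\<forall>b\<in>Basis. \<forall>F\<in>C. \<forall>x\<in>W. d b F x = deriv_at (in_chart U \<kappa> F) (\<kappa> x) b)"

lemma coord_frame_exists:
  assumes chart: "(U, \<kappa>) \<in> smooth_charts A" and p: "p \<in> U"
  obtains W c d where "coord_frame U \<kappa> W c d" "p \<in> W"
proof -
  obtain r where r: "r > 0" "cball (\<kappa> p) r \<subseteq> \<kappa> ` U"
    using chart_ball[OF chart open_UNIV p UNIV_I] by (metis subsetI)
  obtain \<psi> :: "'e \<Rightarrow> real" where \<psi>: "smooth_on \<psi> UNIV" "\<And>x. x \<in> cball (\<kappa> p) (r/2) \<Longrightarrow> \<psi> x = 1"
    "\<And>x. x \<notin> ball (\<kappa> p) (2 * (r/2)) \<Longrightarrow> \<psi> x = 0"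
    using smooth_bump[of "r/2" "\<kappa> p"] r(1) by auto
  have 0: "\<psi> x = 0" if "x \<notin> cball (\<kappa> p) r" for x
    using that by (intro \<psi>(3)) auto
  note extC = bump_extension_smooth[OF chart \<psi>(1) 0 compact_cball r(2) subset_refl chart_image_open[OF chart]]
  define W where "W = {x \<in> U. \<kappa> x \<in> ball (\<kappa> p) (r/2)}"
  define c where "c = (\<lambda>b. bump_extension U \<kappa> \<psi> (\<lambda>y. y \<bullet> b))"
  \<comment> \<open>The alternative 0 follows the convention that fields vanish outside
    \<open>C\<close>.\<close>
  define d where "d = (\<lambda>b F. if F \<in> C then bump_extension U \<kappa> \<psi> (\<lambda>y. deriv_at (in_chart U \<kappa> F) y b) else 0)"
  have W: "x \<in> W \<Longrightarrow> \<psi> (\<kappa> x) = 1" for x by (auto simp: W_def intro!: \<psi>(2))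
  have diff: "(in_chart U \<kappa> F) differentiable (at (\<kappa> x))" if "F \<in> C" "x \<in> U" for F x
    using smooth_on_imp_differentiable[OF smooth_function_chart[OF chart that(1)]] that(2) by blast
  have "d b \<in> VF" for b
  proof (rule VF_I)
    fix f assume f: "f \<in> C"
    show "d b f \<in> C" unfolding d_def using f
      by (simp, intro extC smooth_on_frechet_derivative smooth_function_chart[OF chart f])
    fix g assume g: "g \<in> C"
    show "d b (f + g) = d b f + d b g"
    proof
      fix x show "d b (f + g) x = (d b f + d b g) x"
      proof (cases "x \<in> U")
        case True
        have "deriv_at (\<lambda>y. f (inv_into U \<kappa> y) + g (inv_into U \<kappa> y)) (\<kappa> x) =
            (\<lambda>v. deriv_at (in_chart U \<kappa> f) (\<kappa> x) v + deriv_at (in_chart U \<kappa> g) (\<kappa> x) v)"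
          by (rule frechet_derivative_at[symmetric])
            (rule has_derivative_add[OF diff[OF f True, unfolded frechet_derivative_works] diff[OF g True, unfolded frechet_derivative_works]])
        then show ?thesis using f g by (simp add: d_def bump_extension_def algebra_simps)
      qed (use f g in \<open>simp add: d_def bump_extension_def\<close>)
    qed
    show "d b (f * g) = d b f * g + f * d b g"
    proof
      fix x show "d b (f * g) x = (d b f * g + f * d b g) x"
      proof (cases "x \<in> U")
        case True
        have "deriv_at (\<lambda>y. f (inv_into U \<kappa> y) * g (inv_into U \<kappa> y)) (\<kappa> x) =
            (\<lambda>v. f (inv_into U \<kappa> (\<kappa> x)) * deriv_at (in_chart U \<kappa> g) (\<kappa> x) v
              + deriv_at (in_chart U \<kappa> f) (\<kappa> x) v * g (inv_into U \<kappa> (\<kappa> x)))"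
          by (rule frechet_derivative_at[symmetric])
            (rule has_derivative_mult[OF diff[OF f True, unfolded frechet_derivative_works] diff[OF g True, unfolded frechet_derivative_works]])
        then show ?thesis using f g True by (simp add: d_def bump_extension_def algebra_simps chart_inv[OF chart])
      qed (use f g in \<open>simp add: d_def bump_extension_def\<close>)
    qed
  next
    fix k f assume f: "f \<in> C"
    show "d b ((\<lambda>_. k) * f) = (\<lambda>_. k) * d b f"
    proof
      fix x show "d b ((\<lambda>_. k) * f) x = ((\<lambda>_. k) * d b f) x"
      proof (cases "x \<in> U")
        case True
        have "deriv_at (\<lambda>y. k * f (inv_into U \<kappa> y)) (\<kappa> x) =
            (\<lambda>v. k * deriv_at (in_chart U \<kappa> f) (\<kappa> x) v)"
          by (rule frechet_derivative_at[symmetric])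
            (rule has_derivative_mult_right[OF diff[OF f True, unfolded frechet_derivative_works]])
        then show ?thesis using f by (simp add: d_def bump_extension_def)
      qed (use f in \<open>simp add: d_def bump_extension_def\<close>)
    qed
  qed (simp add: d_def)
  moreover have "c b \<in> C" for b
    unfolding c_def by (intro extC smooth_on_inner_const smooth_on_ident chart_image_open[OF chart])
  moreover have "open W" unfolding W_def by (rule chart_preimage_open[OF chart open_ball])
  ultimately have "coord_frame U \<kappa> W c d"
    unfolding coord_frame_def using W by (auto simp: c_def d_def bump_extension_def W_def)
  moreover have "p \<in> W" using p r(1) by (simp add: W_def)
  ultimately show ?thesis using that by blast
qed

lemma coord_frameD:
  assumes "coord_frame U \<kappa> W c d"
  shows "open W" "W \<subseteq> U" "b \<in> Basis \<Longrightarrow> c b \<in> C" "b \<in> Basis \<Longrightarrow> d b \<in> VF"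
    and "b \<in> Basis \<Longrightarrow> x \<in> W \<Longrightarrow> c b x = \<kappa> x \<bullet> b"
    and "b \<in> Basis \<Longrightarrow> F \<in> C \<Longrightarrow> x \<in> W \<Longrightarrow>
      d b F x = deriv_at (in_chart U \<kappa> F) (\<kappa> x) b"
  using assms by (simp_all add: coord_frame_def)

lemma coord_frame_at:
  obtains U \<kappa> W c d where "(U, \<kappa>) \<in> smooth_charts A" "coord_frame U \<kappa> W c d" "p \<in> U" "p \<in> W"
proof -
  obtain U \<kappa> where U: "(U, \<kappa>) \<in> A" "p \<in> U" by (rule atlas_cover)
  then show ?thesis using coord_frame_exists[OF atlas_charts[OF U(1)] U(2)] that atlas_charts by metis
qed

lemma coord_frame_expand:
  assumes chart: "(U, \<kappa>) \<in> smooth_charts A" and cf: "coord_frame U \<kappa> W c d"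
    and X: "X \<in> VF" and F: "F \<in> C" and q: "q \<in> W"
  shows "X F q = (\<Sum>b\<in>Basis. X (c b) q * d b F q)"
proof -
  have "X F q = (\<Sum>b\<in>Basis. X (c b) q * deriv_at (in_chart U \<kappa> F) (\<kappa> q) b)"
    by (rule vf_coordinates[OF X chart _ F]) (use cf q in \<open>auto simp: coord_frame_def\<close>)
  then show ?thesis using cf q F by (simp add: coord_frame_def)
qed

text \<open>Multiplication by a bump function turns the local coordinate expansion of X into a
  global one, to which C-linearity applies; its coefficients vanish at p.\<close>

lemma tensorial:
  assumes \<omega>: "one_form C \<omega>" and X: "X \<in> VF" and 0: "value_at X p = 0"
  shows "\<omega> X p = 0"
proof -
  obtain U \<kappa> W c d where chart: "(U, \<kappa>) \<in> smooth_charts A" and cf: "coord_frame U \<kappa> W c d" and p: "p \<in> W"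
    by (rule coord_frame_at)
  note W = coord_frameD(1)[OF cf] and cd = coord_frameD(3,4)[OF cf]
  obtain B V where B: "B \<in> C" "p \<in> V" "\<And>x. x \<in> V \<Longrightarrow> B x = 1" "\<And>x. x \<notin> W \<Longrightarrow> B x = 0"
    using bump_function[OF W p] by metis
  let ?Y = "\<Sum>b\<in>Basis. (B * X (c b)) \<odot> d b"
  have YC: "(B * X (c b)) \<odot> d b \<in> VF" if "b \<in> Basis" for b using that X cd B(1) by simp
  have "B \<odot> X = ?Y"
  proof (rule VF_eqI)
    show "?Y \<in> VF" by (rule VF_sum[OF YC])
    fix u q assume u: "u \<in> C"
    show "(B \<odot> X) u q = ?Y u q"
    proof (cases "q \<in> W")
      case True
      show ?thesis
        using coord_frame_expand[OF chart cf X u True] by (simp add: sum_fun_apply sum_distrib_left mult.assoc)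
    qed (simp add: sum_fun_apply B(4))
  qed (use X B in simp)
  then have "\<omega> (B \<odot> X) p = \<omega> ?Y p" by simp
  also have "\<omega> ?Y = (\<Sum>b\<in>Basis. \<omega> ((B * X (c b)) \<odot> d b))"
    by (rule form_sum[OF \<omega> YC])
  also have "\<dots> p = 0"
    using 0 cd B(1) X by (simp add: sum_fun_apply form_fmul[OF \<omega>] value_at_def fun_eq_iff)
  finally show ?thesis unfolding form_fmul[OF \<omega> B(1) X] using B(2,3) by simp
qed

lemma coord_frame_form:
  assumes chart: "(U, \<kappa>) \<in> smooth_charts A" and cf: "coord_frame U \<kappa> W c d"
    and \<omega>: "one_form C \<omega>" and X: "X \<in> VF" and q: "q \<in> W"
  shows "\<omega> X q = (\<Sum>b\<in>Basis. X (c b) q * \<omega> (d b) q)"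
proof -
  note cd = coord_frameD(3,4)[OF cf]
  let ?Y = "\<Sum>b\<in>Basis. X (c b) \<odot> d b"
  have YC: "X (c b) \<odot> d b \<in> VF" if "b \<in> Basis" for b using that X cd by simp
  have Y: "?Y \<in> VF" by (rule VF_sum[OF YC])
  have "value_at (X - ?Y) q = 0"
  proof
    fix u show "value_at (X - ?Y) q u = 0 u"
    proof (cases "u \<in> C")
      case True
      then show ?thesis
        using coord_frame_expand[OF chart cf X True q] by (simp add: value_at_def sum_fun_apply)
    next
      case False
      then have "(X - ?Y) u = 0" using vf_outside[of "X - ?Y" u] X Y by simp
      then show ?thesis by (simp add: value_at_def)
    qed
  qed
  then have "\<omega> (X - ?Y) q = 0" using tensorial[OF \<omega>] X Y by simp
  then have "\<omega> X q = \<omega> ?Y q" using X Y by (simp add: form_diff[OF \<omega>])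
  also have "\<omega> ?Y = (\<Sum>b\<in>Basis. \<omega> (X (c b) \<odot> d b))"
    by (rule form_sum[OF \<omega> YC])
  finally show ?thesis using cd X by (simp add: sum_fun_apply form_fmul[OF \<omega>])
qed

end


section \<open>First integrals and adapted charts\<close>

text \<open>Points with the same image under \<open>\<Phi>\<close> differ by a multiple of \<open>b\<close>, so Rolle's theorem gives
  injectivity near \<open>a\<close>, and invariance of domain makes \<open>\<Phi>\<close> a local homeomorphism.\<close>
lemma smooth_local_inverse_shear:
  fixes f :: "'a::euclidean_space \<Rightarrow> real" and b :: 'a
  defines "\<Phi> \<equiv> \<lambda>x. x + (f x - x \<bullet> b) *\<^sub>R b"
  assumes S: "open S" "a \<in> S" and f: "smooth_on f S" and b: "b \<in> Basis"
    and nz: "deriv_at f a b \<noteq> 0"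
  obtains T r where "open T" "a \<in> T" "T \<subseteq> S" "r > 0" "inj_on \<Phi> T" "\<Phi> ` T = ball (\<Phi> a) r"
    "smooth_on \<Phi> T" "smooth_on (inv_into T \<Phi>) (ball (\<Phi> a) r)"
proof -
  let ?D = "\<lambda>x. deriv_at f x"
  have "continuous_on S (\<lambda>x. ?D x b)"
    by (rule smooth_on_imp_continuous_on[OF smooth_on_frechet_derivative[OF f]])
  then have "open (S \<inter> (\<lambda>x. ?D x b) -` (- {0}))"
    by (rule continuous_open_preimage[OF _ S(1)]) auto
  moreover have "a \<in> S \<inter> (\<lambda>x. ?D x b) -` (- {0})" using S nz by simp
  ultimately obtain e where e: "e > 0" "ball a e \<subseteq> S \<inter> (\<lambda>x. ?D x b) -` (- {0})"
    using open_contains_ball by blast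
  let ?B = "ball a e"
  have BS: "?B \<subseteq> S" and nzB: "x \<in> ?B \<Longrightarrow> ?D x b \<noteq> 0" for x using e(2) by auto
  have comp: "\<Phi> x \<bullet> c = (if c = b then f x else x \<bullet> c)" if "c \<in> Basis" for x c
    using that b by (simp add: \<Phi>_def inner_add_left inner_Basis)
  have inj: "inj_on \<Phi> ?B"
  proof (rule inj_onI, rule ccontr)
    fix x y assume x: "x \<in> ?B" and y: "y \<in> ?B" and eq: "\<Phi> x = \<Phi> y" and ne: "x \<noteq> y"
    have c: "x \<bullet> c = y \<bullet> c" if "c \<in> Basis" "c \<noteq> b" for c
      using comp[OF that(1), of x] comp[OF that(1), of y] eq that(2) by simp
    have fxy: "f x = f y" using comp[OF b, of x] comp[OF b, of y] eq by simp
    have yx: "y - x = ((y - x) \<bullet> b) *\<^sub>R b"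
    proof (rule euclidean_eqI)
      fix c :: 'a assume "c \<in> Basis"
      then show "(y - x) \<bullet> c = ((y - x) \<bullet> b) *\<^sub>R b \<bullet> c"
        using c[of c] b by (cases "c = b") (auto simp: inner_diff_left inner_Basis)
    qed
    have seg: "x + t *\<^sub>R (y - x) \<in> ?B" if "0 \<le> t" "t \<le> 1" for t
    proof -
      have "x + t *\<^sub>R (y - x) = (1 - t) *\<^sub>R x + t *\<^sub>R y" by (simp add: algebra_simps)
      then show ?thesis using convexD_alt[OF convex_ball x y that] by simp
    qed
    define \<phi> where "\<phi> = (\<lambda>t. f (x + t *\<^sub>R (y - x)))"
    have d: "(\<phi> has_derivative (\<lambda>s. s * ?D (x + t *\<^sub>R (y - x)) (y - x))) (at t)"
      if "0 \<le> t" "t \<le> 1" for t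
    proof -
      have fd: "f differentiable (at (x + t *\<^sub>R (y - x)))"
        using smooth_on_imp_differentiable[OF f] seg[OF that] BS by blast
      interpret linear "?D (x + t *\<^sub>R (y - x))" by (rule linear_frechet_derivative[OF fd])
      have "((\<lambda>t. x + t *\<^sub>R (y - x)) has_derivative (\<lambda>s. s *\<^sub>R (y - x))) (at t)"
        by (auto intro!: derivative_eq_intros)
      from has_derivative_compose[OF this fd[unfolded frechet_derivative_works]]
      show ?thesis unfolding \<phi>_def by (rule has_derivative_eq_rhs) (simp add: scale fun_eq_iff)
    qed
    have "\<exists>t. 0 < t \<and> t < 1 \<and> (\<lambda>s. s * ?D (x + t *\<^sub>R (y - x)) (y - x)) = (\<lambda>v. 0)"
    proof (rule Rolle_deriv)
      show "\<phi> 0 = \<phi> 1" using fxy by (simp add: \<phi>_def)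
      show "continuous_on {0..1} \<phi>"
        by (intro continuous_at_imp_continuous_on ballI has_derivative_continuous[OF d]) auto
    qed (use d in auto)
    then obtain t where t: "0 < t" "t < 1" "(\<lambda>s. s * ?D (x + t *\<^sub>R (y - x)) (y - x)) = (\<lambda>v. 0)" by blast
    have fd: "f differentiable (at (x + t *\<^sub>R (y - x)))"
      using smooth_on_imp_differentiable[OF f] seg[of t] t BS by auto
    interpret linear "?D (x + t *\<^sub>R (y - x))" by (rule linear_frechet_derivative[OF fd])
    have "?D (x + t *\<^sub>R (y - x)) (y - x) = 0" using fun_cong[OF t(3), of 1] by simp
    moreover have "?D (x + t *\<^sub>R (y - x)) (y - x) = ((y - x) \<bullet> b) * ?D (x + t *\<^sub>R (y - x)) b"
      using scale[of "(y - x) \<bullet> b" b] yx by simp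
    moreover have "?D (x + t *\<^sub>R (y - x)) b \<noteq> 0" using nzB seg[of t] t by simp
    moreover have "(y - x) \<bullet> b \<noteq> 0" using yx ne by auto
    ultimately show False by simp
  qed
  have sm: "smooth_on \<Phi> ?B"
    unfolding \<Phi>_def
    by (intro smooth_on_add smooth_on_ident smooth_on_scaleR smooth_on_diff smooth_on_inner_const
        smooth_on_const smooth_on_subset[OF f BS] open_ball)
  have "open (\<Phi> ` ?B)"
    by (rule invariance_of_domain[OF smooth_on_imp_continuous_on[OF sm] open_ball inj])
  moreover have "\<Phi> a \<in> \<Phi> ` ?B" using e(1) by simp
  ultimately obtain r where r: "r > 0" "ball (\<Phi> a) r \<subseteq> \<Phi> ` ?B"
    using open_contains_ball by blast
  define T where "T = ?B \<inter> \<Phi> -` ball (\<Phi> a) r"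
  have T: "open T" unfolding T_def
    by (rule continuous_open_preimage[OF smooth_on_imp_continuous_on[OF sm] open_ball open_ball])
  have TB: "T \<subseteq> ?B" by (auto simp: T_def)
  have img: "\<Phi> ` T = ball (\<Phi> a) r" using r(2) by (auto simp: T_def)
  have injT: "inj_on \<Phi> T" using inj TB inj_on_subset by blast
  let ?g = "inv_into T \<Phi>"
  have gT: "?g y \<in> T" "\<Phi> (?g y) = y" if "y \<in> ball (\<Phi> a) r" for y
    using that img inv_into_into[of y \<Phi> T] f_inv_into_f[of y \<Phi> T] by auto
  have cg: "continuous_on (ball (\<Phi> a) r) ?g"
    using continuous_on_inverse_open[OF T smooth_on_imp_continuous_on[OF smooth_on_subset[OF sm TB]], of ?g] injT img
    by simp
  have d\<Phi>: "(\<Phi> has_derivative (\<lambda>v. v + (?D x v - v \<bullet> b) *\<^sub>R b)) (at x)" if x: "x \<in> ?B" for x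
  proof -
    have "(f has_derivative ?D x) (at x)" using smooth_on_imp_has_derivative[OF f] x BS by blast
    then show ?thesis unfolding \<Phi>_def by (auto intro!: derivative_eq_intros)
  qed
  \<comment> \<open>The inverse of the differential of \<Phi>. The preimage of w is w + s b, and
    comparing b-components gives D f w + s D f b = w \<bullet> b.\<close>
  define G where "G = (\<lambda>x w. w + ((w \<bullet> b - ?D x w) * inverse (?D x b)) *\<^sub>R b)"
  have dg: "(?g has_derivative G (?g y)) (at y)" if y: "y \<in> ball (\<Phi> a) r" for y
  proof (rule has_derivative_inverse_basic[OF _ _ _ _ open_ball y])
    have xB: "?g y \<in> ?B" using gT[OF y] TB by blast
    have fd: "f differentiable (at (?g y))" using smooth_on_imp_differentiable[OF f] xB BS by blast
    interpret bounded_linear "?D (?g y)"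
      using fd frechet_derivative_works has_derivative_bounded_linear by blast
    show "(\<Phi> has_derivative (\<lambda>v. v + (?D (?g y) v - v \<bullet> b) *\<^sub>R b)) (at (?g y))"
      by (rule d\<Phi>[OF xB])
    show "bounded_linear (G (?g y))" unfolding G_def
      by (intro bounded_linear_add bounded_linear_ident bounded_linear_scaleR_const
          bounded_linear_mult_const bounded_linear_sub bounded_linear_inner_left bounded_linear)
    show "G (?g y) \<circ> (\<lambda>v. v + (?D (?g y) v - v \<bullet> b) *\<^sub>R b) = id"
    proof
      fix v
      have nz': "?D (?g y) b \<noteq> 0" using nzB xB by blast
      define k where "k = ?D (?g y) v - v \<bullet> b"
      have "?D (?g y) (v + k *\<^sub>R b) = ?D (?g y) v + k * ?D (?g y) b" by (simp add: add scale)
      moreover have "(v + k *\<^sub>R b) \<bullet> b = v \<bullet> b + k" using b by (simp add: inner_add_left)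
      moreover have "(v \<bullet> b + k - (?D (?g y) v + k * ?D (?g y) b)) * inverse (?D (?g y) b) = - k"
        using nz' by (simp add: k_def field_simps)
      ultimately have "G (?g y) (v + k *\<^sub>R b) = v" by (simp only: G_def) simp
      then show "(G (?g y) \<circ> (\<lambda>v. v + (?D (?g y) v - v \<bullet> b) *\<^sub>R b)) v = id v"
        by (simp only: k_def o_apply id_apply)
    qed
    show "continuous (at y) ?g" using cg y by (simp add: continuous_on_eq_continuous_at)
    show "\<Phi> (?g z) = z" if "z \<in> ball (\<Phi> a) r" for z using gT(2)[OF that] .
  qed
  \<comment> \<open>Bootstrapping: the derivative of the inverse is an expression in derivatives of
    f composed with the inverse, so k orders for the inverse yield k + 1.\<close>
  have "Ck_on k ?g (ball (\<Phi> a) r)" for k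
  proof (induction k)
    case 0
    then show ?case using cg by simp
  next
    case (Suc k)
    have img': "?g ` ball (\<Phi> a) r \<subseteq> S" using gT(1) TB BS by blast
    have Dk: "Ck_on k (\<lambda>y. ?D (?g y) w) (ball (\<Phi> a) r)" for w
    proof -
      have "Ck_on k (\<lambda>x. ?D x w) S" using smooth_on_frechet_derivative[OF f] by (simp add: smooth_on_def)
      then show ?thesis by (rule Ck_on_compose[OF open_ball S(1) img' Suc.IH])
    qed
    show ?case
    proof (rule Ck_on_SucI[OF open_ball dg])
      fix w
      have "Ck_on k (\<lambda>y. inverse (?D (?g y) b)) (ball (\<Phi> a) r)"
        by (rule Ck_on_inverse[OF open_ball Dk]) (use nzB gT(1) TB in blast)
      moreover have "Ck_on k (\<lambda>y. w \<bullet> b - ?D (?g y) w) (ball (\<Phi> a) r)"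
        using Ck_on_add[OF open_ball Ck_on_const[of k "w \<bullet> b"] Ck_on_bounded_linear_compose[OF bounded_linear_minus[OF bounded_linear_ident] open_ball Dk[of w]]]
        by simp
      ultimately show "Ck_on k (\<lambda>y. G (?g y) w) (ball (\<Phi> a) r)"
        unfolding G_def
        by (intro Ck_on_add Ck_on_const Ck_on_bilinear[OF bounded_bilinear_scaleR]
            Ck_on_bilinear[OF bounded_bilinear_mult] open_ball)
    qed
  qed
  then have "smooth_on ?g (ball (\<Phi> a) r)" by (simp add: smooth_on_def)
  moreover have "a \<in> T" using e(1) r(1) by (simp add: T_def)
  ultimately show ?thesis
    using that[OF T _ _ r(1) injT img smooth_on_subset[OF sm TB]] TB BS by blast
qed

text \<open>The field \<xi> witnesses that \<eta> vanishes nowhere, so that first integrals have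
  nonzero differential.\<close>

locale closed_form = manifold A for A :: "('m::t2_space, 'e::euclidean_space) chart set" +
  fixes \<eta> \<xi>
  assumes eta: "one_form (smooth_functions A) \<eta>"
    and closed: "\<And>X Y. X \<in> vector_fields (smooth_functions A) \<Longrightarrow> Y \<in> vector_fields (smooth_functions A) \<Longrightarrow>
      ext_deriv1 \<eta> X Y = 0"
    and xi: "\<xi> \<in> vector_fields (smooth_functions A)" "\<eta> \<xi> = 1"
begin

definition first_integral :: "'m set \<Rightarrow> ('m \<Rightarrow> real) \<Rightarrow> bool" where
  "first_integral W f \<longleftrightarrow> open W \<and> f \<in> C \<and> (\<forall>X\<in>VF. \<forall>x\<in>W. \<eta> X x = X f x)"

lemma first_integral_subset: "first_integral W f \<Longrightarrow> open V \<Longrightarrow> V \<subseteq> W \<Longrightarrow> first_integral V f"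
  unfolding first_integral_def by blast

lemma first_integral_exists:
  obtains W f where "first_integral W f" "p \<in> W"
proof -
  obtain U \<kappa> W c d where chart: "(U, \<kappa>) \<in> smooth_charts A" and cf: "coord_frame U \<kappa> W c d"
    and U: "p \<in> U" and p: "p \<in> W"
    by (rule coord_frame_at)
  note W = coord_frameD(1,2)[OF cf] and cd = coord_frameD(3,4)[OF cf] and cW = coord_frameD(5)[OF cf]
    and dF = coord_frameD(6)[OF cf]
  obtain r where r: "r > 0" "\<And>y. y \<in> cball (\<kappa> p) r \<Longrightarrow> y \<in> \<kappa> ` U \<and> inv_into U \<kappa> y \<in> W"
    using chart_ball[OF chart W(1) U p] by metis
  have bU: "ball (\<kappa> p) r \<subseteq> \<kappa> ` U" using r(2) by (meson ball_subset_cball subset_iff)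
  define a where "a = (\<lambda>b y. \<eta> (d b) (inv_into U \<kappa> y))"
  have etaC: "\<eta> (d b) \<in> C" if "b \<in> Basis" for b using form_closed[OF eta cd(2)[OF that]] .
  have dd: "d b (c e) x = (if b = e then 1 else 0)" if "b \<in> Basis" "e \<in> Basis" "x \<in> W" for b e x
  proof -
    have xU: "x \<in> U" using that(3) W(2) by blast
    have k: "\<kappa> x \<in> \<kappa> ` (U \<inter> W)" using that(3) xU by blast
    have "deriv_at (\<lambda>y. c e (inv_into U \<kappa> y)) (\<kappa> x) = deriv_at (\<lambda>y. y \<bullet> e) (\<kappa> x)"
    proof (rule frechet_derivative_cong[OF chart_image_open_subset[OF chart W(1)] k])
      fix y assume "y \<in> \<kappa> ` (U \<inter> W)"
      then obtain z where "z \<in> U" "z \<in> W" "y = \<kappa> z" by blast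
      then show "c e (inv_into U \<kappa> y) = y \<bullet> e" using chart_inv[OF chart] cW[OF that(2)] by simp
    qed
    also have "\<dots> = (\<lambda>v. v \<bullet> e)"
      by (rule frechet_derivative_at[symmetric]) (auto intro!: derivative_eq_intros)
    finally show ?thesis
      using dF[OF that(1) cd(1)[OF that(2)] that(3)] that by (simp add: inner_Basis)
  qed
  \<comment> \<open>the bracket of two coordinate fields kills the coordinate functions, so it vanishes on \<open>W\<close>\<close>
  have br: "\<eta> (bracket (d b) (d e)) x = 0" if be: "b \<in> Basis" "e \<in> Basis" and x: "x \<in> W" for b e x
  proof (rule tensorial[OF eta])
    show "bracket (d b) (d e) \<in> VF" using be cd by simp
    have z: "d b (d e (c i)) x = 0" if "b \<in> Basis" "e \<in> Basis" "i \<in> Basis" for b e i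
    proof -
      have "d b (d e (c i)) x = d b (\<lambda>_. if e = i then 1 else 0) x"
        by (rule vf_local[OF cd(2)[OF that(1)] _ const_smooth W(1) x])
          (use cd that dd in auto)
      then show ?thesis using pd_const[OF vf_point_derivation[OF cd(2)[OF that(1)]]] by simp
    qed
    show "value_at (bracket (d b) (d e)) x = 0"
    proof
      fix u show "value_at (bracket (d b) (d e)) x u = 0 u"
      proof (cases "u \<in> C")
        case True
        have "bracket (d b) (d e) u x = (\<Sum>i\<in>Basis. bracket (d b) (d e) (c i) x * d i u x)"
          by (rule coord_frame_expand[OF chart cf _ True x]) (use be cd in simp)
        then show ?thesis using be by (simp add: value_at_def bracket_apply z)
      next
        case False
        then show ?thesis
          using vf_outside[OF VF_bracket[OF cd(2)[OF be(1)] cd(2)[OF be(2)]] False] by (simp add: value_at_def)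
      qed
    qed
  qed
  obtain f0 where f0: "smooth_on f0 (ball (\<kappa> p) r)"
    "\<And>b x. b \<in> Basis \<Longrightarrow> x \<in> ball (\<kappa> p) r \<Longrightarrow> deriv_at f0 x b = a b x"
  proof (rule poincare[of a "\<kappa> p" r])
    show "smooth_on (a b) (ball (\<kappa> p) r)" if "b \<in> Basis" for b
      unfolding a_def by (rule smooth_on_subset[OF smooth_function_chart[OF chart etaC[OF that]] bU])
    show "deriv_at (a b) y e = deriv_at (a e) y b"
      if "b \<in> Basis" "e \<in> Basis" "y \<in> ball (\<kappa> p) r" for b e y
    proof -
      define x where "x = inv_into U \<kappa> y"
      have "y \<in> cball (\<kappa> p) r" using that(3) by simp
      then have x: "x \<in> W" "\<kappa> x = y" using r(2) chart_inv2[OF chart] by (auto simp: x_def)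
      \<comment> \<open>Without the bracket term, closedness is the symmetry of the partial
        derivatives of the coefficients, as \<open>poincare\<close> requires.\<close>
      have "ext_deriv1 \<eta> (d e) (d b) x = 0" using closed[OF cd(2)[OF that(2)] cd(2)[OF that(1)]] by simp
      then have "d e (\<eta> (d b)) x = d b (\<eta> (d e)) x"
        using br[OF that(2,1) x(1)] by (simp add: ext_deriv1_def)
      then show ?thesis
        using dF[OF that(2) etaC[OF that(1)] x(1)] dF[OF that(1) etaC[OF that(2)] x(1)] x(2)
        by (simp add: a_def[abs_def])
    qed
  qed blast
  obtain f V where f: "f \<in> C" "open V" "p \<in> V" "V \<subseteq> U" "\<And>x. x \<in> V \<Longrightarrow> \<kappa> x \<in> ball (\<kappa> p) r \<and> f x = f0 (\<kappa> x)"
    by (rule smooth_extension[OF chart U open_ball _ bU f0(1)]) (use r(1) in auto)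
  have "first_integral (V \<inter> W) f"
    unfolding first_integral_def
  proof (intro conjI ballI)
    fix X x assume X: "X \<in> VF" and x: "x \<in> V \<inter> W"
    have xU: "x \<in> U" using x W(2) by blast
    have "deriv_at (in_chart U \<kappa> f) (\<kappa> x) = deriv_at f0 (\<kappa> x)"
    proof (rule frechet_derivative_cong[OF chart_image_open_subset[OF chart f(2)]])
      show "\<kappa> x \<in> \<kappa> ` (U \<inter> V)" using x xU by blast
      fix y assume "y \<in> \<kappa> ` (U \<inter> V)"
      then obtain z where "z \<in> U" "z \<in> V" "y = \<kappa> z" by blast
      then show "f (inv_into U \<kappa> y) = f0 y" using chart_inv[OF chart] f(5) by simp
    qed
    then have "d b f x = \<eta> (d b) x" if "b \<in> Basis" for b
      using dF[OF that f(1)] f0(2)[OF that, of "\<kappa> x"] f(5)[of x] x chart_inv[OF chart xU] by (simp add: a_def)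
    then show "\<eta> X x = X f x"
      using coord_frame_form[OF chart cf eta X, of x] coord_frame_expand[OF chart cf X f(1), of x] x by simp
  qed (use f W in auto)
  moreover have "p \<in> V \<inter> W" using f p by blast
  ultimately show ?thesis using that by blast
qed

text \<open>The difference has zero derivative on a coordinate ball, hence is constant there.
  Consequently the germ of a level set does not depend on the first integral, on which the leaf
  topology rests.\<close>

lemma first_integral_unique:
  assumes f: "first_integral W f" and f': "first_integral W' f'" and q: "q \<in> W" "q \<in> W'"
  obtains V where "open V" "q \<in> V" "V \<subseteq> W" "V \<subseteq> W'" "\<And>x. x \<in> V \<Longrightarrow> f x - f q = f' x - f' q"
proof -
  obtain U \<kappa> V c d where chart: "(U, \<kappa>) \<in> smooth_charts A" and cf: "coord_frame U \<kappa> V c d"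
    and U: "q \<in> U" and qV: "q \<in> V"
    by (rule coord_frame_at)
  let ?W = "V \<inter> W \<inter> W'"
  have W: "open ?W" "q \<in> ?W" using cf f f' q qV by (auto simp: coord_frame_def first_integral_def)
  obtain r where r: "r > 0" "\<And>y. y \<in> cball (\<kappa> q) r \<Longrightarrow> y \<in> \<kappa> ` U \<and> inv_into U \<kappa> y \<in> ?W"
    using chart_ball[OF chart W(1) U W(2)] by metis
  have FC: "f - f' \<in> C" using f f' by (simp add: first_integral_def)
  let ?F = "\<lambda>y. (f - f') (inv_into U \<kappa> y)"
  have "\<exists>k. \<forall>y\<in>ball (\<kappa> q) r. ?F y = k"
  proof (rule has_derivative_zero_constant[OF convex_ball])
    fix y assume "y \<in> ball (\<kappa> q) r"
    then have y: "y \<in> \<kappa> ` U" "inv_into U \<kappa> y \<in> ?W" using r(2)[of y] by auto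
    have diff: "?F differentiable (at y)"
      using smooth_on_imp_differentiable[OF smooth_function_chart[OF chart FC] y(1)] .
    have "deriv_at ?F y b = 0" if b: "b \<in> Basis" for b
    proof -
      have dV: "d b \<in> VF" using cf b by (simp add: coord_frame_def)
      have "d b (f - f') (inv_into U \<kappa> y) = deriv_at ?F (\<kappa> (inv_into U \<kappa> y)) b"
        using cf b FC y unfolding coord_frame_def by blast
      moreover have "d b (f - f') (inv_into U \<kappa> y) = 0"
      proof -
        have "\<eta> (d b) (inv_into U \<kappa> y) = d b f (inv_into U \<kappa> y)"
          "\<eta> (d b) (inv_into U \<kappa> y) = d b f' (inv_into U \<kappa> y)"
          using f f' y(2) dV unfolding first_integral_def by blast+
        then show ?thesis using f f' by (simp add: first_integral_def vf_diff[OF dV])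
      qed
      ultimately show ?thesis using chart_inv2[OF chart y(1)] by simp
    qed
    then have "deriv_at ?F y = (\<lambda>v. 0)"
      using frechet_derivative_Basis_sum[OF diff] by (intro ext) simp
    then show "(?F has_derivative (\<lambda>v. 0)) (at y within ball (\<kappa> q) r)"
      using diff[unfolded frechet_derivative_works] by (simp add: has_derivative_at_withinI)
  qed
  then obtain k where k: "\<And>y. y \<in> ball (\<kappa> q) r \<Longrightarrow> ?F y = k" by blast
  let ?V = "{x \<in> U. \<kappa> x \<in> ball (\<kappa> q) r}"
  have kV: "f x - f' x = k" if "x \<in> ?V" for x using k[of "\<kappa> x"] that chart_inv[OF chart] by auto
  have qV': "q \<in> ?V" using U r(1) by simp
  have sub: "x \<in> ?W" if "x \<in> ?V" for x
    using that r(2)[of "\<kappa> x"] chart_inv[OF chart, of x] by auto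
  show ?thesis
  proof
    show "open ?V" by (rule chart_preimage_open[OF chart open_ball])
    show "?V \<subseteq> W" "?V \<subseteq> W'" using sub by blast+
    show "q \<in> ?V" by (rule qV')
    fix x assume "x \<in> ?V" then show "f x - f q = f' x - f' q" using kV[of x] kV[OF qV'] by simp
  qed
qed

text \<open>Since \<open>\<xi> f = 1\<close>, some partial derivative of f is nonzero at p; the
  corresponding coordinate is replaced by f with the help of
  \<open>smooth_local_inverse_shear\<close>. A ball as image makes the slices connected.\<close>

lemma adapted_chart:
  assumes f: "first_integral W f" and p: "p \<in> W"
  obtains V \<mu> b r where "(V, \<mu>) \<in> smooth_charts A" "p \<in> V" "V \<subseteq> W" "b \<in> Basis" "r > 0"
    "\<mu> ` V = ball (\<mu> p) r" "\<And>x. x \<in> V \<Longrightarrow> \<mu> x \<bullet> b = f x"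
proof -
  obtain U \<kappa> V c d where chart: "(U, \<kappa>) \<in> smooth_charts A" and cf: "coord_frame U \<kappa> V c d"
    and U: "p \<in> U" and pV: "p \<in> V"
    by (rule coord_frame_at)
  have fC: "f \<in> C" and W: "open W" using f by (auto simp: first_integral_def)
  let ?f = "\<lambda>y. f (inv_into U \<kappa> y)"
  have "\<exists>b\<in>Basis. deriv_at ?f (\<kappa> p) b \<noteq> 0"
  proof (rule ccontr)
    assume "\<not> ?thesis"
    then have 0: "deriv_at ?f (\<kappa> p) b = 0" if "b \<in> Basis" for b using that by blast
    have "d b f p = 0" if "b \<in> Basis" for b
      using cf that fC pV 0[OF that] by (simp add: coord_frame_def)
    then have "\<xi> f p = 0" using coord_frame_expand[OF chart cf xi(1) fC pV] by simp
    moreover have "\<eta> \<xi> p = \<xi> f p" using f p xi(1) unfolding first_integral_def by blast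
    then have "\<xi> f p = 1" using xi(2) by simp
    ultimately show False by simp
  qed
  then obtain b where b: "b \<in> Basis" "deriv_at ?f (\<kappa> p) b \<noteq> 0" by blast
  let ?S = "\<kappa> ` (U \<inter> W)"
  define \<Phi> where "\<Phi> = (\<lambda>x. x + (?f x - x \<bullet> b) *\<^sub>R b)"
  have S: "open ?S" "\<kappa> p \<in> ?S" using chart_image_open_subset[OF chart W] U p by blast+
  have fS: "smooth_on ?f ?S" by (rule smooth_on_subset[OF smooth_function_chart[OF chart fC]]) auto
  obtain T r where T: "open T" "\<kappa> p \<in> T" "T \<subseteq> ?S" "r > 0" "inj_on \<Phi> T" "\<Phi> ` T = ball (\<Phi> (\<kappa> p)) r"
    "smooth_on \<Phi> T" "smooth_on (inv_into T \<Phi>) (ball (\<Phi> (\<kappa> p)) r)"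
    using smooth_local_inverse_shear[OF S fS b] unfolding \<Phi>_def by blast
  define V where "V = {x \<in> U. \<kappa> x \<in> T}"
  define \<mu> where "\<mu> = \<Phi> \<circ> \<kappa>"
  have V: "open V" unfolding V_def by (rule chart_preimage_open[OF chart T(1)])
  have kV: "\<kappa> ` V = T" using T(3) by (auto simp: V_def)
  have mV: "\<mu> ` V = ball (\<mu> p) r" unfolding \<mu>_def image_comp[symmetric] by (simp only: kV T(6) o_apply)
  let ?g = "inv_into T \<Phi>"
  have gT: "?g y \<in> T" "\<Phi> (?g y) = y" if "y \<in> ball (\<mu> p) r" for y
    using that T(6) inv_into_into[of y \<Phi> T] f_inv_into_f[of y \<Phi> T] by (auto simp: \<mu>_def)
  have injm: "inj_on \<mu> V"
  proof -
    have "inj_on \<kappa> V" using chart_inv[OF chart] by (metis (no_types, lifting) V_def inj_on_inverseI mem_Collect_eq)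
    then show ?thesis unfolding \<mu>_def using T(5) kV by (simp add: comp_inj_on)
  qed
  have inv: "inv_into V \<mu> y = inv_into U \<kappa> (?g y)" if y: "y \<in> ball (\<mu> p) r" for y
  proof (rule inv_into_f_eq[OF injm])
    have k: "?g y \<in> \<kappa> ` U" using gT(1)[OF y] T(3) by blast
    then show "inv_into U \<kappa> (?g y) \<in> V"
      using gT(1)[OF y] chart_inv2[OF chart] by (simp add: V_def)
    show "\<mu> (inv_into U \<kappa> (?g y)) = y"
      using gT(2)[OF y] chart_inv2[OF chart k] by (simp add: \<mu>_def)
  qed
  have cinv: "continuous_on (ball (\<mu> p) r) (inv_into V \<mu>)"
  proof -
    have "continuous_on (ball (\<mu> p) r) ?g"
      using smooth_on_imp_continuous_on[OF T(8)] by (simp add: \<mu>_def)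
    then have "continuous_on (ball (\<mu> p) r) (\<lambda>y. inv_into U \<kappa> (?g y))"
      by (rule continuous_on_compose2[OF chart_inv_cont[OF chart]]) (use gT(1) T(3) in blast)
    then show ?thesis by (rule continuous_on_eq) (use inv in simp)
  qed
  have "(V, \<mu>) \<in> smooth_charts A"
    unfolding smooth_charts_def
  proof (intro CollectI conjI ballI)
    show "is_chart (V, \<mu>)"
      unfolding is_chart_def prod.case
    proof (intro conjI)
      show "open V" "open (\<mu> ` V)" using V mV by simp_all
      have "continuous_on V \<mu>" unfolding \<mu>_def
        using continuous_on_subset[OF chart_cont[OF chart]] smooth_on_imp_continuous_on[OF T(7)] kV
        by (intro continuous_on_compose) (auto simp: V_def)
      moreover have "continuous_on (\<mu> ` V) (inv_into V \<mu>)" using cinv mV by simp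
      ultimately show "homeomorphism V (\<mu> ` V) \<mu> (inv_into V \<mu>)"
        unfolding homeomorphism_def using injm by (auto simp: inv_into_into f_inv_into_f)
    qed
  next
    fix d assume d: "d \<in> A"
    obtain U' \<kappa>' where [simp]: "d = (U', \<kappa>')" by force
    have d': "(U', \<kappa>') \<in> A" using d by simp
    note chart' = atlas_charts[OF d']
    have o1: "open (\<mu> ` (V \<inter> U'))"
    proof -
      have "\<mu> ` (V \<inter> U') = ball (\<mu> p) r \<inter> inv_into V \<mu> -` U'"
        unfolding mV[symmetric] using injm by auto
      then show ?thesis
        using continuous_open_preimage[OF cinv open_ball chart_open[OF chart']] by simp
    qed
    have sub1: "\<mu> ` (V \<inter> U') \<subseteq> ball (\<mu> p) r" using mV by blast
    have "smooth_on (\<lambda>y. \<kappa>' (inv_into U \<kappa> (?g y))) (\<mu> ` (V \<inter> U'))"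
    proof (rule smooth_on_compose[OF o1 chart_image_open_subset[OF chart chart_open[OF chart']] _ _ chart_transitions(1)[OF chart d']])
      show "smooth_on ?g (\<mu> ` (V \<inter> U'))" using smooth_on_subset[OF T(8)] sub1 by (simp add: \<mu>_def)
      show "?g ` (\<mu> ` (V \<inter> U')) \<subseteq> \<kappa> ` (U \<inter> U')"
        using T(5) by (auto simp: \<mu>_def V_def)
    qed
    then have "smooth_on (\<kappa>' \<circ> inv_into V \<mu>) (\<mu> ` (V \<inter> U'))"
      by (subst smooth_on_cong[OF o1, of _ "\<lambda>y. \<kappa>' (inv_into U \<kappa> (?g y))"]) (use inv sub1 in auto)
    then show "smooth_transition (V, \<mu>) d" by (simp add: smooth_transition_def)
    have "smooth_on (\<lambda>y. \<Phi> (\<kappa> (inv_into U' \<kappa>' y))) (\<kappa>' ` (U' \<inter> V))"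
    proof (rule smooth_on_compose[OF chart_image_open_subset[OF chart' V] T(1) _ _ T(7)])
      show "smooth_on (\<lambda>y. \<kappa> (inv_into U' \<kappa>' y)) (\<kappa>' ` (U' \<inter> V))"
        by (rule smooth_on_subset[OF chart_transitions(2)[OF chart d']]) (auto simp: V_def)
      show "(\<lambda>y. \<kappa> (inv_into U' \<kappa>' y)) ` \<kappa>' ` (U' \<inter> V) \<subseteq> T"
        using chart_inv[OF chart'] by (auto simp: V_def)
    qed
    then show "smooth_transition d (V, \<mu>)" by (simp add: smooth_transition_def \<mu>_def o_def)
  qed
  moreover have "V \<subseteq> W"
  proof
    fix x assume "x \<in> V"
    then have "x \<in> U" "\<kappa> x \<in> ?S" using T(3) by (auto simp: V_def)
    then obtain z where "z \<in> U" "z \<in> W" "\<kappa> x = \<kappa> z" by blast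
    then show "x \<in> W" using chart_inv[OF chart] \<open>x \<in> U\<close> by metis
  qed
  moreover have "\<mu> x \<bullet> b = f x" if "x \<in> V" for x
    using that b(1) chart_inv[OF chart] by (simp add: \<mu>_def \<Phi>_def V_def inner_add_left)
  moreover have "p \<in> V" using U T(2) by (simp add: V_def)
  ultimately show ?thesis using that[of V \<mu> b r] b(1) T(4) mV by blast
qed

end


section \<open>Existence of leaves\<close>

context manifold
begin

text \<open>The coordinate line through \<open>\<kappa> x\<close> in direction c stays in the slice
  for small parameters, and F is 0 along it.\<close>

lemma slice_derivative_zero:
  assumes chart: "(U, \<kappa>) \<in> smooth_charts A" and F: "F \<in> C" and b: "b \<in> Basis" "c \<in> Basis" "c \<noteq> b"
    and x: "x \<in> U" and 0: "\<And>y. y \<in> U \<Longrightarrow> \<kappa> y \<bullet> b = \<kappa> x \<bullet> b \<Longrightarrow> F y = 0"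
  shows "deriv_at (in_chart U \<kappa> F) (\<kappa> x) c = 0"
proof -
  let ?F = "\<lambda>y. F (inv_into U \<kappa> y)"
  obtain r where r: "r > 0" "\<And>y. y \<in> cball (\<kappa> x) r \<Longrightarrow> y \<in> \<kappa> ` U"
    using chart_ball[OF chart open_UNIV x UNIV_I] by metis
  have "?F differentiable (at (\<kappa> x))"
    using smooth_on_imp_differentiable[OF smooth_function_chart[OF chart F]] x by blast
  then have d: "(?F has_derivative deriv_at ?F (\<kappa> x)) (at (\<kappa> x + 0 *\<^sub>R c))"
    by (simp add: frechet_derivative_works)
  have "((\<lambda>t. \<kappa> x + t *\<^sub>R c) has_derivative (\<lambda>s. s *\<^sub>R c)) (at 0)"
    by (auto intro!: derivative_eq_intros)
  from has_derivative_compose[OF this d]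
  have 1: "((\<lambda>t. ?F (\<kappa> x + t *\<^sub>R c)) has_derivative (\<lambda>s. deriv_at ?F (\<kappa> x) (s *\<^sub>R c))) (at 0)" .
  have "((\<lambda>t. ?F (\<kappa> x + t *\<^sub>R c)) has_derivative (\<lambda>s. 0)) (at 0)"
  proof (rule has_derivative_transform_within_open[of "\<lambda>_. 0" _ _ _ "ball 0 r"])
    fix t :: real assume t: "t \<in> ball 0 r"
    let ?y = "\<kappa> x + t *\<^sub>R c"
    have "?y \<in> cball (\<kappa> x) r" using t b by (simp add: dist_norm)
    then have y: "inv_into U \<kappa> ?y \<in> U" "\<kappa> (inv_into U \<kappa> ?y) = ?y" using r(2) chart_inv2[OF chart] by blast+
    moreover have "?y \<bullet> b = \<kappa> x \<bullet> b" using b by (simp add: inner_add_left inner_Basis)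
    ultimately show "0 = ?F ?y" using 0[of "inv_into U \<kappa> ?y"] by simp
  qed (use r in auto)
  then have "(\<lambda>s. deriv_at ?F (\<kappa> x) (s *\<^sub>R c)) = (\<lambda>s. 0)"
    using has_derivative_unique 1 by blast
  from fun_cong[OF this, of 1] show ?thesis by simp
qed

end

context closed_form
begin

text \<open>The first integral is not tied to a chart. As W may be shrunk, every open set of the
  manifold is \<open>leaf_open\<close>, so the topology obtained is a refinement.\<close>

definition leaf_open :: "'m set \<Rightarrow> bool" where
  "leaf_open S \<longleftrightarrow> (\<forall>q\<in>S. \<exists>W f. first_integral W f \<and> q \<in> W \<and> {x \<in> W. f x = f q} \<subseteq> S)"

definition leaf_topology :: "'m topology" where
  "leaf_topology = topology leaf_open"

lemma openin_leaf_topology: "openin leaf_topology = leaf_open"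
  unfolding leaf_topology_def
proof (rule topology_inverse')
  have "leaf_open (S \<inter> T)" if S: "leaf_open S" and T: "leaf_open T" for S T
    unfolding leaf_open_def
  proof
    fix q assume q: "q \<in> S \<inter> T"
    obtain W f where f: "first_integral W f" "q \<in> W" "{x \<in> W. f x = f q} \<subseteq> S"
      using S q unfolding leaf_open_def by blast
    obtain W' f' where f': "first_integral W' f'" "q \<in> W'" "{x \<in> W'. f' x = f' q} \<subseteq> T"
      using T q unfolding leaf_open_def by blast
    obtain V where V: "open V" "q \<in> V" "V \<subseteq> W" "V \<subseteq> W'" "\<And>x. x \<in> V \<Longrightarrow> f x - f q = f' x - f' q"
      using first_integral_unique[OF f(1) f'(1) f(2) f'(2)] by blast
    have "{x \<in> V. f x = f q} \<subseteq> S \<inter> T"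
    proof
      fix x assume x: "x \<in> {x \<in> V. f x = f q}"
      then have "f' x = f' q" using V(5)[of x] by simp
      then show "x \<in> S \<inter> T" using x f(3) f'(3) V(3,4) by blast
    qed
    then show "\<exists>W f. first_integral W f \<and> q \<in> W \<and> {x \<in> W. f x = f q} \<subseteq> S \<inter> T"
      using first_integral_subset[OF f(1) V(1,3)] V(2) by blast
  qed
  moreover have "leaf_open (\<Union>K)" if K: "\<forall>S\<in>K. leaf_open S" for K
    unfolding leaf_open_def
  proof
    fix q assume "q \<in> \<Union>K"
    then obtain S where S: "S \<in> K" "q \<in> S" by blast
    then obtain W f where "first_integral W f" "q \<in> W" "{x \<in> W. f x = f q} \<subseteq> S"
      using K unfolding leaf_open_def by blast
    then show "\<exists>W f. first_integral W f \<and> q \<in> W \<and> {x \<in> W. f x = f q} \<subseteq> \<Union>K"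
      using S by blast
  qed
  ultimately show "istopology leaf_open" unfolding istopology_def by blast
qed

lemma topspace_leaf_topology [simp]: "topspace leaf_topology = UNIV"
proof -
  have "leaf_open UNIV" unfolding leaf_open_def using first_integral_exists by blast
  then show ?thesis using openin_subset[of leaf_topology UNIV] by (auto simp: openin_leaf_topology)
qed

text \<open>The requirements of \<open>integral_manifold\<close> at q for the leaf topology,
  together with connectedness, which keeps P inside a connected component in
  \<open>leaf_exists\<close>.\<close>

definition plaque :: "'m \<Rightarrow> 'm set \<Rightarrow> bool" where
  "plaque q P \<longleftrightarrow> (\<exists>U \<kappa>. (U, \<kappa>) \<in> smooth_charts A \<and> q \<in> U \<and>
     (\<exists>b\<in>Basis. P = {x\<in>U. \<kappa> x \<bullet> b = \<kappa> q \<bullet> b}) \<and>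
     openin leaf_topology P \<and> subtopology leaf_topology P = top_of_set P \<and>
     (\<forall>x\<in>P. \<forall>X\<in>VF. \<eta> X x = 0 \<longleftrightarrow> (\<forall>F\<in>C. (\<forall>y\<in>P. F y = 0) \<longrightarrow> X F x = 0)) \<and> connected P)"

lemma plaque_exists: obtains P where "plaque q P" "q \<in> P"
proof -
  obtain W f where f: "first_integral W f" "q \<in> W" by (rule first_integral_exists)
  obtain V \<mu> b r where V: "(V, \<mu>) \<in> smooth_charts A" "q \<in> V" "V \<subseteq> W" "b \<in> Basis" "r > 0"
    "\<mu> ` V = ball (\<mu> q) r" "\<And>x. x \<in> V \<Longrightarrow> \<mu> x \<bullet> b = f x"
    using adapted_chart[OF f] by blast
  have oV: "open V" by (rule chart_open[OF V(1)])
  have fV: "first_integral V f" by (rule first_integral_subset[OF f(1) oV V(3)])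
  have fC: "f \<in> C" using f by (simp add: first_integral_def)
  define P where "P = {x \<in> V. \<mu> x \<bullet> b = \<mu> q \<bullet> b}"
  have P: "P = {x \<in> V. f x = f q}" using V(7) V(2) by (auto simp: P_def)
  have "leaf_open P"
    unfolding leaf_open_def
  proof
    fix x assume "x \<in> P"
    then have "x \<in> V" "{y \<in> V. f y = f x} \<subseteq> P" by (auto simp: P)
    then show "\<exists>W f. first_integral W f \<and> x \<in> W \<and> {y \<in> W. f y = f x} \<subseteq> P" using fV by blast
  qed
  then have oP: "openin leaf_topology P" by (simp add: openin_leaf_topology)
  \<comment> \<open>Within one level set the refinement adds nothing: near a point of P any other
    first integral differs from f by a constant, so it is constant on P there.\<close>
  have "subtopology leaf_topology P = top_of_set P"
    unfolding topology_eq
  proof (intro allI iffI)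
    fix S assume "openin (subtopology leaf_topology P) S"
    then have S: "leaf_open S" "S \<subseteq> P" using openin_open_subtopology[OF oP] by (auto simp: openin_leaf_topology)
    have "\<exists>T. open T \<and> x \<in> P \<inter> T \<and> P \<inter> T \<subseteq> S" if x: "x \<in> S" for x
    proof -
      obtain W' f' where f': "first_integral W' f'" "x \<in> W'" "{y \<in> W'. f' y = f' x} \<subseteq> S"
        using S(1) x unfolding leaf_open_def by blast
      have xP: "x \<in> P" using S(2) x by blast
      then have xV: "x \<in> V" "f x = f q" by (auto simp: P)
      obtain T where T: "open T" "x \<in> T" "T \<subseteq> V" "T \<subseteq> W'" "\<And>y. y \<in> T \<Longrightarrow> f y - f x = f' y - f' x"
        using first_integral_unique[OF fV f'(1) xV(1) f'(2)] by blast
      have "P \<inter> T \<subseteq> S"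
      proof
        fix y assume y: "y \<in> P \<inter> T"
        then have "f y = f x" using xV by (simp add: P)
        then have "f' y = f' x" using T(5)[of y] y by simp
        then show "y \<in> S" using f'(3) T(4) y by blast
      qed
      then show ?thesis using T xP by blast
    qed
    then show "openin (top_of_set P) S"
      by (subst openin_subopen) (metis openin_open_Int)
  next
    fix S assume "openin (top_of_set P) S"
    then obtain T where T: "open T" "S = P \<inter> T" by (auto simp: openin_open)
    have "leaf_open S"
      unfolding leaf_open_def
    proof
      fix x assume x: "x \<in> S"
      have "first_integral (V \<inter> T) f"
        by (rule first_integral_subset[OF fV]) (use oV T in auto)
      moreover have "x \<in> V \<inter> T" "{y \<in> V \<inter> T. f y = f x} \<subseteq> S" using x by (auto simp: T P)
      ultimately show "\<exists>W f. first_integral W f \<and> x \<in> W \<and> {y \<in> W. f y = f x} \<subseteq> S" by blast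
    qed
    then show "openin (subtopology leaf_topology P) S"
      using openin_open_subtopology[OF oP] T(2) by (simp add: openin_leaf_topology)
  qed
  moreover have "\<eta> X x = 0 \<longleftrightarrow> (\<forall>F\<in>C. (\<forall>y\<in>P. F y = 0) \<longrightarrow> X F x = 0)" if x: "x \<in> P" and X: "X \<in> VF" for x X
  proof -
    have xV: "x \<in> V" "f x = f q" using x by (auto simp: P)
    have \<eta>: "\<eta> X x = X f x" using fV X xV(1) by (simp add: first_integral_def)
    show ?thesis
    proof
      assume 0: "\<eta> X x = 0"
      show "\<forall>F\<in>C. (\<forall>y\<in>P. F y = 0) \<longrightarrow> X F x = 0"
      proof (intro ballI impI)
        fix F assume F: "F \<in> C" "\<forall>y\<in>P. F y = 0"
        obtain V' c d where cf: "coord_frame V \<mu> V' c d" and xV': "x \<in> V'"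
          using coord_frame_exists[OF V(1) xV(1)] by blast
        note V' = coord_frameD(1,2)[OF cf] and cC = coord_frameD(3)[OF cf] and cV' = coord_frameD(5)[OF cf]
        \<comment> \<open>Every summand vanishes: for e = b the coordinate is f, and X f x = 0; for
          the other directions F has derivative 0 along the slice.\<close>
        have "X F x = (\<Sum>e\<in>Basis. X (c e) x * deriv_at (in_chart V \<mu> F) (\<mu> x) e)"
          by (rule vf_coordinates[OF X V(1) xV(1) F(1) cC V'(1) xV' cV'])
        also have "\<dots> = 0"
        proof (rule sum.neutral, rule ballI)
          fix e :: 'e assume e: "e \<in> Basis"
          show "X (c e) x * deriv_at (in_chart V \<mu> F) (\<mu> x) e = 0"
          proof (cases "e = b")
            case True
            have "X (c e) x = X f x"
              by (rule vf_local[OF X cC[OF e] fC V'(1) xV']) (use True cV' e V(7) V'(2) in auto)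
            then show ?thesis using 0 \<eta> by simp
          next
            case False
            have "deriv_at (in_chart V \<mu> F) (\<mu> x) e = 0"
              by (rule slice_derivative_zero[OF V(1) F(1) V(4) e False xV(1)])
                (use F(2) x in \<open>auto simp: P_def\<close>)
            then show ?thesis by simp
          qed
        qed
        finally show "X F x = 0" .
      qed
    next
      assume *: "\<forall>F\<in>C. (\<forall>y\<in>P. F y = 0) \<longrightarrow> X F x = 0"
      have "f - (\<lambda>_. f q) \<in> C" using fC const_smooth by simp
      moreover have "\<forall>y\<in>P. (f - (\<lambda>_. f q)) y = 0" by (simp add: P)
      ultimately have "X (f - (\<lambda>_. f q)) x = 0" using * by blast
      then show "\<eta> X x = 0"
        using pd_diff[OF vf_point_derivation[OF X] fC const_smooth] pd_const[OF vf_point_derivation[OF X]] \<eta>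
        by simp
    qed
  qed
  \<comment> \<open>P corresponds to the intersection of a ball with a hyperplane, which is
    convex.\<close>
  moreover have "connected P"
  proof -
    let ?K = "ball (\<mu> q) r \<inter> {y. y \<bullet> b = \<mu> q \<bullet> b}"
    have "convex {y. y \<bullet> b = \<mu> q \<bullet> b}"
      using convex_hyperplane[of b "\<mu> q \<bullet> b"] by (simp add: inner_commute)
    then have K: "convex ?K" by (intro convex_Int convex_ball)
    have "P = inv_into V \<mu> ` ?K"
    proof (intro set_eqI iffI)
      fix x assume "x \<in> P"
      then have "x = inv_into V \<mu> (\<mu> x)" "\<mu> x \<in> ?K"
        using chart_inv[OF V(1), of x] V(6) by (auto simp: P_def)
      then show "x \<in> inv_into V \<mu> ` ?K" by blast
    next
      fix x assume "x \<in> inv_into V \<mu> ` ?K"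
      then obtain y where y: "y \<in> ?K" "x = inv_into V \<mu> y" by blast
      then have "y \<in> \<mu> ` V" using V(6) by blast
      then show "x \<in> P" using chart_inv2[OF V(1), of y] y by (auto simp: P_def)
    qed
    moreover have "connected (inv_into V \<mu> ` ?K)"
      by (intro connected_continuous_image convex_connected K
          continuous_on_subset[OF chart_inv_cont[OF V(1)]]) (use V(6) in auto)
    ultimately show ?thesis by simp
  qed
  ultimately have "plaque q P"
    unfolding plaque_def using V(1,2,4) oP P_def by blast
  moreover have "q \<in> P" using V(2) by (simp add: P_def)
  ultimately show ?thesis using that by blast
qed

lemma integral_manifold_slice:
  assumes "integral_manifold A \<eta> T" "q \<in> topspace T"
  obtains U \<kappa> P b where "(U, \<kappa>) \<in> smooth_charts A" "q \<in> U" "b \<in> Basis"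
    "P = {x\<in>U. \<kappa> x \<bullet> b = \<kappa> q \<bullet> b}" "openin T P" "subtopology T P = top_of_set P"
    "\<forall>x\<in>P. \<forall>X\<in>VF. \<eta> X x = 0 \<longleftrightarrow> (\<forall>F\<in>C. (\<forall>y\<in>P. F y = 0) \<longrightarrow> X F x = 0)"
proof -
  note bspec[OF assms(1)[unfolded integral_manifold_def] assms(2)]
  then show ?thesis by (elim exE conjE bexE) (rule that; assumption)
qed

text \<open>Makes the leaf topology coarser than that of any integral manifold, whence maximality of its components.\<close>
lemma integral_manifold_locally_level_set:
  assumes T: "integral_manifold A \<eta> T" and q: "q \<in> topspace T" and f: "first_integral W f" "q \<in> W"
  obtains N where "openin T N" "q \<in> N" "N \<subseteq> {x \<in> W. f x = f q}"
proof -
  obtain U \<kappa> P b where U: "(U, \<kappa>) \<in> smooth_charts A" "q \<in> U" "b \<in> Basis"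
    and P: "P = {x\<in>U. \<kappa> x \<bullet> b = \<kappa> q \<bullet> b}" "openin T P" "subtopology T P = top_of_set P"
    and tan: "\<forall>x\<in>P. \<forall>X\<in>VF. \<eta> X x = 0 \<longleftrightarrow> (\<forall>F\<in>C. (\<forall>y\<in>P. F y = 0) \<longrightarrow> X F x = 0)"
    by (rule integral_manifold_slice[OF T q])
  have fC: "f \<in> C" and W: "open W" using f by (auto simp: first_integral_def)
  obtain V c d where cf: "coord_frame U \<kappa> V c d" and qV: "q \<in> V"
    using coord_frame_exists[OF U(1,2)] by blast
  note V = coord_frameD(1,2)[OF cf] and dV = coord_frameD(4)[OF cf] and dF = coord_frameD(6)[OF cf]
  obtain r where r: "r > 0" "\<And>y. y \<in> cball (\<kappa> q) r \<Longrightarrow> y \<in> \<kappa> ` U \<and> inv_into U \<kappa> y \<in> V \<inter> W"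
    using chart_ball[OF U(1) open_Int[OF V(1) W] U(2)] qV f(2) by (metis IntI)
  let ?f = "\<lambda>y. f (inv_into U \<kappa> y)"
  define N where "N = P \<inter> {x \<in> U. \<kappa> x \<in> ball (\<kappa> q) r}"
  have "openin (top_of_set P) N"
    unfolding N_def by (intro openin_open_Int chart_preimage_open[OF U(1)] open_ball)
  then have oN: "openin T N" using P(2,3) openin_trans_full by metis
  have qN: "q \<in> N" using U(2) r(1) by (simp add: N_def P(1))
  have N: "x \<in> U" "\<kappa> x \<in> ball (\<kappa> q) r" "\<kappa> x \<bullet> b = \<kappa> q \<bullet> b" "x \<in> V" "x \<in> W" "x \<in> P" if "x \<in> N" for x
  proof -
    show x: "x \<in> U" "\<kappa> x \<in> ball (\<kappa> q) r" "\<kappa> x \<bullet> b = \<kappa> q \<bullet> b" "x \<in> P" using that by (auto simp: N_def P(1))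
    have "\<kappa> x \<in> cball (\<kappa> q) r" using x(2) by simp
    from r(2)[OF this] show "x \<in> V" "x \<in> W" using chart_inv[OF U(1) x(1)] by auto
  qed
  \<comment> \<open>For e different from b the coordinate field \<open>d e\<close> annihilates
    functions vanishing on P, so the tangency clause, read backwards, gives \<eta>(d e) = 0; and
    \<eta>(d e) is the derivative of f.\<close>
  have 0: "deriv_at ?f (\<kappa> x) e = 0" if x: "x \<in> N" and e: "e \<in> Basis" "e \<noteq> b" for x e
  proof -
    have "d e F x = 0" if F: "F \<in> C" "\<forall>y\<in>P. F y = 0" for F
    proof -
      have "deriv_at (in_chart U \<kappa> F) (\<kappa> x) e = 0"
        by (rule slice_derivative_zero[OF U(1) F(1) U(3) e N(1)[OF x]])
          (use F(2) N(3)[OF x] in \<open>auto simp: P(1)\<close>)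
      then show ?thesis using dF[OF e(1) F(1) N(4)[OF x]] by simp
    qed
    then have "\<eta> (d e) x = 0" using tan N(6)[OF x] dV[OF e(1)] by blast
    then have "d e f x = 0" using f(1) dV[OF e(1)] N(5)[OF x] by (auto simp: first_integral_def)
    then show ?thesis using dF[OF e(1) fC N(4)[OF x]] by simp
  qed
  have sm: "smooth_on ?f (ball (\<kappa> q) r)"
    by (rule smooth_on_subset[OF smooth_function_chart[OF U(1) fC]]) (use r(2) in auto)
  have "f x = f q" if x: "x \<in> N" for x
  proof -
    have "?f (\<kappa> x) = ?f (\<kappa> q) + (\<Sum>e\<in>Basis. ((\<kappa> x - \<kappa> q) \<bullet> e) * radial_integral (\<kappa> q) 0 (\<lambda>y. deriv_at ?f y e) (\<kappa> x))"
      by (rule hadamard[OF sm N(2)[OF x]])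
    also have "(\<Sum>e\<in>Basis. ((\<kappa> x - \<kappa> q) \<bullet> e) * radial_integral (\<kappa> q) 0 (\<lambda>y. deriv_at ?f y e) (\<kappa> x)) = 0"
    proof (rule sum.neutral, rule ballI)
      fix e :: 'e assume e: "e \<in> Basis"
      show "((\<kappa> x - \<kappa> q) \<bullet> e) * radial_integral (\<kappa> q) 0 (\<lambda>y. deriv_at ?f y e) (\<kappa> x) = 0"
      proof (cases "e = b")
        case True
        then show ?thesis using N(3)[OF x] by (simp add: inner_diff_left)
      next
        case False
        \<comment> \<open>The segment from \<open>\<kappa> q\<close> to \<open>\<kappa> x\<close>
          runs inside the slice because its end points have equal b-coordinates; hence Hadamard's
          coefficient is the integral of 0.\<close>
        have z: "t ^ 0 * deriv_at ?f (\<kappa> q + t *\<^sub>R (\<kappa> x - \<kappa> q)) e = 0" if t: "t \<in> {0..1}" for t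
        proof -
          let ?y = "\<kappa> q + t *\<^sub>R (\<kappa> x - \<kappa> q)"
          have y: "?y \<in> ball (\<kappa> q) r" by (rule radial_in_ball[OF N(2)[OF x] t])
          then have yU: "?y \<in> \<kappa> ` U" using r(2) by (meson ball_subset_cball subsetD)
          then have y': "inv_into U \<kappa> ?y \<in> U" "\<kappa> (inv_into U \<kappa> ?y) = ?y" using chart_inv2[OF U(1)] by blast+
          have "?y \<bullet> b = \<kappa> q \<bullet> b" using N(3)[OF x] by (simp add: inner_add_left inner_diff_left)
          then have "inv_into U \<kappa> ?y \<in> N" using y' y by (simp add: N_def P(1))
          from 0[OF this e False] show ?thesis by (simp add: y'(2))
        qed
        have "radial_integral (\<kappa> q) 0 (\<lambda>y. deriv_at ?f y e) (\<kappa> x) = integral {0..1} (\<lambda>t::real. 0)"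
          unfolding radial_integral_def by (rule integral_cong[OF z])
        then show ?thesis by simp
      qed
    qed
    finally show ?thesis using chart_inv[OF U(1) N(1)[OF x]] chart_inv[OF U(1,2)] by simp
  qed
  then have "N \<subseteq> {x \<in> W. f x = f q}" using N(5) by blast
  then show ?thesis using that oN qN by blast
qed

lemma leaf_exists:
  obtains T where "is_leaf A \<eta> T" "p \<in> topspace T"
proof -
  define L where "L = connected_component_of_set leaf_topology p"
  define T where "T = subtopology leaf_topology L"
  have top: "topspace T = L" by (simp add: T_def)
  have pL: "p \<in> L" by (simp add: L_def connected_component_of_refl)
  have cL: "connectedin leaf_topology L" unfolding L_def by (rule connectedin_connected_component_of)
  have sub: "P \<subseteq> L" if P: "connectedin leaf_topology P" "q \<in> P" "q \<in> L" for P q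
  proof -
    have "connectedin leaf_topology (P \<union> L)"
      by (rule connectedin_Un[OF P(1) cL]) (use P in blast)
    then have "P \<union> L \<subseteq> L" using pL unfolding L_def by (intro connected_component_of_maximal) auto
    then show ?thesis by blast
  qed
  have conn: "connected_space T" unfolding T_def by (rule connected_space_subtopology[OF cL])
  have "integral_manifold A \<eta> T"
    unfolding integral_manifold_def
  proof
    fix q assume "q \<in> topspace T"
    then have q: "q \<in> L" by (simp add: top)
    obtain P where P: "plaque q P" "q \<in> P" by (rule plaque_exists)
    then obtain U \<kappa> where U: "(U, \<kappa>) \<in> smooth_charts A" "q \<in> U" "\<exists>b\<in>Basis. P = {x\<in>U. \<kappa> x \<bullet> b = \<kappa> q \<bullet> b}"
      and oP: "openin leaf_topology P" "subtopology leaf_topology P = top_of_set P"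
      and tan: "\<forall>x\<in>P. \<forall>X\<in>VF. \<eta> X x = 0 \<longleftrightarrow> (\<forall>F\<in>C. (\<forall>y\<in>P. F y = 0) \<longrightarrow> X F x = 0)"
      and cP: "connected P"
      unfolding plaque_def by blast
    have "connectedin leaf_topology P"
      unfolding connectedin_def oP(2) using cP connectedin_iff_connected[of P] unfolding connectedin_def by simp
    then have PL: "P \<subseteq> L" using sub P(2) q by blast
    have "openin T P" unfolding T_def using openin_subtopology_Int[OF oP(1), of L] PL by (simp add: Int_absorb2)
    moreover have "subtopology T P = top_of_set P"
      unfolding T_def subtopology_subtopology using PL oP(2) by (simp add: Int_absorb1)
    ultimately show "\<exists>U \<kappa> P. (U, \<kappa>) \<in> smooth_charts A \<and> q \<in> U \<and>
        (\<exists>b\<in>Basis. P = {x\<in>U. \<kappa> x \<bullet> b = \<kappa> q \<bullet> b}) \<and>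
        openin T P \<and> subtopology T P = top_of_set P \<and>
        (\<forall>x\<in>P. \<forall>X\<in>VF. \<eta> X x = 0 \<longleftrightarrow> (\<forall>F\<in>C. (\<forall>y\<in>P. F y = 0) \<longrightarrow> X F x = 0))"
      using U tan by blast
  qed
  moreover have "topspace T' = topspace T"
    if T': "integral_manifold A \<eta> T'" "connected_space T'" "topspace T \<subseteq> topspace T'" for T'
  proof -
    \<comment> \<open>Continuity of the identity transports the connectedness of T' to the leaf
      topology, where it cannot exceed the component L.\<close>
    have "continuous_map T' leaf_topology id"
      unfolding continuous_map_def
    proof (intro conjI allI impI)
      fix S assume S: "openin leaf_topology S"
      show "openin T' {x \<in> topspace T'. id x \<in> S}"
      proof (subst openin_subopen, rule ballI)
        fix q assume q: "q \<in> {x \<in> topspace T'. id x \<in> S}"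
        then obtain W f where f: "first_integral W f" "q \<in> W" "{x \<in> W. f x = f q} \<subseteq> S"
          using S unfolding openin_leaf_topology leaf_open_def by auto
        obtain N where N: "openin T' N" "q \<in> N" "N \<subseteq> {x \<in> W. f x = f q}"
          using integral_manifold_locally_level_set[OF T'(1) _ f(1,2)] q by blast
        then have "N \<subseteq> {x \<in> topspace T'. id x \<in> S}" using f(3) openin_subset[OF N(1)] by auto
        then show "\<exists>N. openin T' N \<and> q \<in> N \<and> N \<subseteq> {x \<in> topspace T'. id x \<in> S}" using N by blast
      qed
    qed simp
    moreover have "connectedin T' (topspace T')" using T'(2) by (simp add: connectedin_topspace)
    ultimately have "connectedin leaf_topology (topspace T')"
      using connectedin_continuous_map_image by fastforce
    then have "topspace T' \<subseteq> L" using sub pL T'(3) top by blast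
    then show ?thesis using T'(3) top by blast
  qed
  ultimately have "is_leaf A \<eta> T" unfolding is_leaf_def using conn pL top by blast
  then show ?thesis using that pL top by blast
qed

end


section \<open>Restriction to leaves\<close>

definition restrict_to :: "'m topology \<Rightarrow> ('m \<Rightarrow> real) \<Rightarrow> 'm \<Rightarrow> real" where
  "restrict_to T F = (\<lambda>x. if x \<in> topspace T then F x else 0)"

lemma incl_related_iff:
  "incl_related A T q V X \<longleftrightarrow> (\<forall>F\<in>smooth_functions A. V (restrict_to T F) q = X F q)"
  by (simp add: incl_related_def restrict_to_def)

context manifold
begin

lemma leaf_functionE:
  assumes "f \<in> leaf_functions A T" "q \<in> topspace T"
  obtains P F where "openin T P" "q \<in> P" "F \<in> C" "\<And>x. x \<in> P \<Longrightarrow> f x = F x"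
proof -
  have "\<exists>P. openin T P \<and> q \<in> P \<and> (\<exists>F\<in>C. \<forall>x\<in>P. f x = F x)"
    using assms by (simp add: leaf_functions_def)
  then show ?thesis by (elim exE conjE bexE) (rule that, assumption+, erule (1) bspec)
qed

lemma leaf_function_pairE:
  assumes f: "f \<in> leaf_functions A T" and g: "g \<in> leaf_functions A T" and q: "q \<in> topspace T"
  obtains P F G where "openin T P" "q \<in> P" "F \<in> C" "G \<in> C" "\<forall>x\<in>P. f x = F x \<and> g x = G x"
proof -
  obtain P F where P: "openin T P" "q \<in> P" "F \<in> C" "\<And>x. x \<in> P \<Longrightarrow> f x = F x"
    using leaf_functionE[OF f q] by blast
  obtain P' G where P': "openin T P'" "q \<in> P'" "G \<in> C" "\<And>x. x \<in> P' \<Longrightarrow> g x = G x"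
    using leaf_functionE[OF g q] by blast
  show ?thesis
    by (rule that[of "P \<inter> P'" F G]) (use P P' in auto)
qed

lemma leaf_functionI:
  assumes "\<And>x. x \<notin> topspace T \<Longrightarrow> f x = 0"
    and "\<And>q. q \<in> topspace T \<Longrightarrow> \<exists>P F. openin T P \<and> q \<in> P \<and> F \<in> C \<and> (\<forall>x\<in>P. f x = F x)"
  shows "f \<in> leaf_functions A T"
  unfolding leaf_functions_def
proof (intro CollectI conjI allI impI ballI)
  fix q assume "q \<in> topspace T"
  from assms(2)[OF this] show "\<exists>P. openin T P \<and> q \<in> P \<and> (\<exists>F\<in>C. \<forall>x\<in>P. f x = F x)"
    by blast
qed (rule assms(1))

lemma leaf_function_outside: "f \<in> leaf_functions A T \<Longrightarrow> x \<notin> topspace T \<Longrightarrow> f x = 0"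
  by (simp add: leaf_functions_def)

lemma restrict_leaf_function: "F \<in> C \<Longrightarrow> restrict_to T F \<in> leaf_functions A T"
  by (rule leaf_functionI) (auto simp: restrict_to_def intro!: exI[of _ "topspace T"] bexI[of _ F])

lemma leaf_function_algebra: "fun_algebra (leaf_functions A T)"
proof
  show "0 \<in> leaf_functions A T"
    using restrict_leaf_function[OF zero_C, of T] by (simp add: restrict_to_def fun_eq_iff zero_fun_def)
next
  fix f and c :: real assume f: "f \<in> leaf_functions A T"
  show "(\<lambda>_. c) * f \<in> leaf_functions A T"
  proof (rule leaf_functionI)
    fix q assume "q \<in> topspace T"
    then obtain P F where P: "openin T P" "q \<in> P" "F \<in> C" "\<And>x. x \<in> P \<Longrightarrow> f x = F x"
      using leaf_functionE[OF f] by blast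
    then show "\<exists>P F. openin T P \<and> q \<in> P \<and> F \<in> C \<and> (\<forall>x\<in>P. ((\<lambda>_. c) * f) x = F x)"
      by (intro exI[of _ P] exI[of _ "(\<lambda>_. c) * F"]) simp
  qed (simp add: leaf_function_outside[OF f])
next
  fix f g assume f: "f \<in> leaf_functions A T" and g: "g \<in> leaf_functions A T"
  show "f + g \<in> leaf_functions A T"
  proof (rule leaf_functionI)
    fix q assume "q \<in> topspace T"
    then obtain P F G where P: "openin T P" "q \<in> P" "F \<in> C" "G \<in> C" "\<forall>x\<in>P. f x = F x \<and> g x = G x"
      by (rule leaf_function_pairE[OF f g])
    then show "\<exists>P F. openin T P \<and> q \<in> P \<and> F \<in> C \<and> (\<forall>x\<in>P. (f + g) x = F x)"
      by (intro exI[of _ P] exI[of _ "F + G"]) simp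
  qed (simp add: leaf_function_outside[OF f] leaf_function_outside[OF g])
  show "f * g \<in> leaf_functions A T"
  proof (rule leaf_functionI)
    fix q assume "q \<in> topspace T"
    then obtain P F G where P: "openin T P" "q \<in> P" "F \<in> C" "G \<in> C" "\<forall>x\<in>P. f x = F x \<and> g x = G x"
      by (rule leaf_function_pairE[OF f g])
    then show "\<exists>P F. openin T P \<and> q \<in> P \<and> F \<in> C \<and> (\<forall>x\<in>P. (f * g) x = F x)"
      by (intro exI[of _ P] exI[of _ "F * G"]) simp
  qed (simp add: leaf_function_outside[OF f])
qed

abbreviation "leaf_fields T \<equiv> vector_fields (leaf_functions A T)"

text \<open>A leaf field need not be the restriction of a vector field, but at a single point it agrees with one.\<close>
lemma leaf_field_value:
  assumes V: "V \<in> leaf_fields T" and q: "q \<in> topspace T"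
  obtains X where "X \<in> VF" "incl_related A T q V X"
proof -
  interpret L: fun_algebra "leaf_functions A T" by (rule leaf_function_algebra)
  define \<delta> where "\<delta> = (\<lambda>F. V (restrict_to T F) q)"
  have pd: "point_derivation q \<delta>"
    unfolding point_derivation_def
  proof (intro conjI ballI allI)
    fix F G assume F: "F \<in> C" and G: "G \<in> C"
    have "restrict_to T (F + G) = restrict_to T F + restrict_to T G"
      by (simp add: restrict_to_def fun_eq_iff)
    then show "\<delta> (F + G) = \<delta> F + \<delta> G"
      by (simp add: \<delta>_def L.vf_add[OF V] restrict_leaf_function F G)
    have "restrict_to T (F * G) = restrict_to T F * restrict_to T G"
      by (simp add: restrict_to_def fun_eq_iff)
    then show "\<delta> (F * G) = \<delta> F * G q + F q * \<delta> G"
      using q by (simp add: \<delta>_def L.vf_mult[OF V] restrict_leaf_function F G) (simp add: restrict_to_def)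
  next
    fix c :: real and F assume F: "F \<in> C"
    have "restrict_to T ((\<lambda>_. c) * F) = (\<lambda>_. c) * restrict_to T F"
      by (simp add: restrict_to_def fun_eq_iff)
    then show "\<delta> ((\<lambda>_. c) * F) = c * \<delta> F"
      by (simp add: \<delta>_def L.vf_scale[OF V] restrict_leaf_function F)
  qed
  obtain U \<kappa> W c d where chart: "(U, \<kappa>) \<in> smooth_charts A" and cf: "coord_frame U \<kappa> W c d"
    and U: "q \<in> U" and qW: "q \<in> W"
    by (rule coord_frame_at)
  note W = coord_frameD(1)[OF cf] and cd = coord_frameD(3,4)[OF cf] and cW = coord_frameD(5)[OF cf]
    and dF = coord_frameD(6)[OF cf]
  let ?X = "\<Sum>b\<in>Basis. cmul (\<delta> (c b)) (d b)"
  have "?X F q = \<delta> F" if F: "F \<in> C" for F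
  proof -
    have "\<delta> F = (\<Sum>b\<in>Basis. \<delta> (c b) * deriv_at (in_chart U \<kappa> F) (\<kappa> q) b)"
      by (rule pd_coordinates[OF pd chart U F cd(1) W qW cW])
    then show ?thesis using dF[OF _ F qW] by (simp add: sum_fun_apply)
  qed
  then have "incl_related A T q V ?X" by (simp add: incl_related_iff \<delta>_def)
  moreover have "?X \<in> VF" using cd by (intro VF_sum) simp
  ultimately show ?thesis using that by blast
qed

lemma restrict_leaf_eqI:
  assumes "f \<in> leaf_functions A T" "\<And>q. q \<in> topspace T \<Longrightarrow> f q = F q"
  shows "f = restrict_to T F"
proof
  fix x show "f x = restrict_to T F x"
    using assms leaf_function_outside[OF assms(1)] by (simp add: restrict_to_def)
qed

text \<open>V and X are related by the inclusion at every point of the leaf. Relatedness of fields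
  is the classical condition that passes to brackets.\<close>

definition leaf_restriction :: "'m topology \<Rightarrow> 'm vfield \<Rightarrow> 'm vfield \<Rightarrow> bool" where
  "leaf_restriction T V X \<longleftrightarrow> V \<in> leaf_fields T \<and> X \<in> VF \<and> (\<forall>q\<in>topspace T. incl_related A T q V X)"

lemma leaf_restriction_apply:
  assumes V: "leaf_restriction T V X" and F: "F \<in> C"
  shows "V (restrict_to T F) = restrict_to T (X F)"
proof (rule restrict_leaf_eqI)
  interpret L: fun_algebra "leaf_functions A T" by (rule leaf_function_algebra)
  show "V (restrict_to T F) \<in> leaf_functions A T"
    using V restrict_leaf_function[OF F] by (simp add: leaf_restriction_def)
  show "V (restrict_to T F) q = X F q" if "q \<in> topspace T" for q
    using V F that by (simp add: leaf_restriction_def incl_related_iff)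
qed

lemma leaf_restriction_bracket:
  assumes V: "leaf_restriction T V X" and W: "leaf_restriction T W Y"
  shows "leaf_restriction T (bracket V W) (bracket X Y)"
proof -
  interpret L: fun_algebra "leaf_functions A T" by (rule leaf_function_algebra)
  have VF: "V \<in> leaf_fields T" "W \<in> leaf_fields T" "X \<in> VF" "Y \<in> VF"
    using V W by (auto simp: leaf_restriction_def)
  have "bracket V W (restrict_to T F) q = bracket X Y F q" if F: "F \<in> C" and q: "q \<in> topspace T" for F q
    using VF F q
    by (simp add: bracket_apply leaf_restriction_apply[OF V] leaf_restriction_apply[OF W])
      (simp add: restrict_to_def)
  then show ?thesis using VF by (simp add: leaf_restriction_def incl_related_iff)
qed

text \<open>Each term of Koszul's formula for the leaf is, at q, the corresponding ambient term.
  Comparing pairings with restricted fields avoids constructing the tangential projection of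
  \<open>D X Y\<close>.\<close>

lemma koszul_leaf:
  assumes G: "metric_connection C g D" and \<Gamma>: "metric_connection (leaf_functions A T) \<gamma> DL"
    and ind: "induced_metric A T g \<gamma>"
    and V: "leaf_restriction T V X" and W: "leaf_restriction T W Y" and U: "leaf_restriction T U Z"
    and q: "q \<in> topspace T"
  shows "\<gamma> (DL V W) U q = g (D X Y) Z q"
proof -
  interpret G: metric_connection C g D by (rule G)
  interpret L: metric_connection "leaf_functions A T" \<gamma> DL by (rule \<Gamma>)
  have \<gamma>: "\<gamma> V W q = g X Y q" if "leaf_restriction T V X" "leaf_restriction T W Y" "q \<in> topspace T" for V W X Y q
    using ind that unfolding induced_metric_def leaf_restriction_def by blast
  have \<gamma>': "\<gamma> V W = restrict_to T (g X Y)" if "leaf_restriction T V X" "leaf_restriction T W Y" for V W X Y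
  proof (rule restrict_leaf_eqI)
    show "\<gamma> V W \<in> leaf_functions A T" using that by (simp add: leaf_restriction_def)
  qed (rule \<gamma>[OF that])
  have d: "U (\<gamma> V W) q = Z (g X Y) q"
    if "leaf_restriction T V X" "leaf_restriction T W Y" "leaf_restriction T U Z" for U V W X Y Z
  proof -
    have "g X Y \<in> C" using that by (simp add: leaf_restriction_def)
    from leaf_restriction_apply[OF that(3) this] show ?thesis
      unfolding \<gamma>'[OF that(1,2)] using q by (simp add: restrict_to_def)
  qed
  have VF: "V \<in> leaf_fields T" "W \<in> leaf_fields T" "U \<in> leaf_fields T" "X \<in> VF" "Y \<in> VF" "Z \<in> VF"
    using V W U by (auto simp: leaf_restriction_def)
  note b = leaf_restriction_bracket
  have "(2 * \<gamma> (DL V W) U) q = (2 * g (D X Y) Z) q"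
    unfolding L.koszul[OF VF(1-3)] G.koszul[OF VF(4-6)]
    using d[OF W U V] d[OF U V W] d[OF V W U] \<gamma>[OF b[OF V W] U q] \<gamma>[OF b[OF W U] V q] \<gamma>[OF b[OF U V] W q]
    by simp
  then show ?thesis by simp
qed

text \<open>\<open>koszul_leaf\<close> turns the two summands into pairings of
  \<open>J (DL V W)\<close> with U and of \<open>DL V W\<close> with \<open>J U\<close>. At q the
  field \<open>DL V W\<close> has the value of some ambient Y', and skewness of \<phi> makes these
  pairings opposite.\<close>

lemma leaf_parallel:
  assumes G: "metric_connection C g D" and \<phi>: "\<And>X. X \<in> VF \<Longrightarrow> \<phi> X \<in> VF"
    and skew: "\<And>X Y. X \<in> VF \<Longrightarrow> Y \<in> VF \<Longrightarrow> g (\<phi> X) Y = - g X (\<phi> Y)"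
    and ind: "induced_metric A T g \<gamma>" "induced_endo A T \<phi> J"
    and DL: "levi_civita (leaf_functions A T) \<gamma> DL"
    and par: "\<And>V W. V \<in> leaf_fields T \<Longrightarrow> W \<in> leaf_fields T \<Longrightarrow> DL V (J W) - J (DL V W) = 0"
    and V: "leaf_restriction T V X" and W: "leaf_restriction T W Y" and U: "leaf_restriction T U Z"
    and q: "q \<in> topspace T"
  shows "g (D X (\<phi> Y)) Z q + g (D X Y) (\<phi> Z) q = 0"
proof -
  have \<Gamma>: "metric_connection (leaf_functions A T) \<gamma> DL"
    using leaf_function_algebra ind(1) DL
    by (simp add: metric_connection_def metric_connection_axioms_def induced_metric_def)
  interpret L: metric_connection "leaf_functions A T" \<gamma> DL by (rule \<Gamma>)
  have J: "leaf_restriction T (J V) (\<phi> X)" if "leaf_restriction T V X" for V X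
    using that ind(2) \<phi> unfolding leaf_restriction_def induced_endo_def endo_field_def by blast
  have VF: "V \<in> leaf_fields T" "W \<in> leaf_fields T" "U \<in> leaf_fields T" "X \<in> VF" "Y \<in> VF" "Z \<in> VF"
    using V W U by (auto simp: leaf_restriction_def)
  let ?B = "DL V W"
  have B: "?B \<in> leaf_fields T" using VF by simp
  obtain Y' where Y': "Y' \<in> VF" "incl_related A T q ?B Y'" by (rule leaf_field_value[OF B q])
  have JB: "J ?B \<in> leaf_fields T" "incl_related A T q (J ?B) (\<phi> Y')"
    using ind(2) B Y' q unfolding induced_endo_def endo_field_def by blast+
  have "\<gamma> (J ?B) U q = g (\<phi> Y') Z q"
    using ind(1) JB \<phi>[OF Y'(1)] U q unfolding induced_metric_def leaf_restriction_def by blast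
  moreover have "\<gamma> ?B (J U) q = g Y' (\<phi> Z) q"
    using ind(1) B Y' J[OF U] q unfolding induced_metric_def leaf_restriction_def by blast
  moreover have "DL V (J W) = J ?B" using par[OF VF(1,2)] by simp
  then have "\<gamma> (J ?B) U q = g (D X (\<phi> Y)) Z q"
    using koszul_leaf[OF G \<Gamma> ind(1) V J[OF W] U q] by simp
  moreover have "\<gamma> ?B (J U) q = g (D X Y) (\<phi> Z) q"
    by (rule koszul_leaf[OF G \<Gamma> ind(1) V W J[OF U] q])
  ultimately show ?thesis using skew[OF Y'(1) VF(6)] by simp
qed

end

context closed_form
begin

text \<open>The value of \<open>X\<close> on a leaf function does not depend on the local extension used to compute it.\<close>
lemma tangent_local:
  assumes T: "integral_manifold A \<eta> T" and X: "X \<in> VF" and x: "x \<in> topspace T" "\<eta> X x = 0"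
    and F: "F \<in> C" "G \<in> C" and P: "openin T P" "x \<in> P" "\<And>y. y \<in> P \<Longrightarrow> F y = G y"
  shows "X F x = X G x"
proof -
  obtain U \<kappa> P' b where U: "(U, \<kappa>) \<in> smooth_charts A" "x \<in> U" "b \<in> Basis"
    and P': "P' = {y\<in>U. \<kappa> y \<bullet> b = \<kappa> x \<bullet> b}" "openin T P'" "subtopology T P' = top_of_set P'"
    and tan: "\<forall>x\<in>P'. \<forall>X\<in>VF. \<eta> X x = 0 \<longleftrightarrow> (\<forall>F\<in>C. (\<forall>y\<in>P'. F y = 0) \<longrightarrow> X F x = 0)"
    by (rule integral_manifold_slice[OF T x(1)])
  have xP': "x \<in> P'" using U(2) P'(1) by simp
  \<comment> \<open>P is open only in the topology of the leaf. Within the slice P' it is cut out by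
    an open set S of the manifold, and a bump function supported in S makes B (F - G) vanish on all
    of P', so that the tangency clause applies.\<close>
  have "openin (top_of_set P') (P \<inter> P')"
    using openin_subtopology_Int[OF P(1), of P'] P'(3) by simp
  then obtain S where S: "open S" "P \<inter> P' = P' \<inter> S" by (auto simp: openin_open)
  have xS: "x \<in> S" using S(2) P(2) xP' by blast
  obtain B V where B: "B \<in> C" "x \<in> V" "\<And>y. y \<in> V \<Longrightarrow> B y = 1" "\<And>y. y \<notin> S \<Longrightarrow> B y = 0"
    using bump_function[OF S(1) xS] by metis
  have "B * (F - G) \<in> C" using B F by simp
  moreover have "(B * (F - G)) y = 0" if "y \<in> P'" for y
    using that B(4)[of y] P(3)[of y] S(2) by (cases "y \<in> S") auto
  ultimately have "X (B * (F - G)) x = 0" using tan xP' X x(2) by blast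
  then have "B x * (X F x - X G x) = 0"
    using F B(1) P by (simp add: vf_mult[OF X] vf_diff[OF X])
  then show ?thesis using B(2,3) by simp
qed

text \<open>A leaf function has ambient extensions only locally, so V applies X to a chosen one at
  each point. By \<open>tangent_local\<close> the choice is immaterial, and the laws of a derivation
  follow from those of X with extensions valid on a common neighbourhood.\<close>

lemma leaf_restriction_exists:
  assumes T: "integral_manifold A \<eta> T" and X: "X \<in> VF" and 0: "\<And>x. x \<in> topspace T \<Longrightarrow> \<eta> X x = 0"
  obtains V where "leaf_restriction T V X"
proof -
  interpret L: fun_algebra "leaf_functions A T" by (rule leaf_function_algebra)
  let ?rep = "\<lambda>f x F. F \<in> C \<and> (\<exists>P. openin T P \<and> x \<in> P \<and> (\<forall>y\<in>P. f y = F y))"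
  define V where "V = (\<lambda>f x. if f \<in> leaf_functions A T \<and> x \<in> topspace T then X (SOME F. ?rep f x F) x else 0)"
  have V: "V f x = X F x"
    if f: "f \<in> leaf_functions A T" and F: "F \<in> C" and P: "openin T P" "x \<in> P" "\<And>y. y \<in> P \<Longrightarrow> f y = F y"
    for f F P x
  proof -
    have x: "x \<in> topspace T" using P(1,2) openin_subset by blast
    define G where "G = (SOME F. ?rep f x F)"
    have "?rep f x F" using F P by blast
    then have "?rep f x G" unfolding G_def by (rule someI[where P = "?rep f x"])
    then obtain P' where P': "G \<in> C" "openin T P'" "x \<in> P'" "\<And>y. y \<in> P' \<Longrightarrow> f y = G y" by blast
    have "G y = F y" if "y \<in> P \<inter> P'" for y using that P(3)[of y] P'(4)[of y] by simp
    then have "X G x = X F x"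
      using tangent_local[OF T X x 0[OF x] P'(1) F openin_Int[OF P(1) P'(2)]] P(2) P'(3) by blast
    then have "X (SOME F. ?rep f x F) x = X F x" by (simp only: G_def)
    then show ?thesis using f x by (simp add: V_def)
  qed
  have out: "V f x = 0" if "x \<notin> topspace T" for f x using that by (simp add: V_def)
  have "V \<in> leaf_fields T"
  proof (rule L.VF_I)
    fix f assume f: "f \<in> leaf_functions A T"
    show "V f \<in> leaf_functions A T"
    proof (rule leaf_functionI)
      fix q assume "q \<in> topspace T"
      from leaf_functionE[OF f this] obtain P F
        where P: "openin T P" "q \<in> P" "F \<in> C" "\<And>x. x \<in> P \<Longrightarrow> f x = F x" by blast
      have "\<forall>x\<in>P. V f x = X F x" using V[OF f P(3,1) _ P(4)] by blast
      then show "\<exists>P F. openin T P \<and> q \<in> P \<and> F \<in> C \<and> (\<forall>x\<in>P. V f x = F x)"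
        using P X by (intro exI[of _ P] exI[of _ "X F"]) simp
    qed (rule out)
    show "V ((\<lambda>_. c) * f) = (\<lambda>_. c) * V f" for c
    proof
      fix q show "V ((\<lambda>_. c) * f) q = ((\<lambda>_. c) * V f) q"
      proof (cases "q \<in> topspace T")
        case True
        from leaf_functionE[OF f this] obtain P F
          where P: "openin T P" "q \<in> P" "F \<in> C" "\<And>x. x \<in> P \<Longrightarrow> f x = F x" by blast
        have "V ((\<lambda>_. c) * f) q = X ((\<lambda>_. c) * F) q"
          by (rule V[OF L.scale_C[OF f] scale_C[OF P(3)] P(1,2)]) (simp add: P(4))
        moreover have "V f q = X F q" by (rule V[OF f P(3,1,2,4)])
        ultimately show ?thesis by (simp add: vf_scale[OF X P(3)])
      qed (simp add: out)
    qed
    fix g assume g: "g \<in> leaf_functions A T"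
    show "V (f + g) = V f + V g"
    proof
      fix q show "V (f + g) q = (V f + V g) q"
      proof (cases "q \<in> topspace T")
        case True
        obtain P F G where P: "openin T P" "q \<in> P" "F \<in> C" "G \<in> C"
          "\<forall>x\<in>P. f x = F x \<and> g x = G x" by (rule leaf_function_pairE[OF f g True])
        have "V (f + g) q = X (F + G) q"
          by (rule V[OF L.add_C[OF f g] add_C[OF P(3,4)] P(1,2)]) (simp add: P(5))
        moreover have "V f q = X F q" by (rule V[OF f P(3,1,2)]) (simp add: P(5))
        moreover have "V g q = X G q" by (rule V[OF g P(4,1,2)]) (simp add: P(5))
        ultimately show ?thesis by (simp add: vf_add[OF X P(3,4)])
      qed (simp add: out)
    qed
    show "V (f * g) = V f * g + f * V g"
    proof
      fix q show "V (f * g) q = (V f * g + f * V g) q"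
      proof (cases "q \<in> topspace T")
        case True
        obtain P F G where P: "openin T P" "q \<in> P" "F \<in> C" "G \<in> C"
          "\<forall>x\<in>P. f x = F x \<and> g x = G x" by (rule leaf_function_pairE[OF f g True])
        have "V (f * g) q = X (F * G) q"
          by (rule V[OF L.mult_C[OF f g] mult_C[OF P(3,4)] P(1,2)]) (simp add: P(5))
        moreover have "V f q = X F q" by (rule V[OF f P(3,1,2)]) (simp add: P(5))
        moreover have "V g q = X G q" by (rule V[OF g P(4,1,2)]) (simp add: P(5))
        ultimately show ?thesis using P(2,5) by (simp add: vf_mult[OF X P(3,4)])
      qed (simp add: out)
    qed
  next
    fix f assume "f \<notin> leaf_functions A T" then show "V f = 0" by (simp add: V_def fun_eq_iff)
  qed
  moreover have "V (restrict_to T F) q = X F q" if "q \<in> topspace T" "F \<in> C" for F q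
    by (rule V[OF restrict_leaf_function[OF that(2)] that(2) openin_topspace that(1)])
      (simp add: restrict_to_def)
  ultimately have "leaf_restriction T V X"
    using X by (simp add: leaf_restriction_def incl_related_iff)
  then show ?thesis using that by blast
qed

end


section \<open>The commutator formula\<close>

theorem theorem5:
  fixes A :: "('m::{t2_space,second_countable_topology}, 'e::euclidean_space) chart set"
    and n :: nat and \<alpha> :: real
    and \<phi> :: "'m vfield \<Rightarrow> 'm vfield" and \<xi> :: "'m vfield"
    and \<eta> :: "'m vfield \<Rightarrow> 'm \<Rightarrow> real" and g :: "'m vfield \<Rightarrow> 'm vfield \<Rightarrow> 'm \<Rightarrow> real"
    and D :: "'m vfield \<Rightarrow> 'm vfield \<Rightarrow> 'm vfield" and Q :: "'m vfield \<Rightarrow> 'm vfield"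
    and l :: "'m vfield \<Rightarrow> 'm vfield" and h :: "'m vfield \<Rightarrow> 'm vfield"
    and X :: "'m vfield"
  assumes "DIM('e) = 2 * n + 1"
    and "smooth_atlas A"
    and "almost_para_Kenmotsu (smooth_functions A) \<alpha> n \<phi> \<xi> \<eta> g"
    and "para_Kaehler_leaves A \<phi> \<eta> g"
    and "levi_civita (smooth_functions A) g D"
    and "is_ricci_operator (smooth_functions A) g D Q"
    and "l = jacobi_operator D \<xi>"
    and "h = h_operator \<phi> \<xi>"
    and "X \<in> vector_fields (smooth_functions A)"
  shows "Q (\<phi> X) - \<phi> (Q X) =
    l (\<phi> X) - \<phi> (l X) - cmul (4 * \<alpha> * (1 - real n)) (h X)
      - \<eta> X \<odot> \<phi> (Q \<xi>) + \<eta> (Q (\<phi> X)) \<odot> \<xi>"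
proof -
  let ?C = "smooth_functions A"
  interpret M: manifold A by (unfold_locales) (rule assms(2))
  have apm: "almost_paracontact_metric ?C n \<phi> \<xi> \<eta> g"
    using assms(3) unfolding almost_para_Kenmotsu_def by (rule conjunct1)
  have sym: "sym_form ?C g" and sig: "signature_at ?C g p (n + 1) n" for p
    using apm unfolding almost_paracontact_metric_def by simp_all
  have tens: "\<And>\<omega> X p. one_form ?C \<omega> \<Longrightarrow> X \<in> vector_fields ?C \<Longrightarrow> value_at X p = 0 \<Longrightarrow> \<omega> X p = 0"
    by (fact M.tensorial)
  interpret K: almost_Kenmotsu ?C g D n \<alpha> \<phi> \<xi> \<eta>
    by unfold_locales (fact sym assms(5) M.const_smooth tens sig assms(3))+
  interpret F: closed_form A \<eta> \<xi>
  proof unfold_locales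
    show "ext_deriv1 \<eta> X Y = 0" if "X \<in> vector_fields ?C" "Y \<in> vector_fields ?C" for X Y
      using K.eta_closed_form[OF that] by (simp add: ext_deriv1_def)
  qed (rule K.eta_form K.xi_VF K.eta_xi)+
  \<comment> \<open>The hypothesis on the leaves enters here, one point at a time: the three tangent
    fields restrict to a leaf through q, and \<open>leaf_parallel\<close> yields the identity at
    q.\<close>
  interpret P: para_Kenmotsu ?C g D n \<alpha> \<phi> \<xi> \<eta>
  proof unfold_locales
    fix X Y Z assume X: "X \<in> vector_fields ?C" "\<eta> X = 0" and Y: "Y \<in> vector_fields ?C" "\<eta> Y = 0"
      and Z: "Z \<in> vector_fields ?C" "\<eta> Z = 0"
    show "g (D X (\<phi> Y)) Z + g (D X Y) (\<phi> Z) = 0"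
    proof
      fix q
      obtain T where T: "is_leaf A \<eta> T" "q \<in> topspace T" by (rule F.leaf_exists)
      then have int: "integral_manifold A \<eta> T" by (simp add: is_leaf_def)
      obtain \<gamma> J DL where L: "induced_metric A T g \<gamma>" "induced_endo A T \<phi> J"
        "levi_civita (leaf_functions A T) \<gamma> DL"
        "\<forall>V\<in>M.leaf_fields T. \<forall>W\<in>M.leaf_fields T. DL V (J W) - J (DL V W) = 0"
        using assms(4)[unfolded para_Kaehler_leaves_def, rule_format, OF T(1)] by (elim exE conjE) (rule that)
      obtain V where V: "M.leaf_restriction T V X" by (rule F.leaf_restriction_exists[OF int X(1)]) (simp add: X)
      obtain W where W: "M.leaf_restriction T W Y" by (rule F.leaf_restriction_exists[OF int Y(1)]) (simp add: Y)
      obtain U where U: "M.leaf_restriction T U Z" by (rule F.leaf_restriction_exists[OF int Z(1)]) (simp add: Z)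
      have "g (D X (\<phi> Y)) Z q + g (D X Y) (\<phi> Z) q = 0"
        by (rule M.leaf_parallel[OF K.metric_connection_axioms K.phi_closed K.phi_skew L(1-3) _ V W U T(2)])
          (use L(4) in auto)
      then show "(g (D X (\<phi> Y)) Z + g (D X Y) (\<phi> Z)) q = 0 q" by simp
    qed
  qed
  show ?thesis
    unfolding assms(7,8) by (rule P.ricci_phi_commutator[OF assms(6,9)])
qed

end
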